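(* Let $x_0\in(0,\infty)$ be such that $g(x_0)>0$, and let $\varepsilon_n=\sqrt{n^{-1}\log n}$. Let $\hat V_n(x_0)$ be either $V_n(x_0)$ (for all $n$) or $\tilde V_n(x_0)$ (for all $n$). Suppose that: (a) $\sup_{t\in\mathbb R}|G_n(t)-G(t)|=O(\varepsilon_n)$; (b) $\varepsilon_n^{-2}\{U_n(x_0+\varepsilon_nt)-U_n(x_0)-\hat V_n(x_0)\varepsilon_nt\}\to\frac12t^2V'(x_0)$ as $n\to\infty$, uniformly on compact sets of $t\in\mathbb R$; (c) for each $\varepsilon>0$, $$\left|U_n(x_0+\beta)-U_n(x_0)-\beta\hat V_n(x_0)-\tfrac12\beta^2V'(x_0)\right|\le\varepsilon\beta^2+o(\beta^2)+O(\varepsilon_n^2)$$ for all large $n$, uniformly in $\beta$ varying over a neighborhood of zero (here $o(\beta^2)$ is as $\beta\to0$, uniformly in $n$, and $O(\varepsilon_n^2)$ is as $n\to\infty$, uniformly in $\beta$). Then the distribution of $$\Delta_n=\frac{\tilde V_n^{\#}(x_0)-\hat V_n(x_0)}{\varepsilon_n}$$ converges weakly to that of $W\stackrel{d}{=}\operatorname{LCM}_{\mathbb R}[\mathbb Z]'(0)$, where $W\sim N(0,\frac12g(x_0))$ and $\mathbb Z(t)=tW+\frac12t^2V'(x_0)$, $t\in\mathbb R$.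
   Context: Model: $\mathbf X=(X_1,X_2,X_3)$ is a random vector in $\mathbb R^3$ with a density of the form $\rho(x_1^2+x_2^2+x_3^2)$. $Y=X_1^2+X_2^2$ has distribution function $G$ with density $g(y)=\pi\int_y^\infty\frac{\rho(z)}{\sqrt{z-y}}\,dz$, and $V(y)=\int_y^\infty\frac{g(u)}{\sqrt{u-y}}\,du=\pi^2\int_y^\infty\rho(z)\,dz$, a nonincreasing function, assumed differentiable at $x_0$ with derivative $V'(x_0)$. Triangular array: $G_n$, $n\ge1$, are (nonrandom) distribution functions on $[0,\infty)$; $T_1,T_2,\ldots$ are i.i.d. Uniform$(0,1)$; $Y_{n,i}=G_n^{-1}(T_i)$, $1\le i\le n$, where $G_n^{-1}(u)=\inf\{x:G_n(x)\ge u\}$ (so $Y_{n,1},\ldots,Y_{n,n}$ are i.i.d. with distribution function $G_n$). Define $$V_n(y)=\int_y^\infty\frac{dG_n(u)}{\sqrt{u-y}},\quad U_n(x)=\int_0^xV_n(y)\,dy,\quad U_n^{\#}(x)=\frac2n\sum_{i=1}^n\left\{\sqrt{Y_{n,i}}-\sqrt{(Y_{n,i}-x)_+}\right\},$$ where $y_+=\max\{y,0\}$. For an interval $I$ and a function $h$, $\operatorname{LCM}_I[h]$ is the least concave majorant of the restriction of $h$ to $I$, and $'$ applied to it denotes the right derivative. Set $\tilde V_n=\operatorname{LCM}_{[0,\infty)}[U_n]'$ and $\tilde V_n^{\#}=\operatorname{LCM}_{[0,\infty)}[U_n^{\#}]'$.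
   Formalization: The condition V'(x_0) ≠ 0 (hence V'(x_0) < 0) is added; without it the claim fails, e.g. for ρ constant on [2,3] and zero elsewhere, x_0 = 1, G_n = G, where Δ_n tends to 0. *)

theory Defs
  imports "HOL-Probability.Probability" "HOL-Library.Landau_Symbols"
begin

text \<open>The density of \<open>X\<^sub>1\<^sup>2 + X\<^sub>2\<^sup>2\<close> when \<open>(X\<^sub>1, X\<^sub>2, X\<^sub>3)\<close> has the density
  \<open>\<rho> (x\<^sub>1\<^sup>2 + x\<^sub>2\<^sup>2 + x\<^sub>3\<^sup>2)\<close>. The integral diverges at most for \<open>y\<close> in a null set, and it
  converges wherever \<open>V_fun \<rho>\<close> below is differentiable and \<open>y > 0\<close>.\<close>

definition g_dens :: "(real \<Rightarrow> real) \<Rightarrow> real \<Rightarrow> real" where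
  "g_dens \<rho> y = pi * (LINT z:{y<..}|lborel. \<rho> z / sqrt (z - y))"

text \<open>By Tonelli and \<open>\<integral>\<^sub>y\<^sup>z du / (sqrt (z - u) sqrt (u - y)) = \<pi>\<close>, this equals
  \<open>\<pi>\<^sup>2 \<integral>\<^sub>y\<^sup>\<infinity> \<rho> z dz\<close> for \<open>y > 0\<close>, which is finite and nonincreasing in \<open>y\<close>.\<close>

definition V_fun :: "(real \<Rightarrow> real) \<Rightarrow> real \<Rightarrow> real" where
  "V_fun \<rho> y = (LINT u:{y<..}|lborel. g_dens \<rho> u / sqrt (u - y))"

text \<open>\<open>V_n\<close> and \<open>U_n\<close>, as functions of the probability measure \<open>\<mu>\<close> whose distribution
  function is \<open>G_n\<close>. \<open>V_n\<close> may be infinite on a null set, so it takes values in \<open>[0, \<infinity>]\<close>. The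
  Stieltjes integral over \<open>(y, \<infinity>)\<close> leaves out an atom at \<open>y\<close>, where the integrand is undefined.
  \<open>U_n\<close> is finite: for \<open>x \<ge> 0\<close> it is
  \<open>2 \<integral> (sqrt u - sqrt (max (u - x) 0)) d\<mu>(u) \<le> 2 sqrt x\<close>, when \<open>\<mu>\<close> lives on
  \<open>[0, \<infinity>)\<close>.\<close>

definition V_n :: "real measure \<Rightarrow> real \<Rightarrow> ennreal" where
  "V_n \<mu> y = (\<integral>\<^sup>+ u\<in>{y<..}. ennreal (1 / sqrt (u - y)) \<partial>\<mu>)"

definition U_n :: "real measure \<Rightarrow> real \<Rightarrow> real" where
  "U_n \<mu> x = enn2real (\<integral>\<^sup>+ y\<in>{0..x}. V_n \<mu> y \<partial>lborel)"

definition quantile :: "(real \<Rightarrow> real) \<Rightarrow> real \<Rightarrow> real" where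
  "quantile F u = Inf {x. F x \<ge> u}"

text \<open>\<open>U_n\<^sup>#\<close> as a function of the sample \<open>y 1, \<dots>, y n\<close>.\<close>

definition U_sharp :: "nat \<Rightarrow> (nat \<Rightarrow> real) \<Rightarrow> real \<Rightarrow> real" where
  "U_sharp n y x = 2 / real n * (\<Sum>i=1..n. sqrt (y i) - sqrt (max (y i - x) 0))"

text \<open>The pointwise infimum of the concave majorants of \<open>h\<close> on \<open>I\<close>; meaningful on \<open>I\<close>, and
  if \<open>h\<close> has a concave majorant on \<open>I\<close>.\<close>

definition least_concave_majorant :: "real set \<Rightarrow> (real \<Rightarrow> real) \<Rightarrow> real \<Rightarrow> real" where
  "least_concave_majorant I h x = (INF c\<in>{c. concave_on I c \<and> (\<forall>y\<in>I. h y \<le> c y)}. c x)"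

definition right_deriv :: "(real \<Rightarrow> real) \<Rightarrow> real \<Rightarrow> real" where
  "right_deriv f x = (THE D. (f has_real_derivative D) (at_right x))"

definition eps :: "nat \<Rightarrow> real" where
  "eps n = sqrt (ln (real n) / real n)"

definition V_tilde :: "real measure \<Rightarrow> real \<Rightarrow> real" where
  "V_tilde \<mu> = right_deriv (least_concave_majorant {0..} (U_n \<mu>))"

definition V_tilde_sharp :: "nat \<Rightarrow> (nat \<Rightarrow> real) \<Rightarrow> real \<Rightarrow> real" where
  "V_tilde_sharp n y = right_deriv (least_concave_majorant {0..} (U_sharp n y))"

end

theory Submission
  imports Defs "HOL-Real_Asymp.Real_Asymp"
begin

text \<open>Write \<open>\<psi>\<^sub>x(u) = 2 (\<surd>u - \<surd>(u - x)\<^sub>+)\<close>. Then \<open>U\<^sub>n(x)\<close> is the mean of \<open>\<psi>\<^sub>x\<close> under \<open>G\<^sub>n\<close> and \<open>U\<^sub>n\<^sup>#(x)\<close> the mean over the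
  sample, so the slope of the majorant of \<open>U\<^sub>n\<^sup>#\<close> is governed by the increments
  \<open>\<psi>\<^sub>x\<^sub>0\<^sub>+\<^sub>\<beta> - \<psi>\<^sub>x\<^sub>0\<close>. For an observation at distance \<open>w > 0\<close> to the right of \<open>x\<^sub>0\<close> that is large compared with \<open>\<beta>\<close>
  the increment is \<open>\<beta> / \<surd>w\<close> up to \<open>\<beta>\<^sup>2 / w\<^sup>3\<^sup>/\<^sup>2\<close>. The variable \<open>1 / \<surd>w\<close> has a logarithmically divergent second
  moment, and, cut off at distances of order \<open>\<epsilon>\<^sub>n\<close>, a second moment \<open>g(x\<^sub>0) ln (1 / \<epsilon>\<^sub>n) \<sim> g(x\<^sub>0) (ln n) / 2\<close>.
  The fluctuations of \<open>U\<^sub>n\<^sup>#\<close> around \<open>x\<^sub>0\<close> are therefore linear to leading order: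
  \<open>\<epsilon>\<^sub>n W\<^sub>n \<beta>\<close>, with \<open>W\<^sub>n\<close> the centred and normalized mean of the cut-off \<open>1 / \<surd>w\<close>. By a central limit theorem for
  triangular arrays \<open>W\<^sub>n\<close> has the limit law \<open>N(0, g(x\<^sub>0) / 2)\<close> (lemma \<open>linear_coeff_limit\<close>). The
  variance of the nonlinear remainder lacks the factor \<open>ln n\<close>.

  The local process is thus \<open>\<beta> (Vhat + \<epsilon>\<^sub>n W\<^sub>n) + \<beta>\<^sup>2 V' / 2\<close> up to \<open>o((\<epsilon>\<^sub>n)\<^sup>2)\<close>, at the scale \<open>\<beta> \<sim> \<epsilon>\<^sub>n\<close>. It is concave because
  \<open>V' < 0\<close>: Abel inversion gives \<open>V(y) = \<pi>\<^sup>2 \<integral>\<^sub>y\<^sup>\<infinity> \<rho>\<close>, which is nonincreasing. Hence its own majorant has the slope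
  \<open>Vhat + \<epsilon>\<^sub>n W\<^sub>n\<close> at \<open>x\<^sub>0\<close>. For the actual process this is made rigorous by one affine function of that slope
  which is a majorant of \<open>U\<^sub>n\<^sup>#\<close> on all of \<open>[0, \<infinity>)\<close> and exceeds \<open>U\<^sub>n\<^sup>#(x\<^sub>0)\<close> by \<open>o((\<epsilon>\<^sub>n)\<^sup>2)\<close> only (lemma
  \<open>nearly_touching_majorant\<close>). It bounds the majorant at \<open>x\<^sub>0\<close>, and then the chords from \<open>x\<^sub>0\<close> to
  \<open>x\<^sub>0 \<plusminus> \<tau> \<epsilon>\<^sub>n\<close> with a small fixed \<open>\<tau>\<close> squeeze the slope (lemma \<open>slope_approximation\<close>).

  The affine function is a majorant for different reasons in three ranges. For \<open>\<bar>\<beta>\<bar> \<le> K \<epsilon>\<^sub>n\<close> the remainder is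
  uniformly \<open>o((\<epsilon>\<^sub>n)\<^sup>2)\<close>, by Chebyshev's inequality on a coarse grid and Bernstein's inequality on a fine one
  (\<open>remainder_dev_local\<close>). For \<open>K \<epsilon>\<^sub>n \<le> \<bar>\<beta>\<bar> \<le> \<delta>\<close> Bernstein's inequality bounds it by a small multiple of \<open>\<beta>\<^sup>2\<close>, which the
  negative quadratic drift absorbs (\<open>remainder_dev_far\<close>, \<open>drift_le\<close>). For larger \<open>\<bar>\<beta>\<bar>\<close> uniform consistency of
  \<open>U\<^sub>n\<^sup>#\<close> and the concavity of its limit \<open>U\<close> suffice (\<open>global_majorization\<close>).\<close>

section \<open>Integrals with square-root singularities\<close>

lemma nn_integral_lborel_cong_off_finite:
  fixes f g :: "real \<Rightarrow> ennreal"
  assumes "finite S" "\<And>x. x \<notin> S \<Longrightarrow> f x = g x"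
  shows "(\<integral>\<^sup>+x. f x \<partial>lborel) = (\<integral>\<^sup>+x. g x \<partial>lborel)"
proof (rule nn_integral_cong_AE)
  have "AE x in lborel. x \<notin> S"
    using AE_not_in[OF finite_imp_null_set_lborel[OF assms(1)]] .
  then show "AE x in lborel. f x = g x"
    by eventually_elim (rule assms(2))
qed

lemma nn_integral_nonneg_half_line_SUP:
  fixes F :: "real \<Rightarrow> ennreal"
  assumes [measurable]: "F \<in> borel_measurable borel"
  shows "(\<integral>\<^sup>+x\<in>{0..}. F x \<partial>lborel) = (SUP n. \<integral>\<^sup>+x\<in>{0..real n}. F x \<partial>lborel)"
proof -
  have "(SUP n. F x * indicator {0..real n} x) = F x * indicator {0..} x" for x
  proof -
    obtain m where m: "x \<le> real m" using real_arch_simple by blast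
    show ?thesis
      by (rule antisym)
        (auto intro!: SUP_least SUP_upper2[of m] split: split_indicator simp: m)
  qed
  then have "(\<integral>\<^sup>+x\<in>{0..}. F x \<partial>lborel) = (\<integral>\<^sup>+x. (SUP n. F x * indicator {0..real n} x) \<partial>lborel)"
    by simp
  also have "\<dots> = (SUP n. \<integral>\<^sup>+x\<in>{0..real n}. F x \<partial>lborel)"
    by (intro nn_integral_monotone_convergence_SUP)
       (auto simp: incseq_def le_fun_def split: split_indicator)
  finally show ?thesis .
qed

lemma nn_integral_square_Icc:
  fixes f :: "real \<Rightarrow> ennreal" and b :: real
  assumes [measurable]: "f \<in> borel_measurable borel" and "0 < b"
  shows "(\<integral>\<^sup>+x\<in>{0..b}. 2 * f (x\<^sup>2) \<partial>lborel) = (\<integral>\<^sup>+s\<in>{0..b\<^sup>2}. f s * ennreal (1 / sqrt s) \<partial>lborel)"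
proof -
  have "(\<integral>\<^sup>+s. f s * ennreal (1 / sqrt s) * indicator {0\<^sup>2..b\<^sup>2} s \<partial>lborel)
      = (\<integral>\<^sup>+x. f (x\<^sup>2) * ennreal (1 / sqrt (x\<^sup>2)) * ennreal (2 * x) * indicator {0..b} x \<partial>lborel)"
    using assms(2) by (intro nn_integral_substitution_aux)
      (auto intro!: derivative_eq_intros continuous_intros)
  also have "\<dots> = (\<integral>\<^sup>+x\<in>{0..b}. 2 * f (x\<^sup>2) \<partial>lborel)"
  proof (rule nn_integral_cong_AE)
    have "f (x\<^sup>2) * ennreal (1 / sqrt (x\<^sup>2)) * ennreal (2 * x) * indicator {0..b} x
        = 2 * f (x\<^sup>2) * indicator {0..b} x" if "x \<noteq> 0" for x
    proof (cases "x > 0")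
      case True
      have "ennreal (1 / sqrt (x\<^sup>2)) * ennreal (2 * x) = ennreal 2"
        using True by (subst ennreal_mult[symmetric]) auto
      then show ?thesis by (simp add: mult.assoc) (simp add: mult_ac)
    qed (use that in \<open>auto split: split_indicator\<close>)
    then show "AE x in lborel. f (x\<^sup>2) * ennreal (1 / sqrt (x\<^sup>2)) * ennreal (2 * x) * indicator {0..b} x
        = 2 * f (x\<^sup>2) * indicator {0..b} x"
      using AE_lborel_singleton[of 0] by auto
  qed
  finally show ?thesis by simp
qed

text \<open>The image of Lebesgue measure under squaring: substitution on \<open>[0, b]\<close>, then \<open>b \<rightarrow> \<infinity>\<close>, then
  reflection. All the integrals over spheres and the Abel integrals below reduce to this one.\<close>

lemma nn_integral_square:
  fixes f :: "real \<Rightarrow> ennreal"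
  assumes [measurable]: "f \<in> borel_measurable borel"
  shows "(\<integral>\<^sup>+x. f (x\<^sup>2) \<partial>lborel) = (\<integral>\<^sup>+s\<in>{0<..}. f s * ennreal (1 / sqrt s) \<partial>lborel)"
proof -
  let ?h = "\<lambda>s. f s * ennreal (1 / sqrt s)"
  have half: "(\<integral>\<^sup>+x\<in>{0..}. 2 * f (x\<^sup>2) \<partial>lborel) = (\<integral>\<^sup>+s\<in>{0..}. ?h s \<partial>lborel)"
  proof -
    have "(\<integral>\<^sup>+x\<in>{0..}. 2 * f (x\<^sup>2) \<partial>lborel) = (SUP n. \<integral>\<^sup>+x\<in>{0..real n}. 2 * f (x\<^sup>2) \<partial>lborel)"
      by (rule nn_integral_nonneg_half_line_SUP) simp
    also have "\<dots> = (SUP n. \<integral>\<^sup>+s\<in>{0..(real n)\<^sup>2}. ?h s \<partial>lborel)"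
    proof (rule SUP_cong[OF refl])
      fix n :: nat
      show "(\<integral>\<^sup>+x\<in>{0..real n}. 2 * f (x\<^sup>2) \<partial>lborel) = (\<integral>\<^sup>+s\<in>{0..(real n)\<^sup>2}. ?h s \<partial>lborel)"
      proof (cases "n = 0")
        case True
        then show ?thesis by (simp add: nn_integral_indicator_singleton)
      qed (use nn_integral_square_Icc[of f "real n"] in simp)
    qed
    also have "\<dots> = (SUP n. \<integral>\<^sup>+s\<in>{0..real n}. ?h s \<partial>lborel)"
    proof (rule antisym)
      show "(SUP n. \<integral>\<^sup>+s\<in>{0..(real n)\<^sup>2}. ?h s \<partial>lborel) \<le> (SUP n. \<integral>\<^sup>+s\<in>{0..real n}. ?h s \<partial>lborel)"
        by (rule SUP_least, rule_tac i="n^2" in SUP_upper2) auto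
      show "(SUP n. \<integral>\<^sup>+s\<in>{0..real n}. ?h s \<partial>lborel) \<le> (SUP n. \<integral>\<^sup>+s\<in>{0..(real n)\<^sup>2}. ?h s \<partial>lborel)"
      proof (rule SUP_mono)
        fix n :: nat
        have "real n \<le> (real n)\<^sup>2"
          by (metis of_nat_le_iff of_nat_power le_square power2_eq_square)
        moreover have "(\<integral>\<^sup>+s\<in>{0..N}. ?h s \<partial>lborel) \<le> (\<integral>\<^sup>+s\<in>{0..N'}. ?h s \<partial>lborel)" if "N \<le> N'" for N N' :: real
          using that by (intro nn_integral_mono) (auto split: split_indicator)
        ultimately show "\<exists>m\<in>UNIV. (\<integral>\<^sup>+s\<in>{0..real n}. ?h s \<partial>lborel) \<le> (\<integral>\<^sup>+s\<in>{0..(real m)\<^sup>2}. ?h s \<partial>lborel)"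
          by blast
      qed
    qed
    also have "\<dots> = (\<integral>\<^sup>+s\<in>{0..}. ?h s \<partial>lborel)"
      by (rule nn_integral_nonneg_half_line_SUP[symmetric]) simp
    finally show ?thesis .
  qed
  have refl: "(\<integral>\<^sup>+x\<in>{..0}. f (x\<^sup>2) \<partial>lborel) = (\<integral>\<^sup>+x\<in>{0..}. f (x\<^sup>2) \<partial>lborel)"
    by (subst nn_integral_real_affine[where c="-1" and t=0])
       (auto intro!: nn_integral_cong split: split_indicator)
  have "(\<integral>\<^sup>+x. f (x\<^sup>2) \<partial>lborel) = (\<integral>\<^sup>+x. f (x\<^sup>2) * indicator {0..} x + f (x\<^sup>2) * indicator {..0} x \<partial>lborel)"
    by (rule nn_integral_lborel_cong_off_finite[of "{0}"]) (auto split: split_indicator)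
  also have "\<dots> = 2 * (\<integral>\<^sup>+x\<in>{0..}. f (x\<^sup>2) \<partial>lborel)"
    by (subst nn_integral_add) (auto simp: refl mult_2)
  also have "\<dots> = (\<integral>\<^sup>+x\<in>{0..}. 2 * f (x\<^sup>2) \<partial>lborel)"
    by (subst nn_integral_cmult[symmetric]) (auto simp: mult_ac)
  also have "\<dots> = (\<integral>\<^sup>+s\<in>{0<..}. ?h s \<partial>lborel)"
    unfolding half
    by (rule nn_integral_lborel_cong_off_finite[of "{0}"]) (auto split: split_indicator)
  finally show ?thesis .
qed

text \<open>The beta integral \<open>B(1/2, 1/2) = \<pi>\<close>, by \<open>u = y + (z - y) (sin \<theta>)\<^sup>2\<close>. It is the reason why two Abel
  integrals of order one half compose to an ordinary integral.\<close>

lemma nn_integral_beta_half: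
  fixes y z :: real
  assumes "y < z"
  shows "(\<integral>\<^sup>+u\<in>{y<..<z}. ennreal (1 / sqrt (z - u)) * ennreal (1 / sqrt (u - y)) \<partial>lborel) = ennreal pi"
proof -
  let ?g = "\<lambda>\<theta>. y + (z - y) * (sin \<theta>)\<^sup>2" and ?g' = "\<lambda>\<theta>. (z - y) * (2 * sin \<theta> * cos \<theta>)"
  let ?F = "\<lambda>u. ennreal (1 / sqrt (z - u)) * ennreal (1 / sqrt (u - y))"
  have g0: "?g 0 = y" and g1: "?g (pi/2) = z" by auto
  have "(\<integral>\<^sup>+u. ?F u * indicator {?g 0..?g (pi/2)} u \<partial>lborel)
      = (\<integral>\<^sup>+\<theta>. ?F (?g \<theta>) * ennreal (?g' \<theta>) * indicator {0..pi/2} \<theta> \<partial>lborel)"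
  proof (intro nn_integral_substitution_aux)
    show "continuous_on {0..pi/2} ?g'" by (intro continuous_intros)
    show "(?g has_real_derivative ?g' x) (at x)" for x
      by (auto intro!: derivative_eq_intros)
    show "0 \<le> ?g' x" if "x \<in> {0..pi/2}" for x
      using assms that by (auto intro!: mult_nonneg_nonneg sin_ge_zero cos_ge_zero)
  qed auto
  also have "\<dots> = (\<integral>\<^sup>+\<theta>. 2 * indicator {0..pi/2} \<theta> \<partial>lborel)"
  proof (rule nn_integral_cong_AE)
    have "?F (?g \<theta>) * ennreal (?g' \<theta>) * indicator {0..pi/2} \<theta> = 2 * indicator {0..pi/2} \<theta>"
      if "\<theta> \<noteq> 0" "\<theta> \<noteq> pi/2" for \<theta>
    proof (cases "\<theta> \<in> {0..pi/2}")
      case True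
      then have th: "0 < \<theta>" "\<theta> < pi/2" using that by auto
      have s: "sin \<theta> > 0" and c: "cos \<theta> > 0"
        using th by (auto intro!: sin_gt_zero cos_gt_zero)
      have 1: "z - ?g \<theta> = (z - y) * (cos \<theta>)\<^sup>2"
        by (simp add: cos_squared_eq algebra_simps)
      have 2: "?g \<theta> - y = (z - y) * (sin \<theta>)\<^sup>2" by simp
      have "?F (?g \<theta>) * ennreal (?g' \<theta>)
          = ennreal (1 / sqrt ((z - y) * (cos \<theta>)\<^sup>2) * (1 / sqrt ((z - y) * (sin \<theta>)\<^sup>2)) * ?g' \<theta>)"
        unfolding 1 2 using s c assms
        by (subst ennreal_mult, simp, simp, subst ennreal_mult, simp_all)
      also have "1 / sqrt ((z - y) * (cos \<theta>)\<^sup>2) * (1 / sqrt ((z - y) * (sin \<theta>)\<^sup>2)) * ?g' \<theta> = 2"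
      proof -
        have "sqrt ((z - y) * (cos \<theta>)\<^sup>2) = sqrt (z - y) * cos \<theta>"
             "sqrt ((z - y) * (sin \<theta>)\<^sup>2) = sqrt (z - y) * sin \<theta>"
          using s c by (simp_all add: real_sqrt_mult)
        moreover have "sqrt (z - y) * sqrt (z - y) = z - y" "sqrt (z - y) > 0" using assms by auto
        ultimately show ?thesis using s c assms by (simp add: divide_simps)
      qed
      finally show ?thesis by simp
    qed auto
    then show "AE \<theta> in lborel. ?F (?g \<theta>) * ennreal (?g' \<theta>) * indicator {0..pi/2} \<theta>
        = 2 * indicator {0..pi/2} \<theta>"
      using AE_lborel_singleton[of "0::real"] AE_lborel_singleton[of "pi/2"] by auto
  qed
  also have "\<dots> = 2 * ennreal (pi/2)"
    by (subst nn_integral_cmult) auto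
  also have "\<dots> = ennreal pi" by (simp add: ennreal_mult'[symmetric] flip: ennreal_numeral)
  finally have "(\<integral>\<^sup>+u. ?F u * indicator {y..z} u \<partial>lborel) = ennreal pi" unfolding g0 g1 .
  also have "(\<integral>\<^sup>+u. ?F u * indicator {y..z} u \<partial>lborel) = (\<integral>\<^sup>+u. ?F u * indicator {y<..<z} u \<partial>lborel)"
    by (rule nn_integral_lborel_cong_off_finite[of "{y, z}"]) (auto split: split_indicator)
  finally show ?thesis .
qed

text \<open>Substitute \<open>s = x\<^sup>2\<close>: the integral is the length of \<open>{x. x\<^sup>2 < c}\<close>.\<close>

lemma nn_integral_inverse_sqrt:
  assumes "0 \<le> c"
  shows "(\<integral>\<^sup>+s\<in>{0<..<c}. ennreal (1 / sqrt s) \<partial>lborel) = ennreal (2 * sqrt c)"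
proof -
  have "(\<integral>\<^sup>+x. indicator {..<c} (x\<^sup>2) \<partial>lborel) = (\<integral>\<^sup>+s\<in>{0<..}. indicator {..<c} s * ennreal (1 / sqrt s) \<partial>lborel)"
    by (rule nn_integral_square) simp
  also have "\<dots> = (\<integral>\<^sup>+s\<in>{0<..<c}. ennreal (1 / sqrt s) \<partial>lborel)"
    by (intro nn_integral_cong) (auto split: split_indicator)
  finally have *: "(\<integral>\<^sup>+s\<in>{0<..<c}. ennreal (1 / sqrt s) \<partial>lborel) = (\<integral>\<^sup>+x. indicator {..<c} (x\<^sup>2) \<partial>lborel)" ..
  have "x\<^sup>2 < c \<longleftrightarrow> x \<in> {- sqrt c<..<sqrt c}" for x :: real
    using real_sqrt_less_iff[of "x\<^sup>2" c] by auto
  then have "(indicator {..<c} (x\<^sup>2) :: ennreal) = indicator {- sqrt c<..<sqrt c} x" for x :: real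
    by (simp only: indicator_def lessThan_iff)
  then have "(\<integral>\<^sup>+x. indicator {..<c} (x\<^sup>2) \<partial>lborel) = emeasure lborel {- sqrt c<..<sqrt c}"
    by (simp only: nn_integral_indicator sets_lborel borel_open open_greaterThanLessThan)
  also have "\<dots> = ennreal (sqrt c - - sqrt c)"
    using assms by (intro emeasure_lborel_Ioo) auto
  finally show ?thesis unfolding * by simp
qed

lemma nn_integral_inverse_sqrt_Ioo:
  assumes "a \<le> b" "a \<le> z"
  shows "(\<integral>\<^sup>+u\<in>{a..b} \<inter> {..<z}. ennreal (1 / sqrt (z - u)) \<partial>lborel)
    = ennreal (2 * (sqrt (z - a) - sqrt (max (z - b) 0)))"
proof -
  define c where "c = max (z - b) 0"
  have c: "0 \<le> c" "c \<le> z - a" using assms by (auto simp: c_def)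
  have "(\<integral>\<^sup>+u\<in>{a..b} \<inter> {..<z}. ennreal (1 / sqrt (z - u)) \<partial>lborel)
      = (\<integral>\<^sup>+s. ennreal (1 / sqrt s) * indicator ({a..b} \<inter> {..<z}) (z - s) \<partial>lborel)"
    by (subst nn_integral_real_affine[where c="-1" and t=z]) auto
  also have "\<dots> = (\<integral>\<^sup>+s\<in>{c<..<z - a}. ennreal (1 / sqrt s) \<partial>lborel)"
    by (rule nn_integral_lborel_cong_off_finite[of "{c, z - a, z - b}"])
       (auto split: split_indicator simp: c_def)
  finally have 1: "(\<integral>\<^sup>+u\<in>{a..b} \<inter> {..<z}. ennreal (1 / sqrt (z - u)) \<partial>lborel)
      = (\<integral>\<^sup>+s\<in>{c<..<z - a}. ennreal (1 / sqrt s) \<partial>lborel)" .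
  have "ennreal (2 * sqrt (z - a)) = (\<integral>\<^sup>+s\<in>{0<..<z - a}. ennreal (1 / sqrt s) \<partial>lborel)"
    using assms by (subst nn_integral_inverse_sqrt) auto
  also have "\<dots> = (\<integral>\<^sup>+s. ennreal (1 / sqrt s) * indicator {c<..<z - a} s
       + ennreal (1 / sqrt s) * indicator {0<..<c} s \<partial>lborel)"
    using c by (intro nn_integral_lborel_cong_off_finite[of "{c}"]) (auto split: split_indicator)
  also have "\<dots> = (\<integral>\<^sup>+s\<in>{c<..<z - a}. ennreal (1 / sqrt s) \<partial>lborel) + ennreal (2 * sqrt c)"
    using c by (subst nn_integral_add) (auto simp: nn_integral_inverse_sqrt)
  finally have "ennreal (2 * sqrt (z - a)) - ennreal (2 * sqrt c)
     = (\<integral>\<^sup>+s\<in>{c<..<z - a}. ennreal (1 / sqrt s) \<partial>lborel)"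
    by simp
  then show ?thesis unfolding 1 c_def[symmetric]
    using c by (subst (asm) ennreal_minus) (auto simp: algebra_simps)
qed

section \<open>The law of the sum of two squares\<close>

text \<open>Polar coordinates in the plane, with no Jacobian: both squares get the density \<open>1 / \<surd>s\<close>, and the
  convolution of that density with itself is the constant \<open>\<pi>\<close> by the beta integral.\<close>

lemma nn_integral_sum_of_two_squares:
  fixes f :: "real \<Rightarrow> ennreal"
  assumes [measurable]: "f \<in> borel_measurable borel"
  shows "(\<integral>\<^sup>+x. \<integral>\<^sup>+y. f (x\<^sup>2 + y\<^sup>2) \<partial>lborel \<partial>lborel) = ennreal pi * (\<integral>\<^sup>+s\<in>{0<..}. f s \<partial>lborel)"
proof -
  have "(\<integral>\<^sup>+x. \<integral>\<^sup>+y. f (x\<^sup>2 + y\<^sup>2) \<partial>lborel \<partial>lborel)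
      = (\<integral>\<^sup>+x. (\<integral>\<^sup>+t\<in>{0<..}. f (x\<^sup>2 + t) * ennreal (1 / sqrt t) \<partial>lborel) \<partial>lborel)"
    by (intro nn_integral_cong nn_integral_square) simp
  also have "\<dots> = (\<integral>\<^sup>+s\<in>{0<..}. (\<integral>\<^sup>+t\<in>{0<..}. f (s + t) * ennreal (1 / sqrt t) \<partial>lborel) * ennreal (1 / sqrt s) \<partial>lborel)"
    by (rule nn_integral_square[of "\<lambda>u. \<integral>\<^sup>+t\<in>{0<..}. f (u + t) * ennreal (1 / sqrt t) \<partial>lborel"]) simp
  also have "\<dots> = (\<integral>\<^sup>+s\<in>{0<..}. (\<integral>\<^sup>+z\<in>{s<..}. f z * ennreal (1 / sqrt (z - s)) \<partial>lborel) * ennreal (1 / sqrt s) \<partial>lborel)"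
  proof (intro nn_integral_cong)
    fix s :: real
    have "(\<integral>\<^sup>+z\<in>{s<..}. f z * ennreal (1 / sqrt (z - s)) \<partial>lborel)
        = (\<integral>\<^sup>+t\<in>{0<..}. f (s + t) * ennreal (1 / sqrt t) \<partial>lborel)"
      by (subst nn_integral_real_affine[where c=1 and t=s])
         (auto intro!: nn_integral_cong split: split_indicator)
    then show "(\<integral>\<^sup>+t\<in>{0<..}. f (s + t) * ennreal (1 / sqrt t) \<partial>lborel) * ennreal (1 / sqrt s) * indicator {0<..} s
       = (\<integral>\<^sup>+z\<in>{s<..}. f z * ennreal (1 / sqrt (z - s)) \<partial>lborel) * ennreal (1 / sqrt s) * indicator {0<..} s"
      by simp
  qed
  also have "\<dots> = (\<integral>\<^sup>+s. \<integral>\<^sup>+z. f z * ennreal (1 / sqrt (z - s)) * ennreal (1 / sqrt s) * (indicator {s<..} z * indicator {0<..} s) \<partial>lborel \<partial>lborel)"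
    by (intro nn_integral_cong) (subst nn_integral_multc[symmetric], simp, subst nn_integral_multc[symmetric], simp, simp add: mult_ac)
  also have "\<dots> = (\<integral>\<^sup>+z. \<integral>\<^sup>+s. f z * ennreal (1 / sqrt (z - s)) * ennreal (1 / sqrt s) * (indicator {s<..} z * indicator {0<..} s) \<partial>lborel \<partial>lborel)"
    by (rule lborel_pair.Fubini') (simp add: indicator_def)
  also have "\<dots> = (\<integral>\<^sup>+z. f z * (ennreal pi * indicator {0<..} z) \<partial>lborel)"
  proof (rule nn_integral_cong)
    fix z :: real
    have "(\<integral>\<^sup>+s. f z * ennreal (1 / sqrt (z - s)) * ennreal (1 / sqrt s) * (indicator {s<..} z * indicator {0<..} s) \<partial>lborel)
       = f z * (\<integral>\<^sup>+s\<in>{0<..<z}. ennreal (1 / sqrt (z - s)) * ennreal (1 / sqrt (s - 0)) \<partial>lborel)"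
      by (subst nn_integral_cmult[symmetric], simp)
         (auto intro!: nn_integral_cong simp: mult_ac split: split_indicator)
    also have "\<dots> = f z * (ennreal pi * indicator {0<..} z)"
      using nn_integral_beta_half[of 0 z] by (cases "0 < z") auto
    finally show "(\<integral>\<^sup>+s. f z * ennreal (1 / sqrt (z - s)) * ennreal (1 / sqrt s) * (indicator {s<..} z * indicator {0<..} s) \<partial>lborel)
       = f z * (ennreal pi * indicator {0<..} z)" .
  qed
  also have "\<dots> = ennreal pi * (\<integral>\<^sup>+s\<in>{0<..}. f s \<partial>lborel)"
    by (subst nn_integral_cmult[symmetric]) (auto simp: mult_ac)
  finally show ?thesis .
qed

text \<open>Here \<open>\<nu>\<close> is the law of \<open>X\<^sub>1\<^sup>2 + X\<^sub>2\<^sup>2\<close> and \<open>r\<close> the radial profile \<open>\<rho>\<close>. Both the profile and the density of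
  \<open>\<nu>\<close> take values in \<open>[0, \<infinity>]\<close>, because the density may be infinite on a null set and Tonelli's theorem
  then applies without integrability conditions.\<close>

locale radial_law =
  fixes \<nu> :: "real measure" and r :: "real \<Rightarrow> ennreal"
  assumes distr: "real_distribution \<nu>"
    and r_measurable [measurable]: "r \<in> borel_measurable borel"
    and law: "\<And>\<phi>. \<phi> \<in> borel_measurable borel \<Longrightarrow>
      (\<integral>\<^sup>+y. \<phi> y \<partial>\<nu>) = ennreal pi * (\<integral>\<^sup>+y\<in>{0<..}. \<phi> y * (\<integral>\<^sup>+z\<in>{y<..}. r z * ennreal (1 / sqrt (z - y)) \<partial>lborel) \<partial>lborel)"

text \<open>Integrating \<open>x\<^sub>3\<close> out turns the profile into its Abel transform at \<open>x\<^sub>1\<^sup>2 + x\<^sub>2\<^sup>2\<close>; polar coordinates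
  in the remaining plane finish. The absolute value only extends \<open>\<rho>\<close> to the negative half-line in a
  measurable way.\<close>

lemma radial_law_sum_of_squares:
  fixes X1 X2 X3 :: "'p \<Rightarrow> real"
  assumes "prob_space P"
    and D: "distributed P lborel (\<lambda>\<omega>. (X1 \<omega>, X2 \<omega>, X3 \<omega>)) (\<lambda>(x1, x2, x3). ennreal (\<rho> (x1\<^sup>2 + x2\<^sup>2 + x3\<^sup>2)))"
  shows "radial_law (distr P borel (\<lambda>\<omega>. (X1 \<omega>)\<^sup>2 + (X2 \<omega>)\<^sup>2)) (\<lambda>z. ennreal (\<rho> \<bar>z\<bar>))"
proof -
  interpret prob_space P by fact
  define R where "R = (\<lambda>z. ennreal (\<rho> \<bar>z\<bar>))"
  let ?X = "\<lambda>\<omega>. (X1 \<omega>, X2 \<omega>, X3 \<omega>)"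
  have X: "?X \<in> measurable P borel" using distributed_measurable[OF D] by simp
  have [measurable]: "X1 \<in> borel_measurable P" "X2 \<in> borel_measurable P"
    using measurable_compose[OF X, of fst borel] measurable_compose[OF X, of "\<lambda>x. fst (snd x)" borel]
    by (auto simp: borel_prod[symmetric])
  have f: "(\<lambda>(x1, x2, x3). ennreal (\<rho> (x1\<^sup>2 + x2\<^sup>2 + x3\<^sup>2))) \<in> borel_measurable borel"
    using distributed_borel_measurable[OF D] by simp
  have "(\<lambda>z::real. (sqrt \<bar>z\<bar>, 0::real, 0::real)) \<in> borel \<rightarrow>\<^sub>M borel"
    by (simp add: borel_prod[symmetric])
  from measurable_compose[OF this f] have r[measurable]: "R \<in> borel_measurable borel" by (simp add: R_def)
  show ?thesis unfolding R_def[symmetric]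
  proof (rule radial_law.intro)
    show "real_distribution (distr P borel (\<lambda>\<omega>. (X1 \<omega>)\<^sup>2 + (X2 \<omega>)\<^sup>2))"
      by (rule real_distribution_distr) simp
    show "R \<in> borel_measurable borel" by fact
    fix \<phi> :: "real \<Rightarrow> ennreal" assume [measurable]: "\<phi> \<in> borel_measurable borel"
    define k where "k y = (\<integral>\<^sup>+z\<in>{y<..}. R z * ennreal (1 / sqrt (z - y)) \<partial>lborel)" for y
    have [measurable]: "k \<in> borel_measurable borel"
      unfolding k_def by (simp add: indicator_def)
    have k: "(\<integral>\<^sup>+x3. R (y + x3\<^sup>2) \<partial>lborel) = k y" for y
    proof -
      have "(\<integral>\<^sup>+x3. R (y + x3\<^sup>2) \<partial>lborel) = (\<integral>\<^sup>+s\<in>{0<..}. R (y + s) * ennreal (1 / sqrt s) \<partial>lborel)"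
        by (rule nn_integral_square[of "\<lambda>s. R (y + s)"]) simp
      also have "\<dots> = k y" unfolding k_def
        by (subst (2) nn_integral_real_affine[where c=1 and t=y])
         (auto intro!: nn_integral_cong split: split_indicator)
      finally show ?thesis .
    qed
    have "(\<integral>\<^sup>+y. \<phi> y \<partial>distr P borel (\<lambda>\<omega>. (X1 \<omega>)\<^sup>2 + (X2 \<omega>)\<^sup>2)) = (\<integral>\<^sup>+\<omega>. \<phi> ((X1 \<omega>)\<^sup>2 + (X2 \<omega>)\<^sup>2) \<partial>P)"
      by (subst nn_integral_distr) auto
    also have "\<dots> = (\<integral>\<^sup>+\<omega>. (\<lambda>(x1, x2, x3). \<phi> (x1\<^sup>2 + x2\<^sup>2)) (?X \<omega>) \<partial>P)" by simp
    also have "\<dots> = (\<integral>\<^sup>+x. (\<lambda>(x1, x2, x3). ennreal (\<rho> (x1\<^sup>2 + x2\<^sup>2 + x3\<^sup>2))) x * (\<lambda>(x1, x2, x3). \<phi> (x1\<^sup>2 + x2\<^sup>2)) x \<partial>lborel)"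
      by (rule distributed_nn_integral[OF D, symmetric]) (simp add: borel_prod[symmetric])
    also have "\<dots> = (\<integral>\<^sup>+x. (\<lambda>(x1, x2, x3). R (x1\<^sup>2 + x2\<^sup>2 + x3\<^sup>2) * \<phi> (x1\<^sup>2 + x2\<^sup>2)) x \<partial>(lborel \<Otimes>\<^sub>M (lborel \<Otimes>\<^sub>M lborel)))"
      unfolding lborel_prod by (intro nn_integral_cong) (auto simp: R_def)
    also have "\<dots> = (\<integral>\<^sup>+x1. \<integral>\<^sup>+x2. \<integral>\<^sup>+x3. R (x1\<^sup>2 + x2\<^sup>2 + x3\<^sup>2) * \<phi> (x1\<^sup>2 + x2\<^sup>2) \<partial>lborel \<partial>lborel \<partial>lborel)"
    proof -
      have L: "sigma_finite_measure (lborel \<Otimes>\<^sub>M lborel :: (real \<times> real) measure)"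
        unfolding lborel_prod by (rule lborel.sigma_finite_measure_axioms)
      let ?F = "\<lambda>x1 x2 x3. R (x1\<^sup>2 + x2\<^sup>2 + x3\<^sup>2) * \<phi> (x1\<^sup>2 + x2\<^sup>2)"
      have "(\<integral>\<^sup>+x. (\<lambda>(x1, x2, x3). ?F x1 x2 x3) x \<partial>(lborel \<Otimes>\<^sub>M (lborel \<Otimes>\<^sub>M lborel)))
         = (\<integral>\<^sup>+x1. \<integral>\<^sup>+x. (\<lambda>(x2, x3). ?F x1 x2 x3) x \<partial>(lborel \<Otimes>\<^sub>M lborel) \<partial>lborel)"
        by (subst sigma_finite_measure.nn_integral_fst[OF L, symmetric]) simp_all
      also have "\<dots> = (\<integral>\<^sup>+x1. \<integral>\<^sup>+x2. \<integral>\<^sup>+x3. ?F x1 x2 x3 \<partial>lborel \<partial>lborel \<partial>lborel)"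
        by (intro nn_integral_cong, subst lborel.nn_integral_fst[symmetric]) simp_all
      finally show ?thesis .
    qed
    also have "\<dots> = (\<integral>\<^sup>+x1. \<integral>\<^sup>+x2. k (x1\<^sup>2 + x2\<^sup>2) * \<phi> (x1\<^sup>2 + x2\<^sup>2) \<partial>lborel \<partial>lborel)"
      by (subst nn_integral_multc) (measurable, simp only: k)
    also have "\<dots> = ennreal pi * (\<integral>\<^sup>+y\<in>{0<..}. k y * \<phi> y \<partial>lborel)"
      by (rule nn_integral_sum_of_two_squares[of "\<lambda>y. k y * \<phi> y"]) simp
    finally show "(\<integral>\<^sup>+y. \<phi> y \<partial>distr P borel (\<lambda>\<omega>. (X1 \<omega>)\<^sup>2 + (X2 \<omega>)\<^sup>2))
       = ennreal pi * (\<integral>\<^sup>+y\<in>{0<..}. \<phi> y * (\<integral>\<^sup>+z\<in>{y<..}. R z * ennreal (1 / sqrt (z - y)) \<partial>lborel) \<partial>lborel)"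
      unfolding k_def by (simp add: mult_ac)
  qed
qed

context radial_law
begin

sublocale real_distribution \<nu> by (rule distr)

lemma law_swapped:
  assumes [measurable]: "\<phi> \<in> borel_measurable borel"
  shows "(\<integral>\<^sup>+y. \<phi> y \<partial>\<nu>) = ennreal pi * (\<integral>\<^sup>+z\<in>{0<..}. r z * (\<integral>\<^sup>+y\<in>{0<..<z}. \<phi> y * ennreal (1 / sqrt (z - y)) \<partial>lborel) \<partial>lborel)"
proof -
  have "(\<integral>\<^sup>+y\<in>{0<..}. \<phi> y * (\<integral>\<^sup>+z\<in>{y<..}. r z * ennreal (1 / sqrt (z - y)) \<partial>lborel) \<partial>lborel)
    = (\<integral>\<^sup>+y. \<integral>\<^sup>+z. r z * \<phi> y * ennreal (1 / sqrt (z - y)) * (indicator {y<..} z * indicator {0<..} y) \<partial>lborel \<partial>lborel)"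
    by (intro nn_integral_cong) (subst nn_integral_cmult[symmetric], simp, subst nn_integral_multc[symmetric], simp, simp add: mult_ac)
  also have "\<dots> = (\<integral>\<^sup>+z. \<integral>\<^sup>+y. r z * \<phi> y * ennreal (1 / sqrt (z - y)) * (indicator {y<..} z * indicator {0<..} y) \<partial>lborel \<partial>lborel)"
    by (rule lborel_pair.Fubini') (simp add: indicator_def)
  also have "\<dots> = (\<integral>\<^sup>+z\<in>{0<..}. r z * (\<integral>\<^sup>+y\<in>{0<..<z}. \<phi> y * ennreal (1 / sqrt (z - y)) \<partial>lborel) \<partial>lborel)"
  proof (rule nn_integral_cong)
    fix z :: real
    have "(\<integral>\<^sup>+y. r z * \<phi> y * ennreal (1 / sqrt (z - y)) * (indicator {y<..} z * indicator {0<..} y) \<partial>lborel)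
       = (\<integral>\<^sup>+y. r z * (\<phi> y * ennreal (1 / sqrt (z - y)) * indicator {0<..<z} y) * indicator {0<..} z \<partial>lborel)"
      by (intro nn_integral_cong) (auto simp: mult_ac split: split_indicator)
    also have "\<dots> = r z * (\<integral>\<^sup>+y\<in>{0<..<z}. \<phi> y * ennreal (1 / sqrt (z - y)) \<partial>lborel) * indicator {0<..} z"
      by (subst nn_integral_multc, simp, subst nn_integral_cmult) simp_all
    finally show "(\<integral>\<^sup>+y. r z * \<phi> y * ennreal (1 / sqrt (z - y)) * (indicator {y<..} z * indicator {0<..} y) \<partial>lborel)
       = r z * (\<integral>\<^sup>+y\<in>{0<..<z}. \<phi> y * ennreal (1 / sqrt (z - y)) \<partial>lborel) * indicator {0<..} z" .
  qed
  finally show ?thesis by (subst law) auto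
qed

text \<open>Abel inversion: the second Abel transform undoes the first one up to an integration. This formula
  shows that \<open>V\<close> is nonincreasing, so that \<open>U\<close> is concave and \<open>V' \<le> 0\<close>.\<close>

lemma V_n_radial:
  assumes "0 \<le> y"
  shows "V_n \<nu> y = ennreal (pi\<^sup>2) * (\<integral>\<^sup>+z\<in>{y<..}. r z \<partial>lborel)"
proof -
  have "V_n \<nu> y = ennreal pi * (\<integral>\<^sup>+z\<in>{0<..}. r z * (\<integral>\<^sup>+u\<in>{0<..<z}. (ennreal (1 / sqrt (u - y)) * indicator {y<..} u) * ennreal (1 / sqrt (z - u)) \<partial>lborel) \<partial>lborel)"
    unfolding V_n_def by (rule law_swapped) simp
  also have "\<dots> = ennreal pi * (\<integral>\<^sup>+z. (r z * indicator {y<..} z) * ennreal pi \<partial>lborel)"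
  proof (intro arg_cong[where f="\<lambda>x. ennreal pi * x"] nn_integral_cong)
    fix z :: real
    have "(\<integral>\<^sup>+u\<in>{0<..<z}. (ennreal (1 / sqrt (u - y)) * indicator {y<..} u) * ennreal (1 / sqrt (z - u)) \<partial>lborel)
        = (\<integral>\<^sup>+u\<in>{y<..<z}. ennreal (1 / sqrt (z - u)) * ennreal (1 / sqrt (u - y)) \<partial>lborel)"
      using assms by (intro nn_integral_cong) (auto split: split_indicator simp: mult_ac)
    also have "\<dots> = ennreal pi * indicator {y<..} z"
      using nn_integral_beta_half[of y z] by (cases "y < z") auto
    finally show "r z * (\<integral>\<^sup>+u\<in>{0<..<z}. (ennreal (1 / sqrt (u - y)) * indicator {y<..} u) * ennreal (1 / sqrt (z - u)) \<partial>lborel) * indicator {0<..} z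
       = (r z * indicator {y<..} z) * ennreal pi"
      using assms by (auto split: split_indicator simp: mult_ac)
  qed
  also have "\<dots> = ennreal pi * ennreal pi * (\<integral>\<^sup>+z\<in>{y<..}. r z \<partial>lborel)"
    by (subst nn_integral_multc) (simp_all add: mult_ac)
  also have "ennreal pi * ennreal pi = ennreal (pi\<^sup>2)"
    by (simp add: power2_eq_square ennreal_mult)
  finally show ?thesis .
qed

lemma emeasure_Ioc:
  assumes "0 \<le> a" "a \<le> b"
  shows "emeasure \<nu> {a<..b} = ennreal (2 * pi) * (\<integral>\<^sup>+z\<in>{a<..}. r z * ennreal (sqrt (z - a) - sqrt (max (z - b) 0)) \<partial>lborel)"
proof -
  have "emeasure \<nu> {a<..b} = (\<integral>\<^sup>+y. indicator {a<..b} y \<partial>\<nu>)" by simp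
  also have "\<dots> = ennreal pi * (\<integral>\<^sup>+z\<in>{0<..}. r z * (\<integral>\<^sup>+y\<in>{0<..<z}. indicator {a<..b} y * ennreal (1 / sqrt (z - y)) \<partial>lborel) \<partial>lborel)"
    by (rule law_swapped) simp
  also have "\<dots> = ennreal pi * (\<integral>\<^sup>+z. (r z * ennreal (sqrt (z - a) - sqrt (max (z - b) 0)) * indicator {a<..} z) * 2 \<partial>lborel)"
  proof (intro arg_cong[where f="\<lambda>x. ennreal pi * x"] nn_integral_cong)
    fix z :: real
    have "(\<integral>\<^sup>+y\<in>{0<..<z}. indicator {a<..b} y * ennreal (1 / sqrt (z - y)) \<partial>lborel)
       = (\<integral>\<^sup>+y\<in>{a..b} \<inter> {..<z}. ennreal (1 / sqrt (z - y)) \<partial>lborel)"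
      using assms by (intro nn_integral_lborel_cong_off_finite[of "{a}"]) (auto split: split_indicator)
    also have "\<dots> = 2 * (ennreal (sqrt (z - a) - sqrt (max (z - b) 0)) * indicator {a<..} z)"
    proof (cases "a < z")
      case True
      then show ?thesis using assms
        by (subst nn_integral_inverse_sqrt_Ioo, simp_all only: , subst ennreal_mult') auto
    qed auto
    finally show "r z * (\<integral>\<^sup>+y\<in>{0<..<z}. indicator {a<..b} y * ennreal (1 / sqrt (z - y)) \<partial>lborel) * indicator {0<..} z
      = (r z * ennreal (sqrt (z - a) - sqrt (max (z - b) 0)) * indicator {a<..} z) * 2"
      using assms by (auto split: split_indicator simp: mult_ac)
  qed
  also have "\<dots> = ennreal (2 * pi) * (\<integral>\<^sup>+z\<in>{a<..}. r z * ennreal (sqrt (z - a) - sqrt (max (z - b) 0)) \<partial>lborel)"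
    by (subst nn_integral_multc) (simp_all add: ennreal_mult' mult_ac)
  finally show ?thesis .
qed

text \<open>The total mass of \<open>\<nu>\<close> is \<open>2 \<pi> \<integral> \<rho>(z) \<surd>z dz\<close>, and \<open>\<surd>z \<ge> \<surd>y\<close> on the tail beyond \<open>y\<close>.\<close>

lemma tail_mass_finite:
  assumes "0 < y"
  shows "(\<integral>\<^sup>+z\<in>{y<..}. r z \<partial>lborel) < \<infinity>"
proof -
  have "ennreal (sqrt y) * (\<integral>\<^sup>+z\<in>{y<..}. r z \<partial>lborel) = (\<integral>\<^sup>+z. ennreal (sqrt y) * (r z * indicator {y<..} z) \<partial>lborel)"
    by (subst nn_integral_cmult) auto
  also have "\<dots> \<le> (\<integral>\<^sup>+z\<in>{0<..}. r z * (\<integral>\<^sup>+u\<in>{0<..<z}. 1 * ennreal (1 / sqrt (z - u)) \<partial>lborel) \<partial>lborel)"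
  proof (rule nn_integral_mono)
    fix z :: real
    show "ennreal (sqrt y) * (r z * indicator {y<..} z)
       \<le> r z * (\<integral>\<^sup>+u\<in>{0<..<z}. 1 * ennreal (1 / sqrt (z - u)) \<partial>lborel) * indicator {0<..} z"
    proof (cases "y < z")
      case True
      have "(\<integral>\<^sup>+u\<in>{0<..<z}. 1 * ennreal (1 / sqrt (z - u)) \<partial>lborel) = (\<integral>\<^sup>+u\<in>{0..z} \<inter> {..<z}. ennreal (1 / sqrt (z - u)) \<partial>lborel)"
        by (intro nn_integral_lborel_cong_off_finite[of "{0}"]) (auto split: split_indicator)
      also have "\<dots> = ennreal (2 * sqrt z)"
        using True assms by (subst nn_integral_inverse_sqrt_Ioo) auto
      also have "\<dots> \<ge> ennreal (sqrt y)"
      proof (rule ennreal_leI)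
        have "sqrt y \<le> sqrt z" "0 \<le> sqrt z" using True assms by auto
        then show "sqrt y \<le> 2 * sqrt z" by linarith
      qed
      finally show ?thesis using True assms
        by (auto intro!: mult_left_mono simp: mult.commute[of "ennreal (sqrt y)"])
    qed auto
  qed
  finally have "ennreal pi * (ennreal (sqrt y) * (\<integral>\<^sup>+z\<in>{y<..}. r z \<partial>lborel)) \<le> (\<integral>\<^sup>+u. 1 \<partial>\<nu>)"
    by (subst law_swapped) (auto intro!: mult_left_mono)
  then have "ennreal pi * (ennreal (sqrt y) * (\<integral>\<^sup>+z\<in>{y<..}. r z \<partial>lborel)) < \<infinity>"
    using emeasure_space_1[unfolded space_eq_univ] by (simp add: le_less_trans[of _ 1])
  then show ?thesis using assms by (auto simp: ennreal_mult_less_top)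
qed

lemma V_n_radial_finite: "0 < y \<Longrightarrow> V_n \<nu> y < \<infinity>"
  using tail_mass_finite[of y] by (subst V_n_radial) (auto simp: ennreal_mult_less_top)

lemma V_n_radial_antimono: "0 \<le> a \<Longrightarrow> a \<le> b \<Longrightarrow> V_n \<nu> b \<le> V_n \<nu> a"
  by (subst (1 2) V_n_radial) (auto intro!: mult_left_mono nn_integral_mono split: split_indicator)

end

section \<open>Abel transforms of distributions on the half-line\<close>

text \<open>For \<open>u, x \<ge> 0\<close> this is \<open>\<integral>\<^sub>0\<^sup>x 1 / \<surd>(u - y) dy\<close>, restricted to \<open>y < u\<close>: the contribution of an observation \<open>u\<close> to
  \<open>U\<^sub>n(x)\<close> and to \<open>U\<^sub>n\<^sup>#(x)\<close>.\<close>

definition psi :: "real \<Rightarrow> real \<Rightarrow> real" where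
  "psi x u = 2 * (sqrt u - sqrt (max (u - x) 0))"

lemma psi_measurable [measurable]: "psi x \<in> borel_measurable borel"
  unfolding psi_def by measurable

lemma sqrt_diff_le_sqrt: "0 \<le> b \<Longrightarrow> b \<le> a \<Longrightarrow> sqrt a - sqrt b \<le> sqrt (a - b)"
  using sqrt_add_le_add_sqrt[of b "a - b"] by simp

lemma psi_bounds: "0 \<le> x \<Longrightarrow> 0 \<le> u \<Longrightarrow> 0 \<le> psi x u \<and> psi x u \<le> 2 * sqrt x"
proof -
  assume "0 \<le> x" "0 \<le> u"
  then have "sqrt (max (u - x) 0) \<le> sqrt u" by auto
  moreover have "sqrt u - sqrt (max (u - x) 0) \<le> sqrt x"
  proof (cases "x \<le> u")
    case True
    then show ?thesis using \<open>0 \<le> x\<close> sqrt_diff_le_sqrt[of "u - x" u] by simp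
  qed (use \<open>0 \<le> u\<close> in auto)
  ultimately show ?thesis by (simp add: psi_def)
qed

locale nonneg_real_distribution = real_distribution \<mu> for \<mu> :: "real measure" +
  assumes no_negative: "measure \<mu> {..<0} = 0"
begin

lemma AE_nonneg: "AE u in \<mu>. 0 \<le> u"
proof -
  have "{..<0::real} \<in> null_sets \<mu>"
    using no_negative by (auto simp: null_sets_def emeasure_eq_measure)
  then show ?thesis by (rule AE_I'[rotated 0]) auto
qed

lemma integrable_psi:
  assumes "0 \<le> x"
  shows "integrable \<mu> (psi x)"
proof (rule integrable_const_bound)
  show "AE u in \<mu>. norm (psi x u) \<le> 2 * sqrt x"
    using AE_nonneg by eventually_elim (use psi_bounds[OF assms] in auto)
qed simp

lemma nn_integral_V_n:
  assumes "0 \<le> x"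
  shows "(\<integral>\<^sup>+y\<in>{0..x}. V_n \<mu> y \<partial>lborel) = (\<integral>\<^sup>+u. ennreal (psi x u) \<partial>\<mu>)"
proof -
  interpret pair_sigma_finite lborel \<mu> ..
  have "(\<integral>\<^sup>+y\<in>{0..x}. V_n \<mu> y \<partial>lborel)
      = (\<integral>\<^sup>+y. \<integral>\<^sup>+u. ennreal (1 / sqrt (u - y)) * (indicator {y<..} u * indicator {0..x} y) \<partial>\<mu> \<partial>lborel)"
    unfolding V_n_def
    by (intro nn_integral_cong) (subst nn_integral_multc[symmetric], simp, simp add: mult_ac)
  also have "\<dots> = (\<integral>\<^sup>+u. \<integral>\<^sup>+y. ennreal (1 / sqrt (u - y)) * (indicator {y<..} u * indicator {0..x} y) \<partial>lborel \<partial>\<mu>)"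
    by (rule Fubini'[symmetric]) (simp add: indicator_def)
  also have "\<dots> = (\<integral>\<^sup>+u. ennreal (psi x u) \<partial>\<mu>)"
  proof (rule nn_integral_cong_AE)
    have "(\<integral>\<^sup>+y. ennreal (1 / sqrt (u - y)) * (indicator {y<..} u * indicator {0..x} y) \<partial>lborel) = ennreal (psi x u)"
      if "0 \<le> u" for u
    proof -
      have "(\<integral>\<^sup>+y. ennreal (1 / sqrt (u - y)) * (indicator {y<..} u * indicator {0..x} y) \<partial>lborel)
         = (\<integral>\<^sup>+y\<in>{0..x} \<inter> {..<u}. ennreal (1 / sqrt (u - y)) \<partial>lborel)"
        by (intro nn_integral_cong) (auto split: split_indicator)
      then show ?thesis using nn_integral_inverse_sqrt_Ioo[of 0 x u] assms that by (simp add: psi_def)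
    qed
    then show "AE u in \<mu>. (\<integral>\<^sup>+y. ennreal (1 / sqrt (u - y)) * (indicator {y<..} u * indicator {0..x} y) \<partial>lborel) = ennreal (psi x u)"
      using AE_nonneg by auto
  qed
  finally show ?thesis .
qed

lemma U_n_eq_expectation:
  assumes "0 \<le> x"
  shows "U_n \<mu> x = expectation (psi x)"
proof -
  have "AE u in \<mu>. 0 \<le> psi x u" using AE_nonneg psi_bounds[OF assms] by auto
  then show ?thesis unfolding U_n_def nn_integral_V_n[OF assms]
    using integrable_psi[OF assms] by (intro integral_eq_nn_integral[symmetric]) auto
qed

end

text \<open>\<open>\<surd>w (\<surd>w - \<surd>(w - h)\<^sub>+) \<le> h\<close> because \<open>\<surd>(w - h)\<^sub>+ \<le> \<surd>w\<close>.\<close>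

lemma sqrt_increment_le:
  assumes "0 < w" "0 \<le> h"
  shows "0 \<le> sqrt w - sqrt (max (w - h) 0)" "sqrt w - sqrt (max (w - h) 0) \<le> h / sqrt w"
proof -
  let ?s = "sqrt (max (w - h) 0)"
  have s: "0 \<le> ?s" "?s \<le> sqrt w" using assms by auto
  then show "0 \<le> sqrt w - ?s" by simp
  have "w - h \<le> ?s * ?s" using assms by simp
  also have "\<dots> \<le> ?s * sqrt w" using s by (intro mult_left_mono)
  finally have "sqrt w * sqrt w - h \<le> ?s * sqrt w" using assms by simp
  then show "sqrt w - ?s \<le> h / sqrt w" using assms by (simp add: field_simps)
qed

lemma sqrt_increment_limit:
  assumes "0 < (w::real)"
  shows "((\<lambda>h. (sqrt w - sqrt (max (w - h) 0)) / h) \<longlongrightarrow> 1 / (2 * sqrt w)) (at_right 0)"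
proof -
  have "(sqrt has_real_derivative inverse (sqrt w) / 2) (at w)"
    using assms by (rule DERIV_real_sqrt)
  then have "((\<lambda>h. (sqrt (w + h) - sqrt w) / h) \<longlongrightarrow> inverse (sqrt w) / 2) (at_left 0)"
    unfolding DERIV_def by (rule filterlim_mono) (auto simp: at_le)
  then have "((\<lambda>h. (sqrt (w - h) - sqrt w) / - h) \<longlongrightarrow> inverse (sqrt w) / 2) (at_right 0)"
    unfolding filterlim_at_left_to_right by simp
  moreover have "\<forall>\<^sub>F h in at_right 0. (sqrt (w - h) - sqrt w) / - h = (sqrt w - sqrt (max (w - h) 0)) / h"
    using eventually_at_right_less[of 0] eventually_at_right_field[THEN iffD2, OF exI[of _ w]] assms
    by (auto simp: eventually_at_right_field divide_simps intro!: exI[of _ w])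
  ultimately show ?thesis
    by (auto simp: field_simps dest: tendsto_cong)
qed

locale radial_density = radial_law \<nu> r for \<nu> r +
  fixes \<rho> :: "real \<Rightarrow> real"
  assumes r_eq: "\<And>z. 0 \<le> z \<Longrightarrow> r z = ennreal (\<rho> z)"
    and \<rho>_nonneg: "\<And>z. 0 \<le> z \<Longrightarrow> 0 \<le> \<rho> z"
begin

abbreviation "dens u \<equiv> (\<integral>\<^sup>+z\<in>{u<..}. r z * ennreal (1 / sqrt (z - u)) \<partial>lborel)"

sublocale nonneg_real_distribution \<nu>
proof unfold_locales
  have "emeasure \<nu> {..<0} = (\<integral>\<^sup>+y. indicator {..<0} y \<partial>\<nu>)" by simp
  also have "\<dots> = ennreal pi * (\<integral>\<^sup>+y\<in>{0<..}. indicator {..<0} y * dens y \<partial>lborel)" by (rule law) simp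
  also have "(\<integral>\<^sup>+y\<in>{0<..}. indicator {..<0} y * dens y \<partial>lborel) = (\<integral>\<^sup>+y. 0 \<partial>(lborel :: real measure))"
    by (intro nn_integral_cong) (auto split: split_indicator)
  finally show "measure \<nu> {..<0} = 0" by (simp add: measure_def)
qed

lemma kernel_measurable:
  assumes "0 \<le> u"
  shows "(\<lambda>z. indicator {u<..} z *\<^sub>R (\<rho> z / sqrt (z - u))) \<in> borel_measurable borel"
proof -
  have "(\<lambda>z. indicator {u<..} z *\<^sub>R (\<rho> z / sqrt (z - u))) = (\<lambda>z. indicator {u<..} z *\<^sub>R (enn2real (r z) / sqrt (z - u)))"
    using assms by (auto split: split_indicator simp: r_eq \<rho>_nonneg)
  then show ?thesis by simp
qed

lemma kernel_nn_integral:
  assumes "0 \<le> u"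
  shows "(\<integral>\<^sup>+z. ennreal (indicator {u<..} z *\<^sub>R (\<rho> z / sqrt (z - u))) \<partial>lborel) = dens u"
  using assms by (intro nn_integral_cong)
    (auto split: split_indicator simp: r_eq \<rho>_nonneg ennreal_mult[symmetric])

lemma g_dens_eq:
  assumes "0 \<le> u"
  shows "g_dens \<rho> u = pi * enn2real (dens u)"
proof -
  have "(LINT z:{u<..}|lborel. \<rho> z / sqrt (z - u)) = enn2real (dens u)"
    unfolding set_lebesgue_integral_def kernel_nn_integral[OF assms, symmetric]
    using kernel_measurable[OF assms] assms
    by (intro integral_eq_nn_integral) (auto split: split_indicator simp: \<rho>_nonneg)
  then show ?thesis by (simp add: g_dens_def)
qed

lemma dens_measurable [measurable]: "(\<lambda>u. dens u) \<in> borel_measurable borel"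
  by (simp add: indicator_def)

text \<open>The two integrals can differ only where \<open>g_dens\<close> has its default value 0 in place of \<open>\<infinity>\<close>. That is a
  null set, because \<open>V_n \<nu> y\<close> is finite.\<close>

lemma V_fun_eq:
  assumes "0 < y"
  shows "V_fun \<rho> y = enn2real (V_n \<nu> y)"
proof -
  have V: "V_n \<nu> y = ennreal pi * (\<integral>\<^sup>+u. ennreal (1 / sqrt (u - y)) * dens u * indicator {y<..} u \<partial>lborel)"
    unfolding V_n_def using assms
    by (subst law) (auto intro!: arg_cong[where f="\<lambda>x. ennreal pi * x"] nn_integral_cong split: split_indicator)
  have "(\<integral>\<^sup>+u. ennreal (1 / sqrt (u - y)) * dens u * indicator {y<..} u \<partial>lborel) \<noteq> \<infinity>"
    using V_n_radial_finite[OF assms] unfolding V by (auto simp: ennreal_mult_eq_top_iff)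
  then have "AE u in lborel. ennreal (1 / sqrt (u - y)) * dens u * indicator {y<..} u \<noteq> \<infinity>"
    by (intro nn_integral_PInf_AE) auto
  then have "AE u in lborel. ennreal (indicator {y<..} u *\<^sub>R (g_dens \<rho> u / sqrt (u - y)))
      = ennreal pi * (ennreal (1 / sqrt (u - y)) * dens u * indicator {y<..} u)"
  proof eventually_elim
    case (elim u)
    show ?case
    proof (cases "y < u")
      case True
      then have "dens u < \<infinity>" using elim by (auto simp: ennreal_mult_eq_top_iff less_top)
      then obtain K where K: "dens u = ennreal K" "0 \<le> K" by (cases "dens u") auto
      have "g_dens \<rho> u = pi * K" using assms True K by (subst g_dens_eq) auto
      moreover have "ennreal (pi * (1 / sqrt (u - y) * K)) = ennreal pi * (ennreal (1 / sqrt (u - y)) * ennreal K)"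
        using True K by (subst ennreal_mult, simp, simp, subst ennreal_mult, simp_all)
      ultimately show ?thesis using True K by simp
    qed auto
  qed
  then have "V_n \<nu> y = (\<integral>\<^sup>+u. ennreal (indicator {y<..} u *\<^sub>R (g_dens \<rho> u / sqrt (u - y))) \<partial>lborel)"
    unfolding V by (subst nn_integral_cmult[symmetric]) (auto intro!: nn_integral_cong_AE)
  moreover have "(\<lambda>u. indicator {y<..} u *\<^sub>R (g_dens \<rho> u / sqrt (u - y))) \<in> borel_measurable borel"
  proof -
    have "(\<lambda>u. indicator {y<..} u *\<^sub>R (g_dens \<rho> u / sqrt (u - y))) = (\<lambda>u. indicator {y<..} u *\<^sub>R (pi * enn2real (dens u) / sqrt (u - y)))"
      using assms by (auto split: split_indicator simp: g_dens_eq)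
    then show ?thesis by simp
  qed
  moreover have "0 \<le> indicator {y<..} u *\<^sub>R (g_dens \<rho> u / sqrt (u - y))" for u
    using assms by (auto split: split_indicator simp: g_dens_eq)
  ultimately show ?thesis
    unfolding V_fun_def set_lebesgue_integral_def by (subst integral_eq_nn_integral) auto
qed

lemma V_fun_antimono: "0 < a \<Longrightarrow> a \<le> b \<Longrightarrow> V_fun \<rho> b \<le> V_fun \<rho> a"
  using V_n_radial_finite[of a] by (simp add: V_fun_eq enn2real_mono V_n_radial_antimono)

lemma V_fun_deriv_nonpos:
  assumes "0 < x0" "(V_fun \<rho> has_real_derivative D) (at x0)"
  shows "D \<le> 0"
proof -
  have "((\<lambda>x. - V_fun \<rho> x) has_real_derivative - D) (at x0)"
    using assms(2) by (auto intro!: derivative_eq_intros)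
  then have "0 \<le> - D"
    using assms(1) by (intro mono_on_imp_deriv_nonneg[of "{0<..}" "\<lambda>x. - V_fun \<rho> x"])
       (auto simp: mono_on_def V_fun_antimono interior_open)
  then show ?thesis by simp
qed

text \<open>\<open>U\<close> is concave, being the integral of the nonincreasing function \<open>V\<close>.\<close>

lemma U_n_supergradient:
  assumes "0 < c" "0 \<le> b"
  shows "U_n \<nu> b \<le> U_n \<nu> c + enn2real (V_n \<nu> c) * (b - c)"
proof -
  define I where "I A = (\<integral>\<^sup>+y\<in>A. V_n \<nu> y \<partial>lborel)" for A
  have I_fin: "I {0..x} < \<infinity>" if "0 \<le> x" for x
    unfolding I_def nn_integral_V_n[OF that] using integrable_psi[OF that]
    by (subst nn_integral_eq_integral) (use AE_nonneg psi_bounds[OF that] in auto)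
  have [measurable]: "V_n \<nu> \<in> borel_measurable borel"
    unfolding V_n_def by (intro borel_measurable_nn_integral) (simp add: indicator_def)
  have split: "I {0..b} = I {0..a} + I {a<..b}" if "0 \<le> a" "a \<le> b" for a b
    unfolding I_def using that by (subst nn_integral_add[symmetric])
      (auto intro!: nn_integral_cong split: split_indicator)
  have U: "U_n \<nu> x = enn2real (I {0..x})" for x by (simp add: U_n_def I_def)
  define v where "v = enn2real (V_n \<nu> c)"
  have v: "V_n \<nu> c = ennreal v" "0 \<le> v" using V_n_radial_finite[OF assms(1)] by (auto simp: v_def)
  show ?thesis
  proof (cases "c \<le> b")
    case True
    have "I {c<..b} \<le> (\<integral>\<^sup>+y. ennreal v * indicator {c<..b} y \<partial>lborel)"
      unfolding I_def using V_n_radial_antimono[of c] assms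
      by (intro nn_integral_mono) (auto split: split_indicator simp: v(1)[symmetric])
    also have "\<dots> = ennreal (v * (b - c))" using True v by (simp add: nn_integral_cmult_indicator ennreal_mult)
    finally have "I {0..b} \<le> I {0..c} + ennreal (v * (b - c))"
      using split[of c b] assms True by (simp add: add_left_mono)
    then have "enn2real (I {0..b}) \<le> enn2real (I {0..c} + ennreal (v * (b - c)))"
      using I_fin[of c] assms by (intro enn2real_mono) auto
    also have "\<dots> = enn2real (I {0..c}) + v * (b - c)"
      using I_fin[of c] assms True v by (subst enn2real_plus) auto
    finally show ?thesis by (simp add: U v_def)
  next
    case False
    have "ennreal (v * (c - b)) = (\<integral>\<^sup>+y. ennreal v * indicator {b<..c} y \<partial>lborel)"
      using False v by (simp add: nn_integral_cmult_indicator ennreal_mult)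
    also have "\<dots> \<le> I {b<..c}"
      unfolding I_def
    proof (rule nn_integral_mono)
      fix y :: real
      show "ennreal v * indicator {b<..c} y \<le> V_n \<nu> y * indicator {b<..c} y"
        using V_n_radial_antimono[of y c] assms by (auto split: split_indicator simp: v(1)[symmetric])
    qed
    finally have "I {0..b} + ennreal (v * (c - b)) \<le> I {0..c}"
      using split[of b c] assms False by (simp add: add_left_mono)
    then have "enn2real (I {0..b} + ennreal (v * (c - b))) \<le> enn2real (I {0..c})"
      using I_fin[of c] assms by (intro enn2real_mono) auto
    then have "enn2real (I {0..b}) + v * (c - b) \<le> enn2real (I {0..c})"
      using I_fin[of b] assms False v by (subst (asm) enn2real_plus) auto
    then show ?thesis by (simp add: U v_def algebra_simps)
  qed
qed

lemma dens_finite: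
  assumes "0 \<le> x0" "0 < g_dens \<rho> x0"
  shows "dens x0 < \<infinity>"
  using assms g_dens_eq[of x0] by (auto simp: less_top[symmetric])

text \<open>The mass of \<open>(x\<^sub>0, x\<^sub>0 + h]\<close> is \<open>2 \<pi>\<close> times the integral of \<open>\<rho>(z)\<close> against an increment of the square root.
  Divided by \<open>h\<close> that increment is at most \<open>1 / \<surd>(z - x\<^sub>0)\<close>, which is integrable against \<open>\<rho>\<close> since the
  value \<open>g_dens \<rho> x\<^sub>0 > 0\<close> is not the default value of a divergent integral. So dominated convergence gives
  the right density at \<open>x\<^sub>0\<close>, although the density need not be continuous there.\<close>

lemma right_mass_limit:
  assumes "0 < x0" "0 < g_dens \<rho> x0"
  shows "((\<lambda>h. measure \<nu> {x0<..x0 + h} / h) \<longlongrightarrow> g_dens \<rho> x0) (at_right 0)"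
proof (rule tendsto_at_right_sequentially[of 0 1])
  fix S :: "nat \<Rightarrow> real" assume S: "\<And>n. 0 < S n" "S \<longlonglongrightarrow> 0"
  have Sr: "filterlim S (at_right 0) sequentially"
  proof -
    have "S n \<in> {0<..} \<and> S n \<noteq> 0" for n using S(1)[of n] by auto
    then show ?thesis using S(2) by (simp add: filterlim_at)
  qed
  let ?q = "\<lambda>n z. (sqrt (z - x0) - sqrt (max (z - x0 - S n) 0)) / S n"
  let ?F = "\<lambda>n z. r z * ennreal (?q n z) * indicator {x0<..} z"
  have "(\<lambda>n. \<integral>\<^sup>+z. ?F n z \<partial>lborel) \<longlonglongrightarrow> (\<integral>\<^sup>+z. r z * ennreal (1 / (2 * sqrt (z - x0))) * indicator {x0<..} z \<partial>lborel)"
  proof (rule nn_integral_dominated_convergence)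
    show "(\<integral>\<^sup>+z\<in>{x0<..}. r z * ennreal (1 / sqrt (z - x0)) \<partial>lborel) < \<infinity>"
      using dens_finite assms by simp
    show "AE z in lborel. ?F n z \<le> r z * ennreal (1 / sqrt (z - x0)) * indicator {x0<..} z" for n
    proof (rule AE_I2)
      fix z
      have "?q n z \<le> 1 / sqrt (z - x0)" if "x0 < z"
        using sqrt_increment_le(2)[of "z - x0" "S n"] S(1)[of n] that by (simp add: field_simps)
      then show "?F n z \<le> r z * ennreal (1 / sqrt (z - x0)) * indicator {x0<..} z"
        by (auto split: split_indicator intro!: mult_left_mono ennreal_leI)
    qed
    show "AE z in lborel. (\<lambda>n. ?F n z) \<longlonglongrightarrow> r z * ennreal (1 / (2 * sqrt (z - x0))) * indicator {x0<..} z"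
    proof (rule AE_I2)
      fix z
      show "(\<lambda>n. ?F n z) \<longlonglongrightarrow> r z * ennreal (1 / (2 * sqrt (z - x0))) * indicator {x0<..} z"
      proof (cases "x0 < z")
        case True
        have "(\<lambda>n. ?q n z) \<longlonglongrightarrow> 1 / (2 * sqrt (z - x0))"
          using filterlim_compose[OF sqrt_increment_limit[of "z - x0"] Sr] True by simp
        moreover have "r z = ennreal (\<rho> z)" using True assms by (intro r_eq) simp
        ultimately show ?thesis using True
          by (auto intro!: ennreal_tendsto_cmult)
      qed auto
    qed
  qed auto
  also have "(\<integral>\<^sup>+z. r z * ennreal (1 / (2 * sqrt (z - x0))) * indicator {x0<..} z \<partial>lborel) = ennreal (1/2) * dens x0"
  proof -
    have "r z * ennreal (1 / (2 * sqrt (z - x0))) * indicator {x0<..} z = ennreal (1/2) * (r z * ennreal (1 / sqrt (z - x0)) * indicator {x0<..} z)" for z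
    proof -
      have "ennreal (1 / (2 * sqrt (z - x0))) = ennreal (1/2) * ennreal (1 / sqrt (z - x0))"
        by (subst ennreal_mult'[symmetric]) auto
      then show ?thesis by (simp only: mult_ac)
    qed
    then show ?thesis by (simp only:) (subst nn_integral_cmult, auto)
  qed
  finally have lim: "(\<lambda>n. ennreal (2 * pi) * (\<integral>\<^sup>+z. ?F n z \<partial>lborel)) \<longlonglongrightarrow> ennreal (2 * pi) * (ennreal (1/2) * dens x0)"
    by (intro ennreal_tendsto_cmult) auto
  have "ennreal (2 * pi) * (\<integral>\<^sup>+z. ?F n z \<partial>lborel) = ennreal (measure \<nu> {x0<..x0 + S n} / S n)" for n
  proof -
    have "ennreal (1 / S n) * emeasure \<nu> {x0<..x0 + S n}
       = ennreal (2 * pi) * (ennreal (1 / S n) * (\<integral>\<^sup>+z\<in>{x0<..}. r z * ennreal (sqrt (z - x0) - sqrt (max (z - (x0 + S n)) 0)) \<partial>lborel))"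
      using assms S(1)[of n] by (subst emeasure_Ioc) (auto simp: mult_ac)
    also have "ennreal (1 / S n) * (\<integral>\<^sup>+z\<in>{x0<..}. r z * ennreal (sqrt (z - x0) - sqrt (max (z - (x0 + S n)) 0)) \<partial>lborel)
       = (\<integral>\<^sup>+z. ?F n z \<partial>lborel)"
    proof (subst nn_integral_cmult[symmetric], simp, rule nn_integral_cong)
      fix z
      have "ennreal (1 / S n) * ennreal (sqrt (z - x0) - sqrt (max (z - (x0 + S n)) 0)) = ennreal (?q n z)"
        using S(1)[of n] by (subst ennreal_mult'[symmetric]) (auto simp: diff_diff_eq)
      from this[symmetric] show "ennreal (1 / S n) * (r z * ennreal (sqrt (z - x0) - sqrt (max (z - (x0 + S n)) 0)) * indicator {x0<..} z) = ?F n z"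
        by (simp only: mult_ac)
    qed
    finally have "ennreal (2 * pi) * (\<integral>\<^sup>+z. ?F n z \<partial>lborel) = ennreal (1 / S n) * emeasure \<nu> {x0<..x0 + S n}" ..
    also have "\<dots> = ennreal (measure \<nu> {x0<..x0 + S n} / S n)"
      unfolding emeasure_eq_measure using S(1)[of n] by (subst ennreal_mult'[symmetric]) auto
    finally show ?thesis .
  qed
  moreover have "ennreal (2 * pi) * (ennreal (1/2) * dens x0) = ennreal (g_dens \<rho> x0)"
  proof -
    have "dens x0 = ennreal (enn2real (dens x0))" using dens_finite assms by simp
    then have "ennreal (2 * pi) * (ennreal (1/2) * dens x0) = ennreal (2 * pi) * (ennreal (1/2) * ennreal (enn2real (dens x0)))"
      by simp
    also have "\<dots> = ennreal (2 * pi * (1/2 * enn2real (dens x0)))"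
      by (subst ennreal_mult, simp, simp, subst ennreal_mult, simp_all)
    finally show ?thesis using g_dens_eq[of x0] assms by simp
  qed
  ultimately have "(\<lambda>n. ennreal (measure \<nu> {x0<..x0 + S n} / S n)) \<longlonglongrightarrow> ennreal (g_dens \<rho> x0)"
    using lim by simp
  then show "(\<lambda>n. measure \<nu> {x0<..x0 + S n} / S n) \<longlonglongrightarrow> g_dens \<rho> x0"
    using S(1)[THEN less_imp_le] assms by (subst (asm) tendsto_ennreal_iff) (auto intro!: always_eventually divide_nonneg_nonneg)
qed simp

text \<open>To the left of \<open>x\<^sub>0\<close> there is the additional contribution of \<open>\<rho>\<close> on \<open>(x\<^sub>0 - h, x\<^sub>0]\<close>. Its mass is \<open>O(h)\<close>
  because \<open>V\<close> is differentiable at \<open>x\<^sub>0\<close>.\<close>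

lemma left_mass_le:
  assumes "0 < x0" "0 < g_dens \<rho> x0" "(V_fun \<rho> has_real_derivative D) (at x0)"
  shows "\<exists>B. \<forall>\<^sub>F h in at_right 0. measure \<nu> {x0 - h<..x0} \<le> B * h"
proof -
  have "((\<lambda>h. (V_fun \<rho> (x0 + h) - V_fun \<rho> x0) / h) \<longlongrightarrow> D) (at_left 0)"
    using assms(3) unfolding DERIV_def by (rule filterlim_mono) (auto simp: at_le)
  then have "((\<lambda>h. (V_fun \<rho> (x0 - h) - V_fun \<rho> x0) / - h) \<longlongrightarrow> D) (at_right 0)"
    unfolding filterlim_at_left_to_right by simp
  then have "\<forall>\<^sub>F h in at_right 0. (V_fun \<rho> (x0 - h) - V_fun \<rho> x0) / - h > D - 1"
    by (rule order_tendstoD) simp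
  moreover have "\<forall>\<^sub>F h in at_right 0. 0 < h \<and> h < min 1 x0"
    using assms(1) by (auto simp: eventually_at_right_field intro!: exI[of _ "min 1 x0"])
  ultimately have "\<forall>\<^sub>F h in at_right 0. measure \<nu> {x0 - h<..x0} \<le> (2 * (1 - D) + 2 * pi * enn2real (dens x0)) * h"
  proof eventually_elim
    case (elim h)
    then have h: "0 < h" "h < 1" "h < x0" by auto
    define m where "m = (\<integral>\<^sup>+z\<in>{x0 - h<..x0}. r z \<partial>lborel)"
    define K where "K = enn2real (dens x0)"
    have K: "dens x0 = ennreal K" "0 \<le> K" using dens_finite assms by (auto simp: K_def)
    have "V_n \<nu> (x0 - h) = ennreal (pi\<^sup>2) * (m + (\<integral>\<^sup>+z\<in>{x0<..}. r z \<partial>lborel))"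
      unfolding m_def using h by (subst V_n_radial, simp, subst nn_integral_add[symmetric])
        (auto intro!: arg_cong[where f="\<lambda>x. ennreal (pi\<^sup>2) * x"] nn_integral_cong split: split_indicator)
    also have "\<dots> = ennreal (pi\<^sup>2) * m + V_n \<nu> x0"
      using h assms by (subst V_n_radial) (auto simp: distrib_left)
    finally have V: "V_n \<nu> (x0 - h) = ennreal (pi\<^sup>2) * m + V_n \<nu> x0" .
    have "ennreal (pi\<^sup>2) * m < \<infinity>" using V_n_radial_finite[of "x0 - h"] h unfolding V by auto
    then have m: "m = ennreal (enn2real m)" by (auto simp: ennreal_mult_less_top)
    have "V_fun \<rho> (x0 - h) = pi\<^sup>2 * enn2real m + V_fun \<rho> x0"
      using h assms V_n_radial_finite[of x0] \<open>ennreal (pi\<^sup>2) * m < \<infinity>\<close>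
      by (simp add: V_fun_eq V enn2real_plus enn2real_mult)
    moreover have "V_fun \<rho> (x0 - h) - V_fun \<rho> x0 \<le> (1 - D) * h"
      using elim(1) h by (simp add: field_simps)
    ultimately have "pi\<^sup>2 * enn2real m \<le> (1 - D) * h" by simp
    moreover have "pi * enn2real m \<le> pi\<^sup>2 * enn2real m"
      using pi_gt3 mult_right_mono[of 1 pi "enn2real m"] by (simp add: power2_eq_square)
    ultimately have mb: "pi * enn2real m \<le> (1 - D) * h" by linarith
    have "emeasure \<nu> {x0 - h<..x0} = ennreal (2 * pi) * (\<integral>\<^sup>+z\<in>{x0 - h<..}. r z * ennreal (sqrt (z - (x0 - h)) - sqrt (max (z - x0) 0)) \<partial>lborel)"
      using h by (intro emeasure_Ioc) auto
    also have "\<dots> \<le> ennreal (2 * pi) * (\<integral>\<^sup>+z. r z * indicator {x0 - h<..x0} z + ennreal h * (r z * ennreal (1 / sqrt (z - x0)) * indicator {x0<..} z) \<partial>lborel)"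
    proof (intro mult_left_mono nn_integral_mono)
      fix z
      have 1: "sqrt (z - (x0 - h)) - sqrt (max (z - x0) 0) \<le> 1" if "z \<le> x0" "x0 - h < z"
        using that h by simp
      have 2: "sqrt (z - (x0 - h)) - sqrt (max (z - x0) 0) \<le> h * (1 / sqrt (z - x0))" if "x0 < z"
      proof -
        have "sqrt (z - (x0 - h)) - sqrt (max (z - x0) 0) \<le> h / sqrt (z - (x0 - h))"
          using sqrt_increment_le(2)[of "z - (x0 - h)" h] that h by simp
        also have "\<dots> \<le> h / sqrt (z - x0)" using that h by (intro divide_left_mono) auto
        finally show ?thesis by simp
      qed
      consider "z \<le> x0 - h" | "x0 - h < z" "z \<le> x0" | "x0 < z" by linarith
      then show "r z * ennreal (sqrt (z - (x0 - h)) - sqrt (max (z - x0) 0)) * indicator {x0 - h<..} z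
        \<le> r z * indicator {x0 - h<..x0} z + ennreal h * (r z * ennreal (1 / sqrt (z - x0)) * indicator {x0<..} z)"
      proof cases
        case 2
        have "r z * ennreal (sqrt (z - (x0 - h)) - sqrt (max (z - x0) 0)) \<le> r z * 1"
          using 1 2 by (intro mult_left_mono) (auto simp: ennreal_le_1)
        then show ?thesis using 2 by simp
      next
        case 3
        have "r z * ennreal (sqrt (z - (x0 - h)) - sqrt (max (z - x0) 0)) \<le> r z * ennreal (h * (1 / sqrt (z - x0)))"
          using 2 3 by (intro mult_left_mono ennreal_leI) auto
        also have "\<dots> = ennreal h * (r z * ennreal (1 / sqrt (z - x0)))"
          using h 3 by (subst ennreal_mult) (auto simp: mult_ac)
        finally show ?thesis using 3 h by simp
      qed auto
    qed auto
    also have "(\<integral>\<^sup>+z. r z * indicator {x0 - h<..x0} z + ennreal h * (r z * ennreal (1 / sqrt (z - x0)) * indicator {x0<..} z) \<partial>lborel)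
        = m + ennreal h * dens x0"
      unfolding m_def by (subst nn_integral_add) (auto simp: nn_integral_cmult)
    also have "ennreal (2 * pi) * (m + ennreal h * dens x0) = ennreal (2 * pi * (enn2real m + h * K))"
      using h K m by (simp add: ennreal_mult ennreal_plus)
    finally have "measure \<nu> {x0 - h<..x0} \<le> 2 * pi * (enn2real m + h * K)"
      unfolding emeasure_eq_measure using h K by (subst (asm) ennreal_le_iff) auto
    also have "\<dots> \<le> (2 * (1 - D) + 2 * pi * K) * h"
      using mb by (simp add: algebra_simps)
    finally show ?case unfolding K_def .
  qed
  then show ?thesis by blast
qed

lemma mass_near_le:
  assumes "0 < x0" "0 < g_dens \<rho> x0" "(V_fun \<rho> has_real_derivative D) (at x0)"
  obtains B where "0 < B" "\<And>h. 0 \<le> h \<Longrightarrow> measure \<nu> {x0 - h<..x0 + h} \<le> B * h"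
proof -
  obtain B1 where "\<forall>\<^sub>F h in at_right 0. measure \<nu> {x0 - h<..x0} \<le> B1 * h"
    using left_mass_le[OF assms] by blast
  moreover have "\<forall>\<^sub>F h in at_right 0. measure \<nu> {x0<..x0 + h} / h < g_dens \<rho> x0 + 1"
    by (rule order_tendstoD(2)[OF right_mass_limit[OF assms(1,2)]]) simp
  moreover have "\<forall>\<^sub>F h in at_right 0. 0 < (h::real)"
    by (auto simp: eventually_at_right_field intro: exI[of _ 1])
  ultimately have "\<forall>\<^sub>F h in at_right 0. measure \<nu> {x0 - h<..x0 + h} \<le> (B1 + g_dens \<rho> x0 + 1) * h"
  proof eventually_elim
    case (elim h)
    have "{x0 - h<..x0 + h} = {x0 - h<..x0} \<union> {x0<..x0 + h}" using elim by auto
    then have "measure \<nu> {x0 - h<..x0 + h} \<le> measure \<nu> {x0 - h<..x0} + measure \<nu> {x0<..x0 + h}"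
      by (simp add: measure_Un_le)
    also have "\<dots> \<le> B1 * h + (g_dens \<rho> x0 + 1) * h"
      using elim by (intro add_mono) (simp_all add: divide_simps split: if_splits)
    finally show ?case by (simp add: algebra_simps)
  qed
  then obtain d where d: "0 < d" "\<And>h. 0 < h \<Longrightarrow> h < d \<Longrightarrow> measure \<nu> {x0 - h<..x0 + h} \<le> (B1 + g_dens \<rho> x0 + 1) * h"
    unfolding eventually_at_right_field by auto
  define B where "B = max (\<bar>B1 + g_dens \<rho> x0 + 1\<bar>) (1 / d)"
  have "measure \<nu> {x0 - h<..x0 + h} \<le> B * h" if "0 \<le> h" for h
  proof (cases "h = 0 \<or> d \<le> h")
    case True
    then show ?thesis
    proof
      assume "d \<le> h"
      have "measure \<nu> {x0 - h<..x0 + h} \<le> 1" by simp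
      also have "1 \<le> 1 / d * h" using d \<open>d \<le> h\<close> by simp
      also have "\<dots> \<le> B * h" using that by (intro mult_right_mono) (auto simp: B_def)
      finally show ?thesis .
    qed auto
  next
    case False
    then have "measure \<nu> {x0 - h<..x0 + h} \<le> (B1 + g_dens \<rho> x0 + 1) * h" using that by (intro d) auto
    also have "\<dots> \<le> B * h" using that by (intro mult_right_mono) (auto simp: B_def)
    finally show ?thesis .
  qed
  moreover have "0 < B" using d by (auto simp: B_def less_max_iff_disj)
  ultimately show ?thesis using that by blast
qed

end

section \<open>Least concave majorants\<close>

lemma least_concave_majorant_upper:
  assumes "concave_on I c" "\<And>y. y \<in> I \<Longrightarrow> h y \<le> c y" "x \<in> I"
  shows "least_concave_majorant I h x \<le> c x"
  unfolding least_concave_majorant_def using assms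
  by (intro cINF_lower) (auto intro!: bdd_belowI2[of _ "h x"])

lemma least_concave_majorant_greatest:
  assumes "concave_on I c0" "\<And>y. y \<in> I \<Longrightarrow> h y \<le> c0 y"
    and "\<And>c. concave_on I c \<Longrightarrow> (\<And>y. y \<in> I \<Longrightarrow> h y \<le> c y) \<Longrightarrow> a \<le> c x"
  shows "a \<le> least_concave_majorant I h x"
  unfolding least_concave_majorant_def using assms by (intro cINF_greatest) auto

lemma least_concave_majorant_ge:
  assumes "concave_on I c0" "\<And>y. y \<in> I \<Longrightarrow> h y \<le> c0 y" "x \<in> I"
  shows "h x \<le> least_concave_majorant I h x"
  using assms by (intro least_concave_majorant_greatest[OF assms(1,2)]) auto

lemma concave_on_least_concave_majorant:
  assumes "concave_on I c0" "\<And>y. y \<in> I \<Longrightarrow> h y \<le> c0 y"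
  shows "concave_on I (least_concave_majorant I h)"
  unfolding concave_on_iff
proof (intro conjI ballI allI impI)
  show "convex I" using assms(1) by (rule concave_on_imp_convex)
  fix x y u v :: real
  assume xy: "x \<in> I" "y \<in> I" and uv: "0 \<le> u" "0 \<le> v" "u + v = 1"
  show "u * least_concave_majorant I h x + v * least_concave_majorant I h y
      \<le> least_concave_majorant I h (u *\<^sub>R x + v *\<^sub>R y)"
  proof (rule least_concave_majorant_greatest[OF assms])
    fix c assume c: "concave_on I c" "\<And>y. y \<in> I \<Longrightarrow> h y \<le> c y"
    have "u * least_concave_majorant I h x + v * least_concave_majorant I h y \<le> u * c x + v * c y"
      using xy uv c by (intro add_mono mult_left_mono least_concave_majorant_upper) auto
    also have "\<dots> \<le> c (u *\<^sub>R x + v *\<^sub>R y)"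
      using c(1) xy uv unfolding concave_on_iff by blast
    finally show "u * least_concave_majorant I h x + v * least_concave_majorant I h y \<le> c (u *\<^sub>R x + v *\<^sub>R y)" .
  qed
qed

lemma least_concave_majorant_concave:
  assumes "concave_on I h" "x \<in> I"
  shows "least_concave_majorant I h x = h x"
  using assms least_concave_majorant_upper[of I h h x] least_concave_majorant_ge[of I h h x] by auto

text \<open>Adding \<open>e\<close> to a concave majorant of \<open>g\<close> gives one of \<open>f\<close>: the majorant depends on the function in a
  Lipschitz way, for the supremum norm.\<close>

lemma least_concave_majorant_perturb:
  assumes "concave_on I cf" "\<And>y. y \<in> I \<Longrightarrow> f y \<le> cf y"
    and "\<And>y. y \<in> I \<Longrightarrow> f y \<le> g y + e" "concave_on I cg" "\<And>y. y \<in> I \<Longrightarrow> g y \<le> cg y" "x \<in> I"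
  shows "least_concave_majorant I f x \<le> least_concave_majorant I g x + e"
proof -
  have "least_concave_majorant I f x - e \<le> least_concave_majorant I g x"
  proof (rule least_concave_majorant_greatest[OF assms(4,5)])
    fix c assume c: "concave_on I c" "\<And>y. y \<in> I \<Longrightarrow> g y \<le> c y"
    have "least_concave_majorant I f x \<le> c x + e"
    proof (rule least_concave_majorant_upper)
      have "convex I" using c(1) by (rule concave_on_imp_convex)
      then show "concave_on I (\<lambda>x. c x + e)" using c(1) by (intro concave_on_add) (simp_all add: concave_on_const)
      show "f y \<le> c y + e" if "y \<in> I" for y using assms(3)[OF that] c(2)[OF that] by simp
    qed fact
    then show "least_concave_majorant I f x - e \<le> c x" by simp
  qed
  then show ?thesis by simp
qed

lemma right_deriv_eqI:
  assumes "(f has_real_derivative D) (at_right x)"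
  shows "right_deriv f x = D"
  unfolding right_deriv_def
proof (rule the_equality)
  fix D' assume "(f has_real_derivative D') (at_right x)"
  then show "D' = D"
    using assms unfolding has_field_derivative_iff
    by (intro tendsto_unique[of "at_right x"]) auto
qed fact

lemma concave_chord_le:
  fixes f :: "real \<Rightarrow> real"
  assumes "concave_on I f" "a \<in> I" "c \<in> I" "a < b" "b < c"
  shows "(c - b) * f a + (b - a) * f c \<le> (c - a) * f b"
proof -
  let ?u = "(c - b) / (c - a)" and ?v = "(b - a) / (c - a)"
  have "?u + ?v = 1" using assms by (simp add: add_divide_distrib[symmetric])
  moreover have "0 \<le> ?u" "0 \<le> ?v" using assms by auto
  ultimately have "?u * f a + ?v * f c \<le> f (?u *\<^sub>R a + ?v *\<^sub>R c)"
    using assms(1-3) unfolding concave_on_iff by blast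
  also have "?u *\<^sub>R a + ?v *\<^sub>R c = b"
  proof -
    have "(c - b) * a + (b - a) * c = b * (c - a)" by algebra
    then have "((c - b) * a + (b - a) * c) / (c - a) = b" using assms by simp
    then show ?thesis by (simp add: add_divide_distrib)
  qed
  finally have "?u * f a + ?v * f c \<le> f b" .
  then have "(c - a) * (?u * f a + ?v * f c) \<le> (c - a) * f b" using assms by (intro mult_left_mono) auto
  moreover have "(c - a) * (?u * f a + ?v * f c) = (c - b) * f a + (b - a) * f c"
    using assms by (simp add: distrib_left)
  ultimately show ?thesis by simp
qed

text \<open>The difference quotient of a concave function is antitone and bounded, so the right derivative
  is its supremum.\<close>

lemma concave_right_deriv:
  fixes f :: "real \<Rightarrow> real"
  assumes f: "concave_on {0..} f" and x: "0 < x"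
  shows "(f has_real_derivative right_deriv f x) (at_right x)" (is ?D)
    and "0 < d \<Longrightarrow> (f (x + d) - f x) / d \<le> right_deriv f x" (is "_ \<Longrightarrow> ?R")
    and "0 < d \<Longrightarrow> d \<le> x \<Longrightarrow> right_deriv f x \<le> (f x - f (x - d)) / d" (is "_ \<Longrightarrow> _ \<Longrightarrow> ?L")
proof -
  define q where "q h = (f (x + h) - f x) / h" for h
  have q_mono: "q k \<le> q h" if "0 < h" "h \<le> k" for h k
  proof (cases "h = k")
    case False
    then show ?thesis using concave_chord_le[OF f, of x "x + k" "x + h"] that x
      by (simp add: q_def field_simps)
  qed simp
  have left: "q h \<le> (f x - f (x - d)) / d" if "0 < h" "0 < d" "d \<le> x" for h d
    using concave_chord_le[OF f, of "x - d" "x + h" x] that by (simp add: q_def field_simps)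
  define D where "D = (SUP h\<in>{0<..}. q h)"
  have bdd: "bdd_above (q ` {0<..})"
    using left[of _ x] x by (intro bdd_aboveI2) auto
  have upper: "q h \<le> D" if "0 < h" for h
    unfolding D_def using that bdd by (intro cSUP_upper) auto
  have "(q \<longlongrightarrow> D) (at_right 0)"
  proof (rule order_tendstoI)
    fix a assume "a < D"
    then obtain h0 where h0: "0 < h0" "a < q h0"
      unfolding D_def using less_cSUP_iff[OF _ bdd, of a] by auto
    then have "a < q h" if "0 < h" "h < h0" for h
      using q_mono[of h h0] that by auto
    then show "\<forall>\<^sub>F h in at_right 0. a < q h"
      using h0(1) by (auto simp: eventually_at_right_field)
  next
    fix a assume "D < a"
    then have "q h < a" if "0 < h" for h using upper[OF that] by simp
    then show "\<forall>\<^sub>F h in at_right 0. q h < a" by (auto simp: eventually_at_right_field intro: exI[of _ 1])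
  qed
  then have "((\<lambda>y. (f y - f x) / (y - x)) \<longlongrightarrow> D) (at_right x)"
    unfolding q_def by (subst filterlim_at_right_to_0) (simp add: add.commute)
  then have D: "(f has_real_derivative D) (at_right x)" by (simp add: has_field_derivative_iff)
  then have eq: "right_deriv f x = D" by (rule right_deriv_eqI)
  show ?D using D eq by simp
  show ?R if "0 < d" using upper[OF that] by (simp add: eq q_def)
  show ?L if "0 < d" "d \<le> x"
    unfolding eq D_def using left that by (intro cSUP_least) auto
qed

text \<open>An affine majorant that almost touches \<open>h\<close> at \<open>x\<close> pins the derivative down.\<close>

lemma right_deriv_least_concave_majorant_bounds:
  fixes h :: "real \<Rightarrow> real"
  assumes "0 < x" "\<And>y. 0 \<le> y \<Longrightarrow> h y \<le> h x + k + s * (y - x)" "0 < d" "d \<le> x"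
  shows "(h (x + d) - h x - k) / d \<le> right_deriv (least_concave_majorant {0..} h) x"
    and "right_deriv (least_concave_majorant {0..} h) x \<le> (h x + k - h (x - d)) / d"
proof -
  let ?L = "least_concave_majorant {0..} h" and ?c = "\<lambda>y. h x + k + s * (y - x)"
  have c: "concave_on {0..} ?c"
    unfolding concave_on_iff
  proof (intro conjI ballI allI impI)
    fix a b u v :: real assume "u + v = 1"
    then have v: "v = 1 - u" by simp
    show "u * ?c a + v * ?c b \<le> ?c (u *\<^sub>R a + v *\<^sub>R b)" unfolding v by (simp add: algebra_simps)
  qed simp
  have maj: "h y \<le> ?c y" if "y \<in> {0..}" for y using assms(2) that by auto
  note L = concave_on_least_concave_majorant[OF c maj, simplified]
  have ge: "h y \<le> ?L y" if "0 \<le> y" for y using least_concave_majorant_ge[OF c maj] that by auto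
  have Lx: "?L x \<le> h x + k" using least_concave_majorant_upper[OF c maj, of x] assms(1) by simp
  have "(h (x + d) - h x - k) / d \<le> (?L (x + d) - ?L x) / d"
    using Lx ge[of "x + d"] assms by (intro divide_right_mono) auto
  also have "\<dots> \<le> right_deriv ?L x" by (rule concave_right_deriv(2)[OF L assms(1,3)])
  finally show "(h (x + d) - h x - k) / d \<le> right_deriv ?L x" .
  have "right_deriv ?L x \<le> (?L x - ?L (x - d)) / d" by (rule concave_right_deriv(3)[OF L assms(1,3,4)])
  also have "\<dots> \<le> (h x + k - h (x - d)) / d"
    using Lx ge[of "x - d"] assms by (intro divide_right_mono) auto
  finally show "right_deriv ?L x \<le> (h x + k - h (x - d)) / d" .
qed

lemma right_deriv_majorant_parabola:
  assumes "b \<le> (0::real)"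
  shows "right_deriv (least_concave_majorant UNIV (\<lambda>t. t * w + 1/2 * t\<^sup>2 * b)) 0 = w"
proof -
  have "concave_on UNIV (\<lambda>t. t * w + 1/2 * t\<^sup>2 * b)"
  proof -
    have "convex_on UNIV (\<lambda>t. - (t * w + 1/2 * t\<^sup>2 * b))"
      using assms by (intro convex_on_realI[where f'="\<lambda>t. - (w + t * b)"])
        (auto intro!: derivative_eq_intros simp: mult_right_mono_neg)
    then show ?thesis by (simp add: concave_on_def)
  qed
  then have "least_concave_majorant UNIV (\<lambda>t. t * w + 1/2 * t\<^sup>2 * b) = (\<lambda>t. t * w + 1/2 * t\<^sup>2 * b)"
    by (intro ext least_concave_majorant_concave) auto
  moreover have "right_deriv (\<lambda>t. t * w + 1/2 * t\<^sup>2 * b) 0 = w"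
    by (rule right_deriv_eqI) (auto intro!: derivative_eq_intros)
  ultimately show ?thesis by simp
qed

lemma abs_sqrt_diff_le: "\<bar>sqrt (max a 0) - sqrt (max b 0)\<bar> \<le> sqrt \<bar>a - b\<bar>"
proof -
  have *: "sqrt (max a 0) - sqrt (max b 0) \<le> sqrt \<bar>a - b\<bar>" for a b :: real
  proof (cases "b \<le> a")
    case True
    then have "sqrt (max a 0) - sqrt (max b 0) \<le> sqrt (max a 0 - max b 0)"
      by (intro sqrt_diff_le_sqrt) auto
    also have "\<dots> \<le> sqrt \<bar>a - b\<bar>" by auto
    finally show ?thesis .
  next
    case False
    then have "sqrt (max a 0) \<le> sqrt (max b 0)" by auto
    moreover have "0 \<le> sqrt \<bar>a - b\<bar>" by simp
    ultimately show ?thesis by linarith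
  qed
  from *[of a b] *[of b a] show ?thesis by (simp add: abs_minus_commute abs_le_iff)
qed

lemma U_sharp_le: "0 \<le> x \<Longrightarrow> U_sharp n y x \<le> 2 / real n * (\<Sum>i=1..n. \<bar>sqrt (y i)\<bar>)"
  unfolding U_sharp_def
proof (intro mult_left_mono sum_mono)
  fix i
  have "0 \<le> sqrt (max (y i - x) 0)" by simp
  then show "sqrt (y i) - sqrt (max (y i - x) 0) \<le> \<bar>sqrt (y i)\<bar>" by linarith
qed simp

lemma concave_on_const_nonneg: "concave_on {0::real..} (\<lambda>_. c)"
  by (simp add: concave_on_const)

lemma U_sharp_perturb:
  "U_sharp n y x \<le> U_sharp n z x + 2 / real n * (\<Sum>i=1..n. \<bar>sqrt (y i) - sqrt (z i)\<bar> + sqrt \<bar>y i - z i\<bar>)"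
proof -
  have "(sqrt (y i) - sqrt (max (y i - x) 0)) \<le> (sqrt (z i) - sqrt (max (z i - x) 0)) + (\<bar>sqrt (y i) - sqrt (z i)\<bar> + sqrt \<bar>y i - z i\<bar>)" for i
    using abs_sqrt_diff_le[of "y i - x" "z i - x"] abs_ge_self[of "sqrt (y i) - sqrt (z i)"]
    by (simp add: abs_le_iff)
  then have "(\<Sum>i=1..n. sqrt (y i) - sqrt (max (y i - x) 0)) \<le> (\<Sum>i=1..n. (sqrt (z i) - sqrt (max (z i - x) 0)) + (\<bar>sqrt (y i) - sqrt (z i)\<bar> + sqrt \<bar>y i - z i\<bar>))"
    by (rule sum_mono)
  then have "U_sharp n y x \<le> 2 / real n * (\<Sum>i=1..n. (sqrt (z i) - sqrt (max (z i - x) 0)) + (\<bar>sqrt (y i) - sqrt (z i)\<bar> + sqrt \<bar>y i - z i\<bar>))"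
    unfolding U_sharp_def by (rule mult_left_mono) simp
  then show ?thesis unfolding U_sharp_def by (simp add: sum.distrib distrib_left)
qed

text \<open>Perturbing the sample perturbs \<open>U\<^sub>n\<^sup>#\<close> uniformly in \<open>x\<close>, hence also its majorant. Continuity in the
  product topology gives measurability, because the Borel sets of that topology are generated by the coordinates.\<close>

lemma continuous_majorant_U_sharp:
  assumes "0 \<le> x"
  shows "continuous_on UNIV (\<lambda>y. least_concave_majorant {0..} (U_sharp n y) x)"
proof -
  let ?L = "\<lambda>y. least_concave_majorant {0..} (U_sharp n y) x"
  define E where "E y z = 2 / real n * (\<Sum>i=1..n. \<bar>sqrt (y i) - sqrt (z i)\<bar> + sqrt \<bar>y i - z i\<bar>)" for y z :: "nat \<Rightarrow> real"
  have le: "?L y \<le> ?L z + E y z" for y z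
    unfolding E_def using assms
    by (intro least_concave_majorant_perturb[OF concave_on_const_nonneg _ U_sharp_perturb concave_on_const_nonneg])
      (auto intro: U_sharp_le)
  have "isCont ?L z" for z
  proof -
    have c: "isCont (\<lambda>y::nat \<Rightarrow> real. y i) z" for i
      by (rule continuous_on_eq_continuous_at[OF open_UNIV, THEN iffD1, rule_format, OF continuous_on_product_coordinates UNIV_I])
    have "isCont (\<lambda>y. E y z) z" unfolding E_def by (intro continuous_intros c)
    then have "((\<lambda>y. E y z) \<longlongrightarrow> E z z) (at z)" by (simp add: isCont_def)
    then have E0: "((\<lambda>y. E y z) \<longlongrightarrow> 0) (at z)" by (simp add: E_def)
    have "E y z = E z y" for y by (simp add: E_def abs_minus_commute)
    then have "norm (?L y - ?L z) \<le> E y z" for y using le[of y z] le[of z y] by (auto simp: abs_le_iff)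
    then have "((\<lambda>y. ?L y - ?L z) \<longlongrightarrow> 0) (at z)"
      by (intro Lim_null_comparison[OF _ E0]) auto
    then show ?thesis by (simp add: isCont_def LIM_zero_iff)
  qed
  then show ?thesis by (simp add: continuous_on_eq_continuous_at)
qed

lemma measurable_V_tilde_sharp:
  fixes Y :: "nat \<Rightarrow> 'a \<Rightarrow> real"
  assumes "\<And>i. Y i \<in> borel_measurable M" "0 < x"
  shows "(\<lambda>\<omega>. V_tilde_sharp n (\<lambda>i. Y i \<omega>) x) \<in> borel_measurable M"
proof -
  have Y: "(\<lambda>\<omega> i. Y i \<omega>) \<in> borel_measurable M"
    using assms(1) by (rule measurable_coordinatewise_then_product)
  let ?L = "\<lambda>\<omega>. least_concave_majorant {0..} (U_sharp n (\<lambda>i. Y i \<omega>))"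
  have L[measurable]: "(\<lambda>\<omega>. ?L \<omega> t) \<in> borel_measurable M" if "0 \<le> t" for t
    using measurable_compose[OF Y borel_measurable_continuous_onI[OF continuous_majorant_U_sharp[OF that, of n]]] .
  let ?h = "\<lambda>k. 1 / real (Suc k)"
  show ?thesis
  proof (rule borel_measurable_LIMSEQ_real)
    show "(\<lambda>k. (?L \<omega> (x + ?h k) - ?L \<omega> x) / ?h k) \<longlonglongrightarrow> V_tilde_sharp n (\<lambda>i. Y i \<omega>) x" for \<omega>
    proof -
      have "concave_on {0..} (?L \<omega>)"
        by (rule concave_on_least_concave_majorant[OF concave_on_const_nonneg]) (auto intro: U_sharp_le)
      from concave_right_deriv(1)[OF this assms(2)]
      have "((\<lambda>t. (?L \<omega> t - ?L \<omega> x) / (t - x)) \<longlongrightarrow> V_tilde_sharp n (\<lambda>i. Y i \<omega>) x) (at_right x)"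
        by (simp add: has_field_derivative_iff V_tilde_sharp_def)
      moreover have "filterlim (\<lambda>k. x + ?h k) (at_right x) sequentially"
        unfolding filterlim_at
        using tendsto_add[OF tendsto_const LIMSEQ_Suc[OF lim_1_over_n], of x] by auto
      ultimately have "(\<lambda>k. (?L \<omega> (x + ?h k) - ?L \<omega> x) / (x + ?h k - x)) \<longlonglongrightarrow> V_tilde_sharp n (\<lambda>i. Y i \<omega>) x"
        by (rule filterlim_compose)
      then show ?thesis by simp
    qed
    show "(\<lambda>\<omega>. (?L \<omega> (x + ?h k) - ?L \<omega> x) / ?h k) \<in> borel_measurable M" for k
      using assms(2) by (intro borel_measurable_divide borel_measurable_diff L) auto
  qed
qed

section \<open>Means of independent samples\<close>

definition sample_mean :: "(nat \<Rightarrow> 'm \<Rightarrow> real) \<Rightarrow> nat \<Rightarrow> (real \<Rightarrow> real) \<Rightarrow> 'm \<Rightarrow> real" where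
  "sample_mean Y n q \<omega> = (\<Sum>i=1..n. q (Y i \<omega>)) / real n"

locale iid_sample = prob_space M + law: real_distribution \<mu>
  for M :: "'m measure" and \<mu> :: "real measure" +
  fixes Y :: "nat \<Rightarrow> 'm \<Rightarrow> real" and n :: nat
  assumes n_pos: "0 < n"
    and indep: "indep_vars (\<lambda>_. borel) Y {1..n}"
    and identically: "\<And>i. i \<in> {1..n} \<Longrightarrow> distr M borel (Y i) = \<mu>"
begin

abbreviation avg :: "(real \<Rightarrow> real) \<Rightarrow> 'm \<Rightarrow> real" where
  "avg \<equiv> sample_mean Y n"

lemma Y_measurable: "i \<in> {1..n} \<Longrightarrow> Y i \<in> borel_measurable M"
  using indep by (auto simp: indep_vars_def)

lemma compose_measurable:
  "q \<in> borel_measurable borel \<Longrightarrow> i \<in> {1..n} \<Longrightarrow> (\<lambda>\<omega>. q (Y i \<omega>)) \<in> borel_measurable M"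
  using Y_measurable by (auto intro: measurable_compose)

lemma avg_measurable [measurable]:
  "q \<in> borel_measurable borel \<Longrightarrow> avg q \<in> borel_measurable M"
  unfolding sample_mean_def by (intro borel_measurable_divide borel_measurable_sum compose_measurable borel_measurable_const)

lemma avg_diff: "avg (\<lambda>y. p y - q y) \<omega> = avg p \<omega> - avg q \<omega>"
  by (simp add: sample_mean_def sum_subtractf diff_divide_distrib)

lemma expectation_sample:
  fixes q :: "real \<Rightarrow> 'b :: {banach, second_countable_topology}"
  assumes "q \<in> borel_measurable borel" "i \<in> {1..n}"
  shows "expectation (\<lambda>\<omega>. q (Y i \<omega>)) = law.expectation q"
  using integral_distr[of "Y i" M borel q] Y_measurable[OF assms(2)] identically[OF assms(2)] assms(1) by simp

lemma integrable_sample: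
  fixes q :: "real \<Rightarrow> 'b :: {banach, second_countable_topology}"
  assumes "integrable \<mu> q" "i \<in> {1..n}"
  shows "integrable M (\<lambda>\<omega>. q (Y i \<omega>))"
  using integrable_distr[of "Y i" M borel q] Y_measurable[OF assms(2)] identically[OF assms(2)] assms(1) by simp

lemma indep_compose:
  assumes "q \<in> borel_measurable borel"
  shows "indep_vars (\<lambda>_. borel) (\<lambda>i \<omega>. q (Y i \<omega>)) {1..n}"
  using indep assms by (rule indep_vars_compose2)

lemma integrable_sample_product:
  fixes q :: "real \<Rightarrow> real"
  assumes q: "q \<in> borel_measurable borel" and i2: "integrable \<mu> (\<lambda>y. (q y)\<^sup>2)"
    and ij: "i \<in> {1..n}" "j \<in> {1..n}"
  shows "integrable M (\<lambda>\<omega>. q (Y i \<omega>) * q (Y j \<omega>))"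
proof (rule Bochner_Integration.integrable_bound[where f="\<lambda>\<omega>. (q (Y i \<omega>))\<^sup>2 + (q (Y j \<omega>))\<^sup>2"])
  show "integrable M (\<lambda>\<omega>. (q (Y i \<omega>))\<^sup>2 + (q (Y j \<omega>))\<^sup>2)"
    using integrable_sample[OF i2] ij by auto
  show "(\<lambda>\<omega>. q (Y i \<omega>) * q (Y j \<omega>)) \<in> borel_measurable M"
    by (intro borel_measurable_times compose_measurable q ij)
  have "\<bar>a * b\<bar> \<le> a\<^sup>2 + b\<^sup>2" for a b :: real
    using sum_squares_bound[of "\<bar>a\<bar>" "\<bar>b\<bar>"] mult_nonneg_nonneg[of "\<bar>a\<bar>" "\<bar>b\<bar>"]
    unfolding abs_mult power2_abs by linarith
  then show "AE \<omega> in M. norm (q (Y i \<omega>) * q (Y j \<omega>)) \<le> norm ((q (Y i \<omega>))\<^sup>2 + (q (Y j \<omega>))\<^sup>2)"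
    by simp
qed

text \<open>The mixed terms vanish by independence.\<close>

lemma second_moment_centered_sum:
  fixes q :: "real \<Rightarrow> real"
  assumes q: "q \<in> borel_measurable borel" and i2: "integrable \<mu> (\<lambda>y. (q y)\<^sup>2)"
    and zero: "law.expectation q = 0"
  shows "integrable M (\<lambda>\<omega>. (\<Sum>i=1..n. q (Y i \<omega>))\<^sup>2)"
    and "expectation (\<lambda>\<omega>. (\<Sum>i=1..n. q (Y i \<omega>))\<^sup>2) = real n * law.expectation (\<lambda>y. (q y)\<^sup>2)"
proof -
  note int = integrable_sample_product[OF q i2]
  have i1: "integrable \<mu> q" using law.square_integrable_imp_integrable[OF _ i2] q by simp
  show "integrable M (\<lambda>\<omega>. (\<Sum>i=1..n. q (Y i \<omega>))\<^sup>2)"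
    unfolding power2_eq_square sum_product by (intro Bochner_Integration.integrable_sum int)
  have prod: "expectation (\<lambda>\<omega>. q (Y i \<omega>) * q (Y j \<omega>)) = (if i = j then law.expectation (\<lambda>y. (q y)\<^sup>2) else 0)"
    if ij: "i \<in> {1..n}" "j \<in> {1..n}" for i j
  proof (cases "i = j")
    case True
    then show ?thesis using expectation_sample[of "\<lambda>y. (q y)\<^sup>2" j] q ij by (simp add: power2_eq_square)
  next
    case False
    have "indep_vars (\<lambda>_. borel) (\<lambda>i \<omega>. q (Y i \<omega>)) {i, j}"
      by (rule indep_vars_subset[OF indep_compose[OF q]]) (use ij in auto)
    then have "expectation (\<lambda>\<omega>. \<Prod>k\<in>{i, j}. q (Y k \<omega>)) = (\<Prod>k\<in>{i, j}. expectation (\<lambda>\<omega>. q (Y k \<omega>)))"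
      using integrable_sample[OF i1] ij by (intro indep_vars_lebesgue_integral) auto
    then show ?thesis using False ij by (simp add: expectation_sample[OF q] zero)
  qed
  have "expectation (\<lambda>\<omega>. (\<Sum>i=1..n. q (Y i \<omega>))\<^sup>2) = expectation (\<lambda>\<omega>. \<Sum>i=1..n. \<Sum>j=1..n. q (Y i \<omega>) * q (Y j \<omega>))"
    by (simp add: power2_eq_square sum_product)
  also have "\<dots> = (\<Sum>i=1..n. \<Sum>j=1..n. expectation (\<lambda>\<omega>. q (Y i \<omega>) * q (Y j \<omega>)))"
  proof (subst Bochner_Integration.integral_sum)
    show "integrable M (\<lambda>\<omega>. \<Sum>j=1..n. q (Y i \<omega>) * q (Y j \<omega>))" if "i \<in> {1..n}" for i
      using that by (intro Bochner_Integration.integrable_sum int)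
    show "(\<Sum>i=1..n. expectation (\<lambda>\<omega>. \<Sum>j=1..n. q (Y i \<omega>) * q (Y j \<omega>)))
       = (\<Sum>i=1..n. \<Sum>j=1..n. expectation (\<lambda>\<omega>. q (Y i \<omega>) * q (Y j \<omega>)))"
      by (intro sum.cong refl Bochner_Integration.integral_sum int)
  qed
  also have "\<dots> = (\<Sum>i=1..n. \<Sum>j=1..n. if i = j then law.expectation (\<lambda>y. (q y)\<^sup>2) else 0)"
    by (intro sum.cong refl prod)
  finally show "expectation (\<lambda>\<omega>. (\<Sum>i=1..n. q (Y i \<omega>))\<^sup>2) = real n * law.expectation (\<lambda>y. (q y)\<^sup>2)"
    by simp
qed

lemma chebyshev_avg:
  fixes q :: "real \<Rightarrow> real"
  assumes q: "q \<in> borel_measurable borel" and i2: "integrable \<mu> (\<lambda>y. (q y)\<^sup>2)" and u: "0 < u"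
  shows "prob {\<omega> \<in> space M. \<bar>avg q \<omega> - law.expectation q\<bar> \<ge> u} \<le> law.expectation (\<lambda>y. (q y)\<^sup>2) / (real n * u\<^sup>2)"
proof -
  have i1: "integrable \<mu> q" using law.square_integrable_imp_integrable[OF _ i2] q by simp
  define m where "m = law.expectation q"
  define r where "r y = q y - m" for y
  have r: "r \<in> borel_measurable borel" unfolding r_def using q by simp
  have r2: "(r y)\<^sup>2 = (q y)\<^sup>2 - 2 * m * q y + m\<^sup>2" for y
    by (simp add: r_def power2_diff algebra_simps)
  have ir2: "integrable \<mu> (\<lambda>y. (r y)\<^sup>2)" unfolding r2 using i1 i2 by simp
  have Er: "law.expectation r = 0"
    unfolding r_def using i1 law.prob_space by (simp add: m_def)
  have Er2: "law.expectation (\<lambda>y. (r y)\<^sup>2) \<le> law.expectation (\<lambda>y. (q y)\<^sup>2)"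
  proof -
    have "law.expectation (\<lambda>y. (r y)\<^sup>2) = law.expectation (\<lambda>y. (q y)\<^sup>2) - m\<^sup>2"
      unfolding r2 using i1 i2 law.prob_space by (simp add: m_def power2_eq_square)
    then show ?thesis by simp
  qed
  let ?S = "\<lambda>\<omega>. \<Sum>i=1..n. r (Y i \<omega>)"
  have "{\<omega> \<in> space M. \<bar>avg q \<omega> - m\<bar> \<ge> u} = {\<omega> \<in> space M. (real n * u)\<^sup>2 \<le> (?S \<omega>)\<^sup>2}"
  proof -
    have "?S \<omega> = real n * (avg q \<omega> - m)" for \<omega>
      using n_pos by (simp add: sample_mean_def r_def sum_subtractf algebra_simps)
    then have "(real n * u)\<^sup>2 \<le> (?S \<omega>)\<^sup>2 \<longleftrightarrow> u \<le> \<bar>avg q \<omega> - m\<bar>" for \<omega>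
      using n_pos u by (simp add: power_mult_distrib) (metis abs_le_square_iff abs_of_pos)
    then show ?thesis by simp
  qed
  also have "prob \<dots> \<le> expectation (\<lambda>\<omega>. (?S \<omega>)\<^sup>2) / (real n * u)\<^sup>2"
    using second_moment_centered_sum(1)[OF r ir2 Er] n_pos u
    by (intro integral_Markov_inequality_measure[where A="{}"]) auto
  also have "\<dots> \<le> (real n * law.expectation (\<lambda>y. (q y)\<^sup>2)) / (real n * u)\<^sup>2"
    unfolding second_moment_centered_sum(2)[OF r ir2 Er] using Er2 by (intro divide_right_mono mult_left_mono) auto
  also have "\<dots> = law.expectation (\<lambda>y. (q y)\<^sup>2) / (real n * u\<^sup>2)"
    using n_pos by (simp add: power2_eq_square)
  finally show ?thesis unfolding m_def .
qed

lemma integrable_bounded: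
  fixes q :: "real \<Rightarrow> real"
  shows "q \<in> borel_measurable borel \<Longrightarrow> (\<And>y. \<bar>q y\<bar> \<le> b) \<Longrightarrow> integrable \<mu> q"
  by (rule law.integrable_const_bound[where B=b]) auto

lemma exp_le_quadratic: "\<bar>x\<bar> \<le> 1 \<Longrightarrow> exp x \<le> 1 + x + x\<^sup>2" for x :: real
proof (cases "0 \<le> x")
  case False
  assume x: "\<bar>x\<bar> \<le> 1"
  have "0 \<le> (- x) ^ 3" using False by simp
  then have "1 \<le> (1 + x + x\<^sup>2) * (1 - x)" by (simp add: algebra_simps power2_eq_square power3_eq_cube)
  then have "1 / (1 - x) \<le> 1 + x + x\<^sup>2" using False by (simp add: divide_le_eq)
  moreover have "exp x \<le> 1 / (1 - x)"
    using exp_ge_add_one_self[of "-x"] False by (simp add: exp_minus field_simps)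
  ultimately show ?thesis by simp
qed (use exp_bound[of x] in auto)

text \<open>Bernstein's inequality, with the exponent left open: since \<open>exp x \<le> 1 + x + x\<^sup>2\<close> for \<open>\<bar>x\<bar> \<le> 1\<close>, the moment
  generating function of \<open>q\<close> at \<open>l\<close> is at most \<open>exp (l E q + l\<^sup>2 v)\<close>.\<close>

lemma bernstein_avg:
  assumes q[measurable]: "q \<in> borel_measurable borel" and b: "\<And>y. \<bar>q y\<bar> \<le> b"
    and v: "law.expectation (\<lambda>y. (q y)\<^sup>2) \<le> v" and l: "0 < l" "l * b \<le> 1"
  shows "prob {\<omega> \<in> space M. avg q \<omega> - law.expectation q \<ge> u} \<le> exp (real n * (- l * u + l\<^sup>2 * v))"
proof -
  have b0: "0 \<le> b" using b[of 0] by linarith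
  define m where "m = law.expectation q"
  have bl: "\<bar>l * q y\<bar> \<le> 1" for y
    using order_trans[OF mult_left_mono[OF b[of y] less_imp_le[OF l(1)]] l(2)] l(1) by (simp add: abs_mult)
  have i1: "integrable \<mu> q" by (rule integrable_bounded[OF q b])
  have i2: "integrable \<mu> (\<lambda>y. (q y)\<^sup>2)"
    using power_mono[OF b abs_ge_zero, where n=2] by (intro integrable_bounded[where b="b\<^sup>2"]) auto
  have ie: "integrable \<mu> (\<lambda>y. exp (l * q y))"
  proof (rule integrable_bounded[where b="exp 1"])
    show "\<bar>exp (l * q y)\<bar> \<le> exp 1" for y using bl[of y] by (simp add: abs_le_iff)
  qed simp
  have "law.expectation (\<lambda>y. exp (l * q y)) \<le> law.expectation (\<lambda>y. 1 + l * q y + l\<^sup>2 * (q y)\<^sup>2)"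
    using exp_le_quadratic[OF bl] i1 i2 ie
    by (intro integral_mono) (auto simp: power_mult_distrib)
  also have "\<dots> = 1 + l * m + l\<^sup>2 * law.expectation (\<lambda>y. (q y)\<^sup>2)"
    using i1 i2 law.prob_space by (simp add: m_def)
  also have "\<dots> \<le> 1 + (l * m + l\<^sup>2 * v)" using v by (simp add: mult_left_mono)
  also have "\<dots> \<le> exp (l * m + l\<^sup>2 * v)" by (rule exp_ge_add_one_self)
  finally have mgf: "law.expectation (\<lambda>y. exp (l * q y)) \<le> exp (l * m + l\<^sup>2 * v)" .
  let ?E = "\<lambda>\<omega>. \<Prod>i=1..n. exp (l * q (Y i \<omega>))"
  have ind: "indep_vars (\<lambda>_. borel) (\<lambda>i \<omega>. exp (l * q (Y i \<omega>))) {1..n}"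
    by (rule indep_compose) simp
  have iE: "integrable M ?E"
    using ind integrable_sample[OF ie] by (intro indep_vars_integrable) auto
  have "expectation ?E = (\<Prod>i=1..n. expectation (\<lambda>\<omega>. exp (l * q (Y i \<omega>))))"
    using ind integrable_sample[OF ie] by (intro indep_vars_lebesgue_integral) auto
  also have "\<dots> = (law.expectation (\<lambda>y. exp (l * q y))) ^ n"
    by (simp add: expectation_sample[of "\<lambda>y. exp (l * q y)"])
  also have "\<dots> \<le> exp (l * m + l\<^sup>2 * v) ^ n" by (intro power_mono mgf integral_nonneg) auto
  also have "\<dots> = exp (real n * (l * m + l\<^sup>2 * v))" by (simp add: exp_of_nat_mult)
  finally have EE: "expectation ?E \<le> exp (real n * (l * m + l\<^sup>2 * v))" .
  have "{\<omega> \<in> space M. avg q \<omega> - m \<ge> u} = {\<omega> \<in> space M. ?E \<omega> \<ge> exp (real n * l * (m + u))}"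
  proof -
    have "?E \<omega> = exp (real n * l * avg q \<omega>)" for \<omega>
      using n_pos by (simp add: exp_sum[symmetric] sample_mean_def flip: sum_distrib_left)
    moreover have "real n * l * (m + u) \<le> real n * l * avg q \<omega> \<longleftrightarrow> u \<le> avg q \<omega> - m" for \<omega>
      using n_pos l by (subst mult_le_cancel_left_pos) auto
    ultimately show ?thesis by simp
  qed
  also have "prob \<dots> \<le> expectation ?E / exp (real n * l * (m + u))"
    using iE by (intro integral_Markov_inequality_measure[where A="{}"]) (auto intro!: AE_I2 prod_nonneg)
  also have "\<dots> \<le> exp (real n * (l * m + l\<^sup>2 * v)) / exp (real n * l * (m + u))"
    using EE by (rule divide_right_mono) simp
  also have "\<dots> = exp (real n * (- l * u + l\<^sup>2 * v))"
    by (simp add: exp_diff[symmetric] algebra_simps)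
  finally show ?thesis unfolding m_def .
qed

text \<open>Third-order Taylor expansion of the characteristic function of one summand. The third moment is
  at most the variance times the uniform bound of the summands, which is why small bounded summands
  satisfy a central limit theorem even if their laws change with \<open>n\<close>.\<close>

lemma char_avg_approx:
  fixes t c \<sigma> e :: real
  assumes q[measurable]: "q \<in> borel_measurable borel" and b: "\<And>y. \<bar>q y\<bar> \<le> b" and e: "0 < e"
    and small: "t\<^sup>2 * \<sigma>\<^sup>2 \<le> 4 * real n"
  defines "V \<equiv> (law.expectation (\<lambda>y. (q y)\<^sup>2) - (law.expectation q)\<^sup>2) / (real n * e\<^sup>2)"
  shows "cmod (char (distr M borel (\<lambda>\<omega>. (avg q \<omega> - law.expectation q) / e)) t
      - complex_of_real ((1 + (- (t\<^sup>2 * \<sigma>\<^sup>2) / 2) / real n) ^ n))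
    \<le> \<bar>t\<bar> ^ 3 * (2 * b / (real n * e)) * V / 6 + t\<^sup>2 * \<bar>V - \<sigma>\<^sup>2\<bar> / 2"
proof -
  have b0: "0 \<le> b" using b[of 0] by linarith
  define m where "m = law.expectation q"
  define z where "z y = (q y - m) / (real n * e)" for y
  have z_meas[measurable]: "z \<in> borel_measurable borel" unfolding z_def by measurable
  have ne: "0 < real n * e" using n_pos e by simp
  have i1: "integrable \<mu> q" by (rule integrable_bounded[OF q b])
  have i2: "integrable \<mu> (\<lambda>y. (q y)\<^sup>2)"
    using power_mono[OF b abs_ge_zero, where n=2] by (intro integrable_bounded[where b="b\<^sup>2"]) auto
  have "\<bar>m\<bar> \<le> b"
  proof -
    have "\<bar>m\<bar> \<le> law.expectation (\<lambda>y. \<bar>q y\<bar>)" unfolding m_def by (rule integral_abs_bound)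
    also have "\<dots> \<le> law.expectation (\<lambda>_. b)" using i1 b by (intro integral_mono) auto
    finally show ?thesis using law.prob_space by simp
  qed
  then have "\<bar>q y - m\<bar> \<le> 2 * b" for y using b[of y] by (auto simp: abs_le_iff)
  then have zb: "\<bar>z y\<bar> \<le> 2 * b / (real n * e)" for y
    using ne e by (simp add: z_def abs_mult divide_right_mono)
  have iz: "integrable \<mu> z" by (rule integrable_bounded[OF z_meas zb])
  have iz2: "integrable \<mu> (\<lambda>y. (z y)\<^sup>2)"
    using power_mono[OF zb abs_ge_zero, where n=2] by (intro integrable_bounded[where b="(2 * b / (real n * e))\<^sup>2"]) auto
  have Ez: "law.expectation z = 0"
    unfolding z_def using i1 law.prob_space by (simp add: m_def)
  have Ez2: "law.expectation (\<lambda>y. (z y)\<^sup>2) = V / real n"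
  proof -
    have "law.expectation (\<lambda>y. (z y)\<^sup>2) = law.expectation (\<lambda>y. (q y)\<^sup>2 - 2 * m * q y + m\<^sup>2) / (real n * e)\<^sup>2"
      by (simp add: z_def power_divide power2_diff algebra_simps)
    also have "law.expectation (\<lambda>y. (q y)\<^sup>2 - 2 * m * q y + m\<^sup>2) = law.expectation (\<lambda>y. (q y)\<^sup>2) - m\<^sup>2"
      using i1 i2 law.prob_space by (simp add: m_def power2_eq_square)
    finally show ?thesis using ne by (simp add: V_def m_def power2_eq_square)
  qed
  have V0: "0 \<le> V" 
  proof -
    have "0 \<le> law.expectation (\<lambda>y. (z y)\<^sup>2)" by simp
    then show ?thesis using Ez2 n_pos by (simp add: zero_le_divide_iff)
  qed
  define \<phi> where "\<phi> = char (distr \<mu> borel z) t"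
  have \<phi>1: "cmod \<phi> \<le> 1"
  proof -
    interpret D: real_distribution "distr \<mu> borel z" by (rule law.real_distribution_distr) simp
    show ?thesis unfolding \<phi>_def by (rule D.cmod_char_le_1)
  qed
  have approx: "cmod (\<phi> - (1 - t\<^sup>2 * (V / real n) / 2)) \<le> \<bar>t\<bar> ^ 3 * (2 * b / (real n * e)) * (V / real n) / 6"
  proof -
    have "cmod (\<phi> - (1 - t\<^sup>2 * (V / real n) / 2)) \<le> (t\<^sup>2 / 6) * law.expectation (\<lambda>y. min (6 * (z y)\<^sup>2) (\<bar>t\<bar> * \<bar>z y\<bar> ^ 3))"
      unfolding \<phi>_def using iz iz2 Ez Ez2 by (intro law.char_approx3') auto
    also have "\<dots> \<le> (t\<^sup>2 / 6) * law.expectation (\<lambda>y. \<bar>t\<bar> * (2 * b / (real n * e)) * (z y)\<^sup>2)"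
    proof (intro mult_left_mono integral_mono)
      show "integrable \<mu> (\<lambda>y. min (6 * (z y)\<^sup>2) (\<bar>t\<bar> * \<bar>z y\<bar> ^ 3))"
        by (rule Bochner_Integration.integrable_bound[of _ "\<lambda>y. 6 * (z y)\<^sup>2"]) (use iz2 in auto)
      fix y
      have "\<bar>z y\<bar> ^ 3 = \<bar>z y\<bar> * (z y)\<^sup>2" by (simp add: power3_eq_cube power2_eq_square)
      also have "\<dots> \<le> 2 * b / (real n * e) * (z y)\<^sup>2" using zb[of y] by (rule mult_right_mono) simp
      finally have "\<bar>t\<bar> * \<bar>z y\<bar> ^ 3 \<le> \<bar>t\<bar> * (2 * b / (real n * e) * (z y)\<^sup>2)" by (rule mult_left_mono) simp
      then show "min (6 * (z y)\<^sup>2) (\<bar>t\<bar> * \<bar>z y\<bar> ^ 3) \<le> \<bar>t\<bar> * (2 * b / (real n * e)) * (z y)\<^sup>2"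
        by (simp add: mult.assoc min.coboundedI2)
    qed (use iz2 in auto)
    also have "\<dots> = \<bar>t\<bar> ^ 3 * (2 * b / (real n * e)) * (V / real n) / 6"
      using Ez2 by (simp add: power3_eq_cube power2_eq_square)
    finally show ?thesis by simp
  qed
  have "char (distr M borel (\<lambda>\<omega>. (avg q \<omega> - m) / e)) t = char (distr M borel (\<lambda>\<omega>. \<Sum>i\<in>{1..n}. z (Y i \<omega>))) t"
  proof -
    have "(avg q \<omega> - m) / e = (\<Sum>i\<in>{1..n}. z (Y i \<omega>))" for \<omega>
      using n_pos e by (simp add: sample_mean_def z_def sum_divide_distrib[symmetric] sum_subtractf field_simps)
    then show ?thesis by simp
  qed
  also have "\<dots> = (\<Prod>i\<in>{1..n}. char (distr M borel (\<lambda>\<omega>. z (Y i \<omega>))) t)"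
    by (rule char_distr_sum) (rule indep_compose[OF z_meas])
  also have "\<dots> = \<phi> ^ n"
  proof -
    have "distr M borel (\<lambda>\<omega>. z (Y i \<omega>)) = distr \<mu> borel z" if "i \<in> {1..n}" for i
      using Y_measurable[OF that] identically[OF that] distr_distr[of z borel borel "Y i" M]
      by (simp add: comp_def)
    then show ?thesis by (simp add: \<phi>_def)
  qed
  finally have char: "char (distr M borel (\<lambda>\<omega>. (avg q \<omega> - m) / e)) t = \<phi> ^ n" .
  let ?a = "1 + (- (t\<^sup>2 * \<sigma>\<^sup>2) / 2) / real n"
  have a1: "cmod (complex_of_real ?a) \<le> 1"
    using small n_pos by (simp only: norm_of_real) (auto simp: abs_le_iff field_simps)
  have "cmod (\<phi> - complex_of_real ?a) \<le> cmod (\<phi> - (1 - t\<^sup>2 * (V / real n) / 2)) + cmod ((1 - t\<^sup>2 * (V / real n) / 2) - complex_of_real ?a)"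
    by (rule norm_diff_triangle_le[OF order_refl order_refl])
  also have "cmod ((1 - t\<^sup>2 * (V / real n) / 2) - complex_of_real ?a) = t\<^sup>2 * \<bar>V - \<sigma>\<^sup>2\<bar> / 2 / real n"
  proof -
    have "(1 - t\<^sup>2 * (V / real n) / 2) - complex_of_real ?a = complex_of_real (- (t\<^sup>2 * (V - \<sigma>\<^sup>2) / 2 / real n))"
      using n_pos by (simp add: field_simps)
    then show ?thesis by (simp only: norm_of_real) (simp add: abs_mult)
  qed
  finally have d: "cmod (\<phi> - complex_of_real ?a) \<le> \<bar>t\<bar> ^ 3 * (2 * b / (real n * e)) * (V / real n) / 6 + t\<^sup>2 * \<bar>V - \<sigma>\<^sup>2\<bar> / 2 / real n"
    using approx by linarith
  have "cmod (\<phi> ^ n - complex_of_real ?a ^ n) \<le> real n * cmod (\<phi> - complex_of_real ?a)"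
    by (rule norm_power_diff[OF \<phi>1 a1])
  also have "\<dots> \<le> real n * (\<bar>t\<bar> ^ 3 * (2 * b / (real n * e)) * (V / real n) / 6 + t\<^sup>2 * \<bar>V - \<sigma>\<^sup>2\<bar> / 2 / real n)"
    using d by (rule mult_left_mono) simp
  also have "\<dots> = \<bar>t\<bar> ^ 3 * (2 * b / (real n * e)) * V / 6 + t\<^sup>2 * \<bar>V - \<sigma>\<^sup>2\<bar> / 2"
    using n_pos by (simp add: distrib_left)
  finally show ?thesis using char by (simp add: m_def)
qed

end

lemma char_normal:
  assumes "0 < \<sigma>"
  shows "char (density lborel (normal_density 0 \<sigma>)) t = complex_of_real (exp (- (t\<^sup>2 * \<sigma>\<^sup>2) / 2))"
proof -
  interpret N: prob_space "std_normal_distribution" by (rule prob_space_normal_density) simp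
  have "distributed std_normal_distribution lborel (\<lambda>x. x) (normal_density 0 1)"
    by (auto simp: distributed_def distr_id2)
  then have "distributed std_normal_distribution lborel (\<lambda>x. 0 + \<sigma> * x) (normal_density (0 + \<sigma> * 0) (\<bar>\<sigma>\<bar> * 1))"
    using assms by (intro N.normal_density_affine) auto
  then have "distr std_normal_distribution lborel (\<lambda>x. \<sigma> * x) = density lborel (normal_density 0 \<sigma>)"
    using assms by (simp add: distributed_def)
  then have "density lborel (normal_density 0 \<sigma>) = distr std_normal_distribution borel (\<lambda>x. \<sigma> * x)"
    by (metis distr_cong sets_lborel)
  then have "char (density lborel (normal_density 0 \<sigma>)) t = char std_normal_distribution (t * \<sigma>)"
    by (simp add: char_def integral_distr mult_ac)
  then show ?thesis by (simp add: char_std_normal_distribution power_mult_distrib)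
qed

lemma (in prob_space) triangular_central_limit_theorem:
  fixes q :: "nat \<Rightarrow> real \<Rightarrow> real" and e b :: "nat \<Rightarrow> real"
  assumes iid: "\<And>n. 1 \<le> n \<Longrightarrow> iid_sample M (\<mu> n) (Y n) n"
    and q: "\<And>n. q n \<in> borel_measurable borel" and b: "\<And>n y. 2 \<le> n \<Longrightarrow> \<bar>q n y\<bar> \<le> b n" and e: "\<And>n. 2 \<le> n \<Longrightarrow> 0 < e n"
    and \<sigma>: "0 < \<sigma>"
    and var: "(\<lambda>n. ((\<integral>y. (q n y)\<^sup>2 \<partial>\<mu> n) - (\<integral>y. q n y \<partial>\<mu> n)\<^sup>2) / (real n * (e n)\<^sup>2)) \<longlonglongrightarrow> \<sigma>\<^sup>2"
    and small: "(\<lambda>n. b n / (real n * e n)) \<longlonglongrightarrow> 0"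
  shows "weak_conv_m (\<lambda>n. distr M borel (\<lambda>\<omega>. (sample_mean (Y n) n (q n) \<omega> - (\<integral>y. q n y \<partial>\<mu> n)) / e n))
    (density lborel (normal_density 0 \<sigma>))"
proof (rule levy_continuity)
  show "real_distribution (distr M borel (\<lambda>\<omega>. (sample_mean (Y n) n (q n) \<omega> - (\<integral>y. q n y \<partial>\<mu> n)) / e n))" for n
  proof (cases "n = 0")
    case True
    then have "(\<lambda>\<omega>. (sample_mean (Y n) n (q n) \<omega> - (\<integral>y. q n y \<partial>\<mu> n)) / e n) = (\<lambda>\<omega>. - (\<integral>y. q n y \<partial>\<mu> n) / e n)"
      by (simp add: sample_mean_def)
    then show ?thesis by (intro real_distribution_distr) simp
  next
    case False
    then interpret iid_sample M "\<mu> n" "Y n" n by (intro iid) simp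
    show ?thesis using q by (intro real_distribution_distr) simp
  qed
  show "real_distribution (density lborel (normal_density 0 \<sigma>))"
    using \<sigma> by (intro real_distribution.intro prob_space_normal_density real_distribution_axioms.intro) auto
  fix t :: real
  let ?V = "\<lambda>n. ((\<integral>y. (q n y)\<^sup>2 \<partial>\<mu> n) - (\<integral>y. q n y \<partial>\<mu> n)\<^sup>2) / (real n * (e n)\<^sup>2)"
  let ?c = "\<lambda>n. char (distr M borel (\<lambda>\<omega>. (sample_mean (Y n) n (q n) \<omega> - (\<integral>y. q n y \<partial>\<mu> n)) / e n)) t"
  let ?g = "\<lambda>n. complex_of_real ((1 + (- (t\<^sup>2 * \<sigma>\<^sup>2) / 2) / real n) ^ n)"
  have "\<forall>\<^sub>F n in sequentially. cmod (?c n - ?g n) \<le> \<bar>t\<bar> ^ 3 * (2 * (b n / (real n * e n))) * ?V n / 6 + t\<^sup>2 * \<bar>?V n - \<sigma>\<^sup>2\<bar> / 2"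
    using eventually_ge_at_top[of 2] eventually_ge_at_top[of "nat \<lceil>t\<^sup>2 * \<sigma>\<^sup>2\<rceil>"]
  proof eventually_elim
    case (elim n)
    interpret iid_sample M "\<mu> n" "Y n" n using elim by (intro iid) simp
    have "t\<^sup>2 * \<sigma>\<^sup>2 \<le> real n" using elim(2) by (simp add: nat_ceiling_le_eq)
    then have "t\<^sup>2 * \<sigma>\<^sup>2 \<le> 4 * real n" by simp
    from char_avg_approx[OF q b[OF elim(1)] e[OF elim(1)] this] show ?case by simp
  qed
  moreover have "(\<lambda>n. \<bar>t\<bar> ^ 3 * (2 * (b n / (real n * e n))) * ?V n / 6 + t\<^sup>2 * \<bar>?V n - \<sigma>\<^sup>2\<bar> / 2)
     \<longlonglongrightarrow> \<bar>t\<bar> ^ 3 * (2 * 0) * \<sigma>\<^sup>2 / 6 + t\<^sup>2 * \<bar>\<sigma>\<^sup>2 - \<sigma>\<^sup>2\<bar> / 2"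
    by (intro tendsto_intros var small) auto
  ultimately have 1: "(\<lambda>n. ?c n - ?g n) \<longlonglongrightarrow> 0"
    by (intro Lim_null_comparison[of "\<lambda>n. ?c n - ?g n"]) auto
  have 2: "?g \<longlonglongrightarrow> complex_of_real (exp (- (t\<^sup>2 * \<sigma>\<^sup>2) / 2))"
    by (intro tendsto_of_real tendsto_exp_limit_sequentially)
  show "?c \<longlonglongrightarrow> char (density lborel (normal_density 0 \<sigma>)) t"
    unfolding char_normal[OF \<sigma>] by (rule Lim_transform[OF 2 1])
qed

text \<open>With probability tending to one, in terms of an exceptional event: \<open>P n\<close> need not define a
  measurable set.\<close>

definition (in prob_space) whp :: "(nat \<Rightarrow> 'a \<Rightarrow> bool) \<Rightarrow> bool" where
  "whp P \<longleftrightarrow> (\<exists>F. (\<forall>\<^sub>F n in sequentially. F n \<in> events \<and> (\<forall>\<omega>\<in>space M - F n. P n \<omega>)) \<and>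
    (\<lambda>n. prob (F n)) \<longlonglongrightarrow> 0)"

context prob_space
begin

lemma whpI:
  assumes "\<forall>\<^sub>F n in sequentially. F n \<in> events \<and> prob (F n) \<le> p n \<and> (\<forall>\<omega>\<in>space M - F n. P n \<omega>)"
    and "p \<longlonglongrightarrow> 0"
  shows "whp P"
  unfolding whp_def
proof (intro exI conjI)
  show "\<forall>\<^sub>F n in sequentially. F n \<in> events \<and> (\<forall>\<omega>\<in>space M - F n. P n \<omega>)"
    using assms(1) by eventually_elim simp
  have "\<forall>\<^sub>F n in sequentially. norm (prob (F n)) \<le> p n" using assms(1) by eventually_elim simp
  then show "(\<lambda>n. prob (F n)) \<longlonglongrightarrow> 0" using assms(2) by (rule Lim_null_comparison)
qed

lemma whp_conj:
  assumes "whp P" "whp Q"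
  shows "whp (\<lambda>n \<omega>. P n \<omega> \<and> Q n \<omega>)"
proof -
  obtain F where F: "\<forall>\<^sub>F n in sequentially. F n \<in> events \<and> (\<forall>\<omega>\<in>space M - F n. P n \<omega>)"
    "(\<lambda>n. prob (F n)) \<longlonglongrightarrow> 0" using assms(1) by (auto simp: whp_def)
  obtain H where H: "\<forall>\<^sub>F n in sequentially. H n \<in> events \<and> (\<forall>\<omega>\<in>space M - H n. Q n \<omega>)"
    "(\<lambda>n. prob (H n)) \<longlonglongrightarrow> 0" using assms(2) by (auto simp: whp_def)
  show ?thesis
  proof (rule whpI)
    show "\<forall>\<^sub>F n in sequentially. F n \<union> H n \<in> events \<and> prob (F n \<union> H n) \<le> prob (F n) + prob (H n)
        \<and> (\<forall>\<omega>\<in>space M - (F n \<union> H n). P n \<omega> \<and> Q n \<omega>)"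
      using F(1) H(1) by eventually_elim (auto intro: measure_Un_le)
    show "(\<lambda>n. prob (F n) + prob (H n)) \<longlonglongrightarrow> 0" using tendsto_add[OF F(2) H(2)] by simp
  qed
qed

lemma whp_mono:
  assumes "whp P" "\<forall>\<^sub>F n in sequentially. \<forall>\<omega>\<in>space M. P n \<omega> \<longrightarrow> Q n \<omega>"
  shows "whp Q"
proof -
  obtain F where F: "\<forall>\<^sub>F n in sequentially. F n \<in> events \<and> (\<forall>\<omega>\<in>space M - F n. P n \<omega>)"
    "(\<lambda>n. prob (F n)) \<longlonglongrightarrow> 0" using assms(1) by (auto simp: whp_def)
  have "\<forall>\<^sub>F n in sequentially. F n \<in> events \<and> (\<forall>\<omega>\<in>space M - F n. Q n \<omega>)"
    using F(1) assms(2) by eventually_elim blast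
  then show ?thesis using F(2) by (auto simp: whp_def)
qed

end

text \<open>Slutsky's theorem in the form needed here: the approximating variables may depend on the accuracy
  \<open>\<eta>\<close>. At a point of continuity \<open>x\<close> the distribution functions are squeezed between those of \<open>W n\<close> at
  \<open>x - \<eta>\<close> and \<open>x + \<eta>\<close>.\<close>

lemma (in prob_space) weak_conv_of_approximations:
  fixes D :: "nat \<Rightarrow> 'a \<Rightarrow> real"
  assumes D: "\<And>n. D n \<in> borel_measurable M" and cont: "\<And>x. isCont (cdf L) x"
    and approx: "\<And>\<eta>. 0 < \<eta> \<Longrightarrow> \<exists>W. (\<forall>\<^sub>F n in sequentially. W n \<in> borel_measurable M) \<and>
        whp (\<lambda>n \<omega>. \<bar>D n \<omega> - W n \<omega>\<bar> \<le> \<eta>) \<and> weak_conv_m (\<lambda>n. distr M borel (W n)) L"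
  shows "weak_conv_m (\<lambda>n. distr M borel (D n)) L"
  unfolding weak_conv_m_def weak_conv_def
proof (intro allI impI)
  fix x
  have cdf_eq: "cdf (distr M borel X) y = prob {\<omega> \<in> space M. X \<omega> \<le> y}" if "X \<in> borel_measurable M" for X and y :: real
    using that by (simp add: cdf_def measure_distr vimage_def Int_def conj_commute)
  show "(\<lambda>n. cdf (distr M borel (D n)) x) \<longlonglongrightarrow> cdf L x"
  proof (rule tendstoI)
    fix \<epsilon> :: real assume \<epsilon>: "0 < \<epsilon>"
    have "(cdf L \<longlongrightarrow> cdf L x) (at x)" using cont[of x] by (simp add: isCont_def)
    then obtain \<eta>0 where \<eta>0: "0 < \<eta>0" "\<And>y. y \<noteq> x \<Longrightarrow> \<bar>y - x\<bar> < \<eta>0 \<Longrightarrow> \<bar>cdf L y - cdf L x\<bar> < \<epsilon> / 3"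
      using \<epsilon> by (auto dest!: LIM_D[where r="\<epsilon> / 3"])
    define \<eta> where "\<eta> = \<eta>0 / 2"
    have \<eta>: "0 < \<eta>" using \<eta>0 by (simp add: \<eta>_def)
    obtain W where W: "\<forall>\<^sub>F n in sequentially. W n \<in> borel_measurable M"
        and near: "whp (\<lambda>n \<omega>. \<bar>D n \<omega> - W n \<omega>\<bar> \<le> \<eta>)"
        and conv: "weak_conv_m (\<lambda>n. distr M borel (W n)) L"
      using approx[OF \<eta>] by blast
    obtain E where EW: "\<forall>\<^sub>F n in sequentially. E n \<in> events \<and> (\<forall>\<omega>\<in>space M - E n. \<bar>D n \<omega> - W n \<omega>\<bar> \<le> \<eta>)"
        and E: "(\<lambda>n. prob (E n)) \<longlonglongrightarrow> 0"
      using near by (auto simp: whp_def)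
    have cW: "(\<lambda>n. cdf (distr M borel (W n)) y) \<longlonglongrightarrow> cdf L y" for y
      using conv cont by (simp add: weak_conv_m_def weak_conv_def)
    have "\<forall>\<^sub>F n in sequentially. prob (E n) < \<epsilon> / 3"
      using order_tendstoD(2)[OF E, of "\<epsilon> / 3"] \<epsilon> by simp
    moreover have "\<forall>\<^sub>F n in sequentially. dist (cdf (distr M borel (W n)) (x + \<eta>)) (cdf L (x + \<eta>)) < \<epsilon> / 3"
      using tendstoD[OF cW, of "\<epsilon> / 3"] \<epsilon> by simp
    moreover have "\<forall>\<^sub>F n in sequentially. dist (cdf (distr M borel (W n)) (x - \<eta>)) (cdf L (x - \<eta>)) < \<epsilon> / 3"
      using tendstoD[OF cW, of "\<epsilon> / 3"] \<epsilon> by simp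
    ultimately show "\<forall>\<^sub>F n in sequentially. dist (cdf (distr M borel (D n)) x) (cdf L x) < \<epsilon>"
      using W EW
    proof eventually_elim
      case (elim n)
      then have [measurable]: "W n \<in> borel_measurable M" "E n \<in> events" "D n \<in> borel_measurable M" using D by auto
      have close: "\<bar>D n \<omega> - W n \<omega>\<bar> \<le> \<eta>" if "\<omega> \<in> space M" "\<omega> \<notin> E n" for \<omega> using elim that by auto
      have "prob {\<omega> \<in> space M. D n \<omega> \<le> x} \<le> prob ({\<omega> \<in> space M. W n \<omega> \<le> x + \<eta>} \<union> E n)"
        using close by (intro finite_measure_mono) (auto simp: abs_le_iff, force)
      also have "\<dots> \<le> prob {\<omega> \<in> space M. W n \<omega> \<le> x + \<eta>} + prob (E n)" by (rule measure_Un_le) auto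
      finally have 1: "cdf (distr M borel (D n)) x \<le> cdf (distr M borel (W n)) (x + \<eta>) + prob (E n)"
        by (simp add: cdf_eq)
      have "prob {\<omega> \<in> space M. W n \<omega> \<le> x - \<eta>} \<le> prob ({\<omega> \<in> space M. D n \<omega> \<le> x} \<union> E n)"
        using close by (intro finite_measure_mono) (auto simp: abs_le_iff, force)
      also have "\<dots> \<le> prob {\<omega> \<in> space M. D n \<omega> \<le> x} + prob (E n)" by (rule measure_Un_le) auto
      finally have 2: "cdf (distr M borel (W n)) (x - \<eta>) \<le> cdf (distr M borel (D n)) x + prob (E n)"
        by (simp add: cdf_eq)
      have "\<bar>cdf L (x + \<eta>) - cdf L x\<bar> < \<epsilon> / 3" "\<bar>cdf L (x - \<eta>) - cdf L x\<bar> < \<epsilon> / 3"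
        using \<eta>0 by (auto simp: \<eta>_def)
      with 1 2 elim show ?case unfolding dist_real_def by linarith
    qed
  qed
qed

section \<open>Moments of the local increments\<close>

text \<open>Half of the contribution of an observation \<open>y\<close> to the increment of \<open>U\<^sub>n\<^sup>#\<close> from \<open>x0\<close> to \<open>x0 + \<beta>\<close>.\<close>

definition sqrt_step :: "real \<Rightarrow> real \<Rightarrow> real \<Rightarrow> real" where
  "sqrt_step x0 \<beta> y = sqrt (max (y - x0) 0) - sqrt (max (y - x0 - \<beta>) 0)"

text \<open>The derivative of twice \<open>sqrt_step\<close> at \<open>\<beta> = 0\<close>, cut off within distance \<open>a\<close> of the singularity.\<close>

definition inv_sqrt :: "real \<Rightarrow> real \<Rightarrow> real \<Rightarrow> real" where
  "inv_sqrt x0 a y = (if a < y - x0 then 1 / sqrt (y - x0) else 0)"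

definition remainder :: "real \<Rightarrow> real \<Rightarrow> real \<Rightarrow> real \<Rightarrow> real" where
  "remainder x0 a \<beta> y = 2 * sqrt_step x0 \<beta> y - \<beta> * inv_sqrt x0 a y"

lemma sqrt_step_measurable [measurable]: "sqrt_step x0 \<beta> \<in> borel_measurable borel"
  unfolding sqrt_step_def by measurable

lemma inv_sqrt_measurable [measurable]: "inv_sqrt x0 a \<in> borel_measurable borel"
  unfolding inv_sqrt_def by measurable

lemma remainder_measurable [measurable]: "remainder x0 a \<beta> \<in> borel_measurable borel"
  unfolding remainder_def by measurable

lemma psi_diff: "psi (x0 + \<beta>) y - psi x0 y = 2 * sqrt_step x0 \<beta> y"
  by (simp add: psi_def sqrt_step_def diff_diff_eq)

lemma remainder_0 [simp]: "remainder x0 a 0 y = 0"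
  by (simp add: remainder_def sqrt_step_def)

lemma sqrt_step_diff_le: "\<bar>sqrt_step x0 \<beta> y - sqrt_step x0 \<gamma> y\<bar> \<le> sqrt \<bar>\<beta> - \<gamma>\<bar>"
  using abs_sqrt_diff_le[of "y - x0 - \<gamma>" "y - x0 - \<beta>"] by (simp add: sqrt_step_def abs_minus_commute)

lemma sqrt_step_le: "\<bar>sqrt_step x0 \<beta> y\<bar> \<le> sqrt \<bar>\<beta>\<bar>"
  using sqrt_step_diff_le[of x0 \<beta> y 0] by (simp add: sqrt_step_def)

lemma sqrt_step_eq_0: "y - x0 \<le> - \<bar>\<beta>\<bar> \<Longrightarrow> sqrt_step x0 \<beta> y = 0"
  by (auto simp: sqrt_step_def max_def)

text \<open>At distance \<open>w > 2 m\<close> from \<open>x0\<close> the increment is almost linear in \<open>\<beta>\<close>: the increment is the quotient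
  of \<open>\<beta> - \<gamma>\<close> by the sum of \<open>\<surd>(w - \<beta>)\<close> and \<open>\<surd>(w - \<gamma>)\<close>, and both roots are within \<open>m / \<surd>w\<close> of \<open>\<surd>w\<close>.\<close>

lemma sqrt_step_linearization:
  assumes \<beta>: "\<bar>\<beta>\<bar> \<le> m" and \<gamma>: "\<bar>\<gamma>\<bar> \<le> m" and w: "2 * m < y - x0" "0 \<le> m"
  shows "\<bar>2 * (sqrt_step x0 \<beta> y - sqrt_step x0 \<gamma> y) - (\<beta> - \<gamma>) / sqrt (y - x0)\<bar>
    \<le> 2 * \<bar>\<beta> - \<gamma>\<bar> * m / ((y - x0) * sqrt (y - x0))"
proof -
  define w where "w = y - x0"
  define s p p' where "s = sqrt w" and "p = sqrt (w - \<beta>)" and "p' = sqrt (w - \<gamma>)"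
  have pos: "0 < w" "0 < w - \<beta>" "0 < w - \<gamma>" using assms by (auto simp: w_def)
  then have sp: "0 < s" "0 < p" "0 < p'" "s * s = w" "p * p = w - \<beta>" "p' * p' = w - \<gamma>"
    by (auto simp: s_def p_def p'_def)
  have sqrt_step: "sqrt_step x0 \<beta> y - sqrt_step x0 \<gamma> y = p' - p"
    using pos by (simp add: sqrt_step_def p_def p'_def w_def max_def)
  have half: "s / 2 \<le> sqrt (w - \<delta>)" if "\<bar>\<delta>\<bar> \<le> m" for \<delta>
  proof (rule real_le_rsqrt)
    have "w / 4 \<le> w - \<delta>" using that w by (simp add: w_def[symmetric] abs_le_iff)
    then show "(s / 2)\<^sup>2 \<le> w - \<delta>" using sp by (simp add: power2_eq_square)
  qed
  have ge: "s \<le> p + p'" using half[OF \<beta>] half[OF \<gamma>] by (simp add: p_def p'_def)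
  have d: "\<bar>s - sqrt (w - \<delta>)\<bar> \<le> m / s" if "\<bar>\<delta>\<bar> \<le> m" "0 < w - \<delta>" for \<delta>
  proof -
    have "(s - sqrt (w - \<delta>)) * (s + sqrt (w - \<delta>)) = \<delta>" using sp that by (simp add: algebra_simps)
    then have "\<bar>s - sqrt (w - \<delta>)\<bar> * (s + sqrt (w - \<delta>)) = \<bar>\<delta>\<bar>"
      using sp that by (metis abs_mult abs_of_pos add_pos_pos real_sqrt_gt_zero)
    moreover have "\<bar>s - sqrt (w - \<delta>)\<bar> * s \<le> \<bar>s - sqrt (w - \<delta>)\<bar> * (s + sqrt (w - \<delta>))"
      using that by (intro mult_left_mono) auto
    ultimately show ?thesis using that sp by (simp add: pos_le_divide_eq)
  qed
  have pp: "(p' - p) * (p + p') = \<beta> - \<gamma>" using sp by (simp add: algebra_simps)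
  have quot: "2 * (X / S) - X / s = X * (2 * s - S) / (S * s)" if "0 < S" for X S :: real
    using sp that by (simp add: field_simps)
  have "p' - p = (\<beta> - \<gamma>) / (p + p')" using sp pp by (simp add: nonzero_eq_divide_eq)
  then have "2 * (p' - p) - (\<beta> - \<gamma>) / s = (\<beta> - \<gamma>) * ((s - p) + (s - p')) / ((p + p') * s)"
    using quot[of "p + p'" "\<beta> - \<gamma>"] sp by simp
  then have "\<bar>2 * (p' - p) - (\<beta> - \<gamma>) / s\<bar> = \<bar>\<beta> - \<gamma>\<bar> * \<bar>(s - p) + (s - p')\<bar> / ((p + p') * s)"
    using sp by (simp add: abs_mult)
  also have "\<dots> \<le> \<bar>\<beta> - \<gamma>\<bar> * (2 * (m / s)) / (s * s)"
  proof (intro frac_le mult_left_mono mult_right_mono)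
    show "\<bar>(s - p) + (s - p')\<bar> \<le> 2 * (m / s)"
      using d[OF \<beta>] d[OF \<gamma>] pos by (simp add: p_def p'_def)
  qed (use sp ge w in \<open>auto intro!: mult_nonneg_nonneg divide_nonneg_pos\<close>)
  also have "\<dots> = 2 * \<bar>\<beta> - \<gamma>\<bar> * m / (w * s)"
    using sp by (simp add: field_simps)
  finally show ?thesis unfolding sqrt_step by (simp add: w_def s_def)
qed

lemma remainder_diff_far:
  assumes "\<bar>\<beta>\<bar> \<le> m" "\<bar>\<gamma>\<bar> \<le> m" "2 * m < y - x0" "0 \<le> m" "a \<le> 2 * m"
  shows "\<bar>remainder x0 a \<beta> y - remainder x0 a \<gamma> y\<bar> \<le> 2 * \<bar>\<beta> - \<gamma>\<bar> * m / ((y - x0) * sqrt (y - x0))"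
  using sqrt_step_linearization[OF assms(1-4)] assms(3,5) by (simp add: remainder_def inv_sqrt_def algebra_simps diff_divide_distrib)

lemma far_square_le:
  assumes "\<bar>D\<bar> \<le> c / (w * sqrt w)" "0 < w"
  shows "D\<^sup>2 \<le> c\<^sup>2 * (1 / w ^ 3)"
proof -
  have "D\<^sup>2 \<le> (c / (w * sqrt w))\<^sup>2" using assms by (metis abs_ge_zero power2_abs power_mono)
  also have "\<dots> = c\<^sup>2 * (1 / w ^ 3)" using assms by (simp add: power_divide power_mult_distrib power3_eq_cube power2_eq_square)
  finally show ?thesis .
qed

lemma far_bound:
  assumes "2 * m < w" "0 < m" "0 \<le> c"
  shows "c / (w * sqrt w) \<le> c / (2 * m * sqrt (2 * m))"
  using assms by (intro divide_left_mono mult_mono) auto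

lemma ennreal_add_times:
  "0 \<le> a \<Longrightarrow> 0 \<le> b \<Longrightarrow> 0 \<le> c \<Longrightarrow> ennreal (a + b * c) = ennreal a + ennreal b * ennreal c"
  by (simp add: ennreal_mult ennreal_plus)

lemma ennreal_times_add_times:
  "0 \<le> a \<Longrightarrow> 0 \<le> b \<Longrightarrow> 0 \<le> c \<Longrightarrow> 0 \<le> d \<Longrightarrow> ennreal (a * b + c * d) = ennreal a * ennreal b + ennreal c * ennreal d"
  by (simp add: ennreal_mult ennreal_plus)

text \<open>Writing \<open>F (y - x0)\<close> as the integral of \<open>- F'\<close> over \<open>[y - x0, \<infinity>)\<close> and exchanging the integrals turns
  bounds on the mass of intervals into bounds on moments.\<close>

lemma (in real_distribution) nn_integral_tail_layer_cake:
  fixes F f :: "real \<Rightarrow> real"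
  assumes "0 < b" and [measurable]: "f \<in> borel_measurable borel" "F \<in> borel_measurable borel"
    and f: "\<And>r. b \<le> r \<Longrightarrow> 0 \<le> f r"
    and F: "\<And>r. b \<le> r \<Longrightarrow> (F has_real_derivative - f r) (at r)" and lim: "(F \<longlongrightarrow> 0) at_top"
  shows "(\<integral>\<^sup>+y\<in>{x0 + b<..}. ennreal (F (y - x0)) \<partial>M) = (\<integral>\<^sup>+r\<in>{b<..}. ennreal (f r) * emeasure M {x0 + b<..x0 + r} \<partial>lborel)"
proof -
  interpret pair_sigma_finite lborel M ..
  have FTC: "(\<integral>\<^sup>+r\<in>{w..}. ennreal (f r) \<partial>lborel) = ennreal (F w)" if "b < w" for w
  proof -
    have "(\<integral>\<^sup>+r. ennreal (f r) * indicator {w..} r \<partial>lborel) = ennreal (0 - (- F w))"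
    proof (rule nn_integral_FTC_atLeast)
      show "((\<lambda>r. - F r) has_real_derivative f r) (at r)" if "w \<le> r" for r
        using F[of r] that \<open>b < w\<close> DERIV_minus by force
      show "((\<lambda>r. - F r) \<longlongrightarrow> 0) at_top" using tendsto_minus[OF lim] by simp
    qed (use f that in auto)
    then show ?thesis by simp
  qed
  have "(\<integral>\<^sup>+y\<in>{x0 + b<..}. ennreal (F (y - x0)) \<partial>M) = (\<integral>\<^sup>+y. \<integral>\<^sup>+r. ennreal (f r) * (indicator {x0 + b<..} y * indicator {y - x0..} r) \<partial>lborel \<partial>M)"
  proof (rule nn_integral_cong)
    fix y
    show "ennreal (F (y - x0)) * indicator {x0 + b<..} y = (\<integral>\<^sup>+r. ennreal (f r) * (indicator {x0 + b<..} y * indicator {y - x0..} r) \<partial>lborel)"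
      using FTC[of "y - x0"] by (cases "x0 + b < y") auto
  qed
  also have "\<dots> = (\<integral>\<^sup>+r. \<integral>\<^sup>+y. ennreal (f r) * (indicator {x0 + b<..} y * indicator {y - x0..} r) \<partial>M \<partial>lborel)"
    by (rule Fubini') (simp add: indicator_def)
  also have "\<dots> = (\<integral>\<^sup>+r\<in>{b<..}. ennreal (f r) * emeasure M {x0 + b<..x0 + r} \<partial>lborel)"
  proof (rule nn_integral_cong)
    fix r
    have "(\<integral>\<^sup>+y. ennreal (f r) * (indicator {x0 + b<..} y * indicator {y - x0..} r) \<partial>M) = (\<integral>\<^sup>+y. ennreal (f r) * indicator {x0 + b<..x0 + r} y \<partial>M)"
      by (intro nn_integral_cong) (auto split: split_indicator)
    also have "\<dots> = ennreal (f r) * emeasure M {x0 + b<..x0 + r}"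
      by (subst nn_integral_cmult_indicator) auto
    finally show "(\<integral>\<^sup>+y. ennreal (f r) * (indicator {x0 + b<..} y * indicator {y - x0..} r) \<partial>M)
       = ennreal (f r) * emeasure M {x0 + b<..x0 + r} * indicator {b<..} r"
      by (cases "b < r") auto
  qed
  finally show ?thesis .
qed

lemma nn_integral_inverse_power:
  assumes "0 < b" "0 < p"
  shows "(\<integral>\<^sup>+r\<in>{b<..}. ennreal (real p / r ^ Suc p) \<partial>lborel) = ennreal (1 / b ^ p)"
proof -
  have "(\<integral>\<^sup>+r. ennreal (real p / r ^ Suc p) * indicator {b..} r \<partial>lborel) = ennreal (0 - (- (1 / b ^ p)))"
  proof (rule nn_integral_FTC_atLeast)
    show "((\<lambda>r. - (1 / r ^ p)) has_real_derivative real p / r ^ Suc p) (at r)" if "b \<le> r" for r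
    proof -
      obtain k where k: "p = Suc k" using assms(2) gr0_implies_Suc by blast
      have "0 < r" using that assms by simp
      have "((\<lambda>r. r ^ p) has_real_derivative real p * r ^ k) (at r)"
        using DERIV_pow[of p r] by (simp add: k)
      from DERIV_minus[OF DERIV_inverse_fun[OF this]] \<open>0 < r\<close>
      have "((\<lambda>r. - inverse (r ^ p)) has_real_derivative (real p * r ^ k) * inverse ((r ^ p) ^ 2)) (at r)"
        by (simp add: numeral_2_eq_2)
      moreover have "(real p * r ^ k) * inverse ((r ^ p) ^ 2) = real p / r ^ Suc p"
        using \<open>0 < r\<close> by (simp add: k divide_simps power2_eq_square)
      ultimately show ?thesis by (simp add: inverse_eq_divide)
    qed
    show "((\<lambda>r. - (1 / r ^ p)) \<longlongrightarrow> (0::real)) at_top"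
      using tendsto_minus[OF tendsto_inverse_0_at_top[OF filterlim_pow_at_top[OF assms(2) filterlim_ident]]]
      by (simp add: inverse_eq_divide)
  qed (use assms in auto)
  moreover have "(\<integral>\<^sup>+r. ennreal (real p / r ^ Suc p) * indicator {b..} r \<partial>lborel) = (\<integral>\<^sup>+r\<in>{b<..}. ennreal (real p / r ^ Suc p) \<partial>lborel)"
    by (rule nn_integral_lborel_cong_off_finite[of "{b}"]) (auto split: split_indicator)
  ultimately show ?thesis by simp
qed

text \<open>A distribution that has, near \<open>x0\<close>, a bounded density down to the scale \<open>e\<close>. This is what closeness of
  order \<open>e\<close> to a distribution with a bounded density leaves; only intervals centred at \<open>x0\<close> are
  controlled, since the limit density may be unbounded at points arbitrarily close to \<open>x0\<close>.\<close>

locale mass_bound = real_distribution \<mu> for \<mu> :: "real measure" +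
  fixes x0 B e :: real
  assumes B: "0 \<le> B" and e: "0 < e"
    and mass: "\<And>h. 0 \<le> h \<Longrightarrow> measure \<mu> {x0 - h<..x0 + h} \<le> B * (h + e)"
begin

lemma tail_cubic:
  assumes "e \<le> b"
  shows "(\<integral>\<^sup>+y\<in>{x0 + b<..}. ennreal (1 / (y - x0) ^ 3) \<partial>\<mu>) \<le> ennreal (5 / 2 * B / b\<^sup>2)"
proof -
  have b: "0 < b" using e assms by simp
  have "(\<integral>\<^sup>+y\<in>{x0 + b<..}. ennreal (1 / (y - x0) ^ 3) \<partial>\<mu>) = (\<integral>\<^sup>+r\<in>{b<..}. ennreal (3 / r ^ 4) * emeasure \<mu> {x0 + b<..x0 + r} \<partial>lborel)"
  proof (rule nn_integral_tail_layer_cake[OF b, of "\<lambda>r. 3 / r ^ 4" "\<lambda>w. 1 / w ^ 3"])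
    show "((\<lambda>w. 1 / w ^ 3) has_real_derivative - (3 / r ^ 4)) (at r)" if "b \<le> r" for r
      using that b by (auto intro!: derivative_eq_intros simp: field_simps power_numeral_reduce)
    show "((\<lambda>w. 1 / w ^ 3) \<longlongrightarrow> (0::real)) at_top"
      by (auto intro!: tendsto_divide_0[OF tendsto_const] filterlim_at_top_imp_at_infinity filterlim_pow_at_top filterlim_ident)
  qed auto
  also have "\<dots> \<le> (\<integral>\<^sup>+r. ennreal (3 / 2 * B) * (ennreal (real 2 / r ^ Suc 2) * indicator {b<..} r) + ennreal (B * e) * (ennreal (real 3 / r ^ Suc 3) * indicator {b<..} r) \<partial>lborel)"
  proof (rule nn_integral_mono)
    fix r
    show "ennreal (3 / r ^ 4) * emeasure \<mu> {x0 + b<..x0 + r} * indicator {b<..} r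
      \<le> ennreal (3 / 2 * B) * (ennreal (real 2 / r ^ Suc 2) * indicator {b<..} r) + ennreal (B * e) * (ennreal (real 3 / r ^ Suc 3) * indicator {b<..} r)"
    proof (cases "b < r")
      case True
      have "measure \<mu> {x0 + b<..x0 + r} \<le> measure \<mu> {x0 - r<..x0 + r}"
        using True b by (intro finite_measure_mono) auto
      also have "\<dots> \<le> B * (r + e)" using mass True b by simp
      finally have "3 / r ^ 4 * measure \<mu> {x0 + b<..x0 + r} \<le> 3 / r ^ 4 * (B * (r + e))"
        using True b by (intro mult_left_mono) auto
      also have "\<dots> = 3 / 2 * B * (real 2 / r ^ Suc 2) + B * e * (real 3 / r ^ Suc 3)"
        using True b by (simp add: field_simps power_numeral_reduce)
      finally have "ennreal (3 / r ^ 4 * measure \<mu> {x0 + b<..x0 + r}) \<le> ennreal (3 / 2 * B * (real 2 / r ^ Suc 2) + B * e * (real 3 / r ^ Suc 3))"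
        by (rule ennreal_leI)
      moreover have "ennreal (3 / r ^ 4 * measure \<mu> {x0 + b<..x0 + r}) = ennreal (3 / r ^ 4) * emeasure \<mu> {x0 + b<..x0 + r}"
        unfolding emeasure_eq_measure using True b by (intro ennreal_mult) auto
      moreover have "ennreal (3 / 2 * B * (real 2 / r ^ Suc 2) + B * e * (real 3 / r ^ Suc 3))
         = ennreal (3 / 2 * B) * ennreal (real 2 / r ^ Suc 2) + ennreal (B * e) * ennreal (real 3 / r ^ Suc 3)"
        using True b B e by (intro ennreal_times_add_times) auto
      ultimately show ?thesis using True by simp
    qed auto
  qed
  also have "\<dots> = ennreal (3 / 2 * B) * ennreal (1 / b\<^sup>2) + ennreal (B * e) * ennreal (1 / b ^ 3)"
    by (subst nn_integral_add, simp, simp, subst (1 2) nn_integral_cmult, simp, simp, simp only: nn_integral_inverse_power[OF b] zero_less_numeral)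
  also have "\<dots> = ennreal (3 / 2 * B * (1 / b\<^sup>2) + B * e * (1 / b ^ 3))"
    using B e b by (intro ennreal_times_add_times[symmetric]) auto
  also have "\<dots> \<le> ennreal (5 / 2 * B / b\<^sup>2)"
  proof (rule ennreal_leI)
    have "B * e * (1 / b ^ 3) \<le> B * b * (1 / b ^ 3)" using assms B b by (intro mult_right_mono mult_left_mono) auto
    also have "\<dots> = B / b\<^sup>2" using b by (simp add: power3_eq_cube power2_eq_square)
    finally show "3 / 2 * B * (1 / b\<^sup>2) + B * e * (1 / b ^ 3) \<le> 5 / 2 * B / b\<^sup>2" by simp
  qed
  finally show ?thesis .
qed

text \<open>The constants are those of the two ranges: the window \<open>\<bar>y - x0\<bar> \<le> 2 m\<close> has mass at most \<open>3 B m\<close>, and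
  outside it \<open>1 / (y - x0)\<^sup>3\<close> integrates to at most \<open>B / m\<^sup>2\<close>.\<close>

lemma second_moment_le:
  assumes [measurable]: "D \<in> borel_measurable borel" and m: "e \<le> m" and c: "0 \<le> c" "0 \<le> d"
    and outside: "\<And>y. y - x0 \<le> - 2 * m \<Longrightarrow> D y = 0"
    and near: "\<And>y. y - x0 \<le> 2 * m \<Longrightarrow> (D y)\<^sup>2 \<le> d"
    and far: "\<And>y. 2 * m < y - x0 \<Longrightarrow> (D y)\<^sup>2 \<le> c * (1 / (y - x0) ^ 3)"
  shows "expectation (\<lambda>y. (D y)\<^sup>2) \<le> 3 * B * m * d + B * c / m\<^sup>2"
proof -
  have m0: "0 < m" using e m by simp
  have "(\<integral>\<^sup>+y. ennreal ((D y)\<^sup>2) \<partial>\<mu>) \<le> (\<integral>\<^sup>+y. ennreal d * indicator {x0 - 2 * m<..x0 + 2 * m} y + ennreal c * (ennreal (1 / (y - x0) ^ 3) * indicator {x0 + 2 * m<..} y) \<partial>\<mu>)"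
  proof (rule nn_integral_mono)
    fix y
    consider "y - x0 \<le> - 2 * m" | "- 2 * m < y - x0" "y - x0 \<le> 2 * m" | "2 * m < y - x0" by linarith
    then show "ennreal ((D y)\<^sup>2) \<le> ennreal d * indicator {x0 - 2 * m<..x0 + 2 * m} y + ennreal c * (ennreal (1 / (y - x0) ^ 3) * indicator {x0 + 2 * m<..} y)"
    proof cases
      case 3
      then have "ennreal ((D y)\<^sup>2) \<le> ennreal (c * (1 / (y - x0) ^ 3))" using far by (intro ennreal_leI) auto
      also have "\<dots> = ennreal c * ennreal (1 / (y - x0) ^ 3)" using 3 m0 c by (intro ennreal_mult) auto
      finally show ?thesis using 3 m0 by simp
    qed (use outside near m0 in \<open>auto intro!: ennreal_leI\<close>)
  qed
  also have "\<dots> = ennreal d * emeasure \<mu> {x0 - 2 * m<..x0 + 2 * m} + ennreal c * (\<integral>\<^sup>+y\<in>{x0 + 2 * m<..}. ennreal (1 / (y - x0) ^ 3) \<partial>\<mu>)"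
    by (subst nn_integral_add) (auto simp: nn_integral_cmult nn_integral_cmult_indicator)
  also have "\<dots> \<le> ennreal d * ennreal (3 * B * m) + ennreal c * ennreal (5 / 2 * B / (2 * m)\<^sup>2)"
  proof (intro add_mono mult_left_mono tail_cubic)
    have "B * (2 * m + e) \<le> B * (3 * m)" using B m by (intro mult_left_mono) auto
    then have "measure \<mu> {x0 - 2 * m<..x0 + 2 * m} \<le> 3 * B * m" using mass[of "2 * m"] m0 by simp
    then show "emeasure \<mu> {x0 - 2 * m<..x0 + 2 * m} \<le> ennreal (3 * B * m)"
      unfolding emeasure_eq_measure by (rule ennreal_leI)
  qed (use m m0 in auto)
  also have "\<dots> = ennreal (d * (3 * B * m) + c * (5 / 2 * B / (2 * m)\<^sup>2))"
    using c B m0 by (subst ennreal_add_times) (auto intro!: arg_cong2[where f="(+)"] ennreal_mult[symmetric])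
  also have "\<dots> \<le> ennreal (3 * B * m * d + B * c / m\<^sup>2)"
  proof (rule ennreal_leI)
    have "c * (5 / 2 * B / (2 * m)\<^sup>2) = 5 / 8 * (B * c / m\<^sup>2)" using m0 by (simp add: power2_eq_square)
    also have "0 \<le> B * c / m\<^sup>2" using B c by simp
    then have "5 / 8 * (B * c / m\<^sup>2) \<le> B * c / m\<^sup>2" by linarith
    finally show "d * (3 * B * m) + c * (5 / 2 * B / (2 * m)\<^sup>2) \<le> 3 * B * m * d + B * c / m\<^sup>2" by simp
  qed
  finally have "enn2real (\<integral>\<^sup>+y. ennreal ((D y)\<^sup>2) \<partial>\<mu>) \<le> 3 * B * m * d + B * c / m\<^sup>2"
    using B c m0 by (intro enn2real_leI) auto
  then show ?thesis by (subst integral_eq_nn_integral) auto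
qed

text \<open>The second moment of an increment is at most linear in \<open>\<bar>\<beta> - \<gamma>\<bar>\<close>, as for Brownian motion. In the window of radius \<open>2 m\<close>
  nothing is linearized, and outside it the linear part is subtracted exactly.\<close>

lemma remainder_local_bounds:
  assumes "e \<le> m" "\<bar>\<beta>\<bar> \<le> m" "\<bar>\<gamma>\<bar> \<le> m"
  shows "\<bar>remainder x0 (2 * m) \<beta> y - remainder x0 (2 * m) \<gamma> y\<bar> \<le> 2 * sqrt \<bar>\<beta> - \<gamma>\<bar>"
    and "expectation (\<lambda>y. (remainder x0 (2 * m) \<beta> y - remainder x0 (2 * m) \<gamma> y)\<^sup>2) \<le> 20 * B * m * \<bar>\<beta> - \<gamma>\<bar>"
proof -
  define \<Delta> where "\<Delta> = \<bar>\<beta> - \<gamma>\<bar>"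
  have m0: "0 < m" using assms e by simp
  have \<Delta>: "0 \<le> \<Delta>" "\<Delta> \<le> 2 * m" using assms by (auto simp: \<Delta>_def)
  let ?D = "\<lambda>y. remainder x0 (2 * m) \<beta> y - remainder x0 (2 * m) \<gamma> y"
  have near: "\<bar>?D y\<bar> \<le> 2 * sqrt \<Delta>" if "y - x0 \<le> 2 * m" for y
    using sqrt_step_diff_le[of x0 \<beta> y \<gamma>] that by (simp add: remainder_def inv_sqrt_def \<Delta>_def)
  have far: "\<bar>?D y\<bar> \<le> 2 * \<Delta> * m / ((y - x0) * sqrt (y - x0))" if "2 * m < y - x0" for y
    using remainder_diff_far[OF assms(2,3) that] m0 by (simp add: \<Delta>_def)
  have bound: "\<bar>?D y\<bar> \<le> 2 * sqrt \<Delta>" for y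
  proof (cases "y - x0 \<le> 2 * m")
    case False
    have "\<bar>?D y\<bar> \<le> 2 * \<Delta> * m / (2 * m * sqrt (2 * m))"
      using far[of y] far_bound[of m "y - x0" "2 * \<Delta> * m"] False m0 \<Delta> by simp
    also have "\<dots> = \<Delta> / sqrt (2 * m)" using m0 by simp
    also have "\<dots> \<le> sqrt \<Delta>"
    proof -
      have "\<Delta> = sqrt \<Delta> * sqrt \<Delta>" using \<Delta> by simp
      also have "\<dots> \<le> sqrt \<Delta> * sqrt (2 * m)" using \<Delta> by (intro mult_left_mono) auto
      finally show ?thesis using m0 by (simp add: pos_divide_le_eq)
    qed
    also have "\<dots> \<le> 2 * sqrt \<Delta>" using \<Delta> by simp
    finally show ?thesis .
  qed (rule near)
  then show "\<bar>remainder x0 (2 * m) \<beta> y - remainder x0 (2 * m) \<gamma> y\<bar> \<le> 2 * sqrt \<bar>\<beta> - \<gamma>\<bar>" by (simp add: \<Delta>_def)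
  have "expectation (\<lambda>y. (?D y)\<^sup>2) \<le> 3 * B * m * (4 * \<Delta>) + B * (2 * \<Delta> * m)\<^sup>2 / m\<^sup>2"
  proof (rule second_moment_le)
    show "(?D y)\<^sup>2 \<le> 4 * \<Delta>" for y
      using power_mono[OF bound[of y] abs_ge_zero, where n=2] \<Delta> by (simp add: power_mult_distrib)
    show "(?D y)\<^sup>2 \<le> (2 * \<Delta> * m)\<^sup>2 * (1 / (y - x0) ^ 3)" if "2 * m < y - x0" for y
      using far[OF that] that m0 by (intro far_square_le) auto
    show "?D y = 0" if "y - x0 \<le> - 2 * m" for y
      using that assms m0 sqrt_step_eq_0[of y x0 \<beta>] sqrt_step_eq_0[of y x0 \<gamma>] by (simp add: remainder_def inv_sqrt_def)
  qed (use assms \<Delta> in auto)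
  also have "\<dots> = 12 * B * m * \<Delta> + 4 * B * \<Delta> * \<Delta>" using m0 by (simp add: power_mult_distrib power2_eq_square)
  also have "\<dots> \<le> 12 * B * m * \<Delta> + 4 * B * (2 * m) * \<Delta>" using B \<Delta> by (intro add_left_mono mult_right_mono mult_left_mono) auto
  finally show "expectation (\<lambda>y. (remainder x0 (2 * m) \<beta> y - remainder x0 (2 * m) \<gamma> y)\<^sup>2) \<le> 20 * B * m * \<bar>\<beta> - \<gamma>\<bar>"
    by (simp add: \<Delta>_def)
qed

text \<open>For \<open>\<bar>\<beta>\<bar>\<close> above the cutoff the linear part is also subtracted where it does not approximate, between
  the cutoff and \<open>2 \<bar>\<beta>\<bar>\<close>. This costs a factor \<open>\<bar>\<beta>\<bar> / m\<close>, which a deviation of order \<open>\<beta>\<^sup>2\<close> can afford.\<close>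

lemma remainder_far_bounds:
  assumes "e \<le> m" "m \<le> \<bar>\<beta>\<bar>"
  shows "\<bar>remainder x0 (2 * m) \<beta> y\<bar> \<le> 3 * \<bar>\<beta>\<bar> / sqrt m"
    and "expectation (\<lambda>y. (remainder x0 (2 * m) \<beta> y)\<^sup>2) \<le> 31 * B * \<bar>\<beta>\<bar> ^ 3 / m"
proof -
  define b where "b = \<bar>\<beta>\<bar>"
  have m0: "0 < m" and b: "m \<le> b" using assms e by (auto simp: b_def)
  have sq: "sqrt b \<le> b / sqrt m"
  proof -
    have "sqrt b * sqrt m \<le> sqrt b * sqrt b" using b m0 by (intro mult_left_mono) auto
    then show ?thesis using b m0 by (simp add: pos_le_divide_eq)
  qed
  let ?D = "\<lambda>y. remainder x0 (2 * m) \<beta> y"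
  have inv_sqrt: "\<bar>inv_sqrt x0 (2 * m) y\<bar> \<le> 1 / sqrt m" for y
    using m0 by (auto simp: inv_sqrt_def intro!: divide_left_mono)
  have bound: "\<bar>?D y\<bar> \<le> 3 * b / sqrt m" for y
  proof -
    have "\<bar>?D y\<bar> \<le> 2 * \<bar>sqrt_step x0 \<beta> y\<bar> + b * \<bar>inv_sqrt x0 (2 * m) y\<bar>"
      unfolding remainder_def b_def abs_mult[symmetric] by (rule order_trans[OF abs_triangle_ineq4]) (simp add: abs_mult)
    also have "\<dots> \<le> 2 * (b / sqrt m) + b * (1 / sqrt m)"
      using sqrt_step_le[of x0 \<beta> y] sq inv_sqrt[of y] b m0 by (intro add_mono mult_left_mono) (auto simp: b_def)
    finally show ?thesis by simp
  qed
  then show "\<bar>remainder x0 (2 * m) \<beta> y\<bar> \<le> 3 * \<bar>\<beta>\<bar> / sqrt m" by (simp add: b_def)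
  have far: "\<bar>?D y\<bar> \<le> 2 * b * b / ((y - x0) * sqrt (y - x0))" if "2 * b < y - x0" for y
    using remainder_diff_far[of \<beta> b 0 y x0 "2 * m"] that b m0 by (simp add: b_def)
  have "expectation (\<lambda>y. (?D y)\<^sup>2) \<le> 3 * B * b * (9 * b\<^sup>2 / m) + B * (2 * b * b)\<^sup>2 / b\<^sup>2"
  proof (rule second_moment_le)
    show "(?D y)\<^sup>2 \<le> 9 * b\<^sup>2 / m" for y
      using power_mono[OF bound[of y] abs_ge_zero, where n=2] m0 by (simp add: power_mult_distrib power_divide)
    show "(?D y)\<^sup>2 \<le> (2 * b * b)\<^sup>2 * (1 / (y - x0) ^ 3)" if "2 * b < y - x0" for y
      using far[OF that] that m0 b by (intro far_square_le) auto
    show "?D y = 0" if "y - x0 \<le> - 2 * b" for y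
      using that m0 b sqrt_step_eq_0[of y x0 \<beta>] by (simp add: remainder_def inv_sqrt_def b_def)
  qed (use assms b m0 in auto)
  also have "\<dots> = 27 * (B * b ^ 3 / m) + 4 * (B * b\<^sup>2)"
    using m0 b by (simp add: power_mult_distrib power2_eq_square power3_eq_cube)
  also have "B * b\<^sup>2 \<le> B * b ^ 3 / m"
  proof -
    have "B * b\<^sup>2 * m \<le> B * b\<^sup>2 * b" using B b m0 by (intro mult_left_mono) auto
    then show ?thesis using m0 by (simp add: pos_le_divide_eq power3_eq_cube power2_eq_square mult_ac)
  qed
  finally show "expectation (\<lambda>y. (remainder x0 (2 * m) \<beta> y)\<^sup>2) \<le> 31 * B * \<bar>\<beta>\<bar> ^ 3 / m"
    by (simp add: b_def)
qed

end

lemma nn_integral_inverse: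
  assumes "0 < b" "b \<le> \<tau>" "0 \<le> A"
  shows "(\<integral>\<^sup>+r\<in>{b<..\<tau>}. ennreal (A / r) \<partial>lborel) = ennreal (A * ln (\<tau> / b))"
proof -
  have "(\<integral>\<^sup>+r. ennreal (A / r) * indicator {b..\<tau>} r \<partial>lborel) = ennreal (A * ln \<tau> - A * ln b)"
    using assms by (intro nn_integral_FTC_Icc) (auto intro!: derivative_eq_intros simp: field_simps)
  moreover have "(\<integral>\<^sup>+r. ennreal (A / r) * indicator {b..\<tau>} r \<partial>lborel) = (\<integral>\<^sup>+r\<in>{b<..\<tau>}. ennreal (A / r) \<partial>lborel)"
    by (rule nn_integral_lborel_cong_off_finite[of "{b}"]) (auto split: split_indicator)
  ultimately show ?thesis using assms by (simp add: ln_div right_diff_distrib)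
qed

text \<open>The second moment of \<open>1 / \<surd>(y - x0)\<close> diverges logarithmically at \<open>x0\<close>, with the density as
  the coefficient. This logarithm is the one in \<open>\<epsilon>\<^sub>n\<close>.\<close>

lemma (in real_distribution) inv_sqrt_second_moment:
  assumes b: "0 < b" "b \<le> \<tau>" and A: "0 \<le> A'" "0 \<le> A" "0 \<le> d"
    and upper: "\<And>r. b < r \<Longrightarrow> r \<le> \<tau> \<Longrightarrow> measure M {x0 + b<..x0 + r} \<le> A * r + d"
    and lower: "\<And>r. b < r \<Longrightarrow> r \<le> \<tau> \<Longrightarrow> A' * r \<le> measure M {x0 + b<..x0 + r} + d"
  shows "A' * ln (\<tau> / b) - d / b \<le> expectation (\<lambda>y. (inv_sqrt x0 b y)\<^sup>2)"
    and "expectation (\<lambda>y. (inv_sqrt x0 b y)\<^sup>2) \<le> A * ln (\<tau> / b) + d / b + 1 / \<tau>"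
proof -
  have bound: "\<bar>inv_sqrt x0 b y\<bar> \<le> 1 / sqrt b" for y
    using b by (auto simp: inv_sqrt_def intro!: divide_left_mono)
  have int: "integrable M (\<lambda>y. (inv_sqrt x0 b y)\<^sup>2)"
  proof (rule integrable_const_bound)
    show "AE y in M. norm ((inv_sqrt x0 b y)\<^sup>2) \<le> 1 / b"
      using power_mono[OF bound abs_ge_zero, where n=2] b by (auto simp: power_divide)
  qed simp
  let ?m = "\<lambda>r. measure M {x0 + b<..x0 + r}"
  have "ennreal (expectation (\<lambda>y. (inv_sqrt x0 b y)\<^sup>2)) = (\<integral>\<^sup>+y. ennreal ((inv_sqrt x0 b y)\<^sup>2) \<partial>M)"
    using int by (intro nn_integral_eq_integral[symmetric]) auto
  also have "\<dots> = (\<integral>\<^sup>+y\<in>{x0 + b<..}. ennreal (1 / (y - x0)) \<partial>M)"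
    using b by (intro nn_integral_cong) (auto simp: inv_sqrt_def power_divide split: split_indicator)
  also have "\<dots> = (\<integral>\<^sup>+r\<in>{b<..}. ennreal (1 / r\<^sup>2) * emeasure M {x0 + b<..x0 + r} \<partial>lborel)"
  proof (rule nn_integral_tail_layer_cake[OF b(1), of "\<lambda>r. 1 / r\<^sup>2" "\<lambda>w. 1 / w"])
    show "((\<lambda>w. 1 / w) has_real_derivative - (1 / r\<^sup>2)) (at r)" if "b \<le> r" for r
      using that b by (auto intro!: derivative_eq_intros simp: field_simps power2_eq_square)
    show "((\<lambda>w. 1 / w) \<longlongrightarrow> (0::real)) at_top"
      by (auto intro!: tendsto_divide_0[OF tendsto_const] filterlim_at_top_imp_at_infinity filterlim_ident)
  qed auto
  also have "\<dots> = (\<integral>\<^sup>+r. ennreal (?m r / r\<^sup>2) * indicator {b<..} r \<partial>lborel)"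
    using b by (intro nn_integral_cong) (auto split: split_indicator simp: emeasure_eq_measure ennreal_mult[symmetric])
  finally have eq: "ennreal (expectation (\<lambda>y. (inv_sqrt x0 b y)\<^sup>2)) = (\<integral>\<^sup>+r. ennreal (?m r / r\<^sup>2) * indicator {b<..} r \<partial>lborel)" .
  have [measurable]: "?m \<in> borel_measurable borel"
  proof -
    have "mono ?m" by (intro monoI finite_measure_mono) auto
    then show ?thesis by (rule borel_measurable_mono)
  qed
  have d_int: "(\<integral>\<^sup>+r. ennreal d * (ennreal (real 1 / r ^ Suc 1) * indicator {b<..} r) \<partial>lborel) = ennreal (d / b)"
    using nn_integral_inverse_power[OF b(1), of 1] A b
    by (subst nn_integral_cmult) (auto simp: ennreal_mult[symmetric])
  have E0: "0 \<le> expectation (\<lambda>y. (inv_sqrt x0 b y)\<^sup>2)" by simp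
  have "ennreal (expectation (\<lambda>y. (inv_sqrt x0 b y)\<^sup>2)) \<le> (\<integral>\<^sup>+r. (ennreal (A / r) * indicator {b<..\<tau>} r + ennreal d * (ennreal (real 1 / r ^ Suc 1) * indicator {b<..} r)) + ennreal (real 1 / r ^ Suc 1) * indicator {\<tau><..} r \<partial>lborel)"
    unfolding eq
  proof (rule nn_integral_mono)
    fix r
    consider "r \<le> b" | "b < r" "r \<le> \<tau>" | "\<tau> < r" by linarith
    then show "ennreal (?m r / r\<^sup>2) * indicator {b<..} r \<le> (ennreal (A / r) * indicator {b<..\<tau>} r + ennreal d * (ennreal (real 1 / r ^ Suc 1) * indicator {b<..} r)) + ennreal (real 1 / r ^ Suc 1) * indicator {\<tau><..} r"
    proof cases
      case 2
      have "?m r / r\<^sup>2 \<le> (A * r + d) / r\<^sup>2" using upper[OF 2] by (rule divide_right_mono) simp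
      also have "\<dots> = A / r + d * (1 / r\<^sup>2)" using 2 b by (simp add: field_simps power2_eq_square)
      finally have "ennreal (?m r / r\<^sup>2) \<le> ennreal (A / r + d * (1 / r\<^sup>2))" by (rule ennreal_leI)
      also have "\<dots> = ennreal (A / r) + ennreal d * ennreal (1 / r\<^sup>2)"
        using 2 b A by (intro ennreal_add_times) auto
      finally show ?thesis using 2 by (simp add: power2_eq_square)
    next
      case 3
      have "ennreal (?m r / r\<^sup>2) \<le> ennreal (1 / r\<^sup>2)" by (intro ennreal_leI divide_right_mono) auto
      also have "\<dots> \<le> ennreal d * ennreal (1 / r\<^sup>2) + ennreal (1 / r\<^sup>2)" by simp
      finally show ?thesis using 3 b by (simp add: power2_eq_square)
    qed auto
  qed
  also have "\<dots> = ennreal (A * ln (\<tau> / b)) + ennreal (d / b) + ennreal (1 / \<tau>)"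
    using b A nn_integral_inverse_power[of \<tau> 1]
    by (subst nn_integral_add, simp, simp, subst nn_integral_add, simp, simp, simp only: nn_integral_inverse d_int) simp
  also have "\<dots> = ennreal (A * ln (\<tau> / b) + d / b + 1 / \<tau>)"
    using b A by (simp add: ennreal_plus)
  finally show "expectation (\<lambda>y. (inv_sqrt x0 b y)\<^sup>2) \<le> A * ln (\<tau> / b) + d / b + 1 / \<tau>"
    using b A by (subst (asm) ennreal_le_iff) auto
  have "ennreal (A' * ln (\<tau> / b)) = (\<integral>\<^sup>+r\<in>{b<..\<tau>}. ennreal (A' / r) \<partial>lborel)"
    using b A by (intro nn_integral_inverse[symmetric])
  also have "\<dots> \<le> (\<integral>\<^sup>+r. ennreal (?m r / r\<^sup>2) * indicator {b<..} r + ennreal d * (ennreal (real 1 / r ^ Suc 1) * indicator {b<..} r) \<partial>lborel)"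
  proof (rule nn_integral_mono)
    fix r
    show "ennreal (A' / r) * indicator {b<..\<tau>} r \<le> ennreal (?m r / r\<^sup>2) * indicator {b<..} r + ennreal d * (ennreal (real 1 / r ^ Suc 1) * indicator {b<..} r)"
    proof (cases "b < r \<and> r \<le> \<tau>")
      case True
      have "A' / r = A' * r / r\<^sup>2" using True b by (simp add: power2_eq_square)
      also have "\<dots> \<le> (?m r + d) / r\<^sup>2" using lower True by (intro divide_right_mono) auto
      also have "\<dots> = ?m r / r\<^sup>2 + d * (1 / r\<^sup>2)" by (simp add: add_divide_distrib)
      finally have "ennreal (A' / r) \<le> ennreal (?m r / r\<^sup>2 + d * (1 / r\<^sup>2))" by (rule ennreal_leI)
      also have "\<dots> = ennreal (?m r / r\<^sup>2) + ennreal d * ennreal (1 / r\<^sup>2)"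
        using A by (intro ennreal_add_times) auto
      finally show ?thesis using True by (simp add: power2_eq_square)
    qed auto
  qed
  also have "\<dots> = ennreal (expectation (\<lambda>y. (inv_sqrt x0 b y)\<^sup>2)) + ennreal (d / b)"
    by (subst nn_integral_add, simp, simp, simp only: d_int eq)
  also have "\<dots> = ennreal (expectation (\<lambda>y. (inv_sqrt x0 b y)\<^sup>2) + d / b)"
    using E0 A b by (simp add: ennreal_plus)
  finally show "A' * ln (\<tau> / b) - d / b \<le> expectation (\<lambda>y. (inv_sqrt x0 b y)\<^sup>2)"
    using E0 A b by (subst (asm) ennreal_le_iff) auto
qed

section \<open>Drift and linear part of the local process\<close>

lemma eps_pos: "2 \<le> n \<Longrightarrow> 0 < eps n"
  by (simp add: eps_def)

lemma eps_nonneg: "0 \<le> eps n"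
  by (cases n) (simp_all add: eps_def)

lemma n_eps_sq: "1 \<le> n \<Longrightarrow> real n * (eps n)\<^sup>2 = ln (real n)"
  by (simp add: eps_def)

lemma eps_tendsto_0: "eps \<longlonglongrightarrow> 0"
  unfolding eps_def by real_asymp

lemma ln_at_top: "filterlim (\<lambda>n. ln (real n)) at_top sequentially"
  by real_asymp

lemma inv_sqrt_bound: "0 < b \<Longrightarrow> \<bar>inv_sqrt x0 b y\<bar> \<le> 1 / sqrt b"
  by (auto simp: inv_sqrt_def intro!: divide_left_mono)

text \<open>An array of samples whose laws \<open>\<mu> n\<close> approach \<open>\<nu>\<close> at the rate \<open>\<epsilon>\<^sub>n\<close>, together with the two expansions of \<open>U\<^sub>n\<close>
  around \<open>x0\<close>.\<close>

locale sqrt_log_array = prob_space M + limit: radial_density \<nu> r \<rho>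
  for M :: "'m measure" and \<nu> :: "real measure" and r \<rho> +
  fixes \<mu> :: "nat \<Rightarrow> real measure" and Y :: "nat \<Rightarrow> nat \<Rightarrow> 'm \<Rightarrow> real" and x0 V' :: real and Vhat :: "nat \<Rightarrow> real"
  assumes iid: "\<And>n. 1 \<le> n \<Longrightarrow> iid_sample M (\<mu> n) (Y n) n"
    and nonneg: "\<And>n. 1 \<le> n \<Longrightarrow> nonneg_real_distribution (\<mu> n)"
    and x0: "0 < x0" and g: "0 < g_dens \<rho> x0" and V'_neg: "V' < 0"
    and V_deriv: "(V_fun \<rho> has_real_derivative V') (at x0)"
    and cdf_close: "\<exists>C>0. \<forall>\<^sub>F n in sequentially. \<forall>t. \<bar>cdf (\<mu> n) t - cdf \<nu> t\<bar> \<le> C * eps n"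
    and local_expansion: "\<And>K. compact K \<Longrightarrow> uniform_limit K
      (\<lambda>n t. (U_n (\<mu> n) (x0 + eps n * t) - U_n (\<mu> n) x0 - Vhat n * eps n * t) / (eps n)\<^sup>2)
      (\<lambda>t. 1/2 * t\<^sup>2 * V') sequentially"
    and near_expansion: "\<And>e. 0 < e \<Longrightarrow> \<exists>(r :: real \<Rightarrow> real) C \<delta>. \<delta> > 0 \<and> r \<in> o[at 0](\<lambda>\<beta>. \<beta>\<^sup>2) \<and>
      (\<forall>\<^sub>F n in sequentially. \<forall>\<beta>. \<bar>\<beta>\<bar> < \<delta> \<longrightarrow>
        \<bar>U_n (\<mu> n) (x0 + \<beta>) - U_n (\<mu> n) x0 - \<beta> * Vhat n - 1/2 * \<beta>\<^sup>2 * V'\<bar> \<le> e * \<beta>\<^sup>2 + r \<beta> + C * (eps n)\<^sup>2)"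
begin

text \<open>The deterministic part of the process whose majorant is studied, centred by the line of slope
  \<open>Vhat n\<close>.\<close>

definition drift :: "nat \<Rightarrow> real \<Rightarrow> real" where
  "drift n \<beta> = U_n (\<mu> n) (x0 + \<beta>) - U_n (\<mu> n) x0 - Vhat n * \<beta>"

abbreviation E\<mu> :: "nat \<Rightarrow> (real \<Rightarrow> real) \<Rightarrow> real" where
  "E\<mu> n q \<equiv> integral\<^sup>L (\<mu> n) q"

lemma drift_local:
  assumes "0 < \<kappa>"
  shows "\<forall>\<^sub>F n in sequentially. \<forall>t. \<bar>t\<bar> \<le> K \<longrightarrow> \<bar>drift n (eps n * t) - 1/2 * (eps n * t)\<^sup>2 * V'\<bar> \<le> \<kappa> * (eps n)\<^sup>2"
proof -
  have "\<forall>\<^sub>F n in sequentially. \<forall>t\<in>{-K..K}. dist ((U_n (\<mu> n) (x0 + eps n * t) - U_n (\<mu> n) x0 - Vhat n * eps n * t) / (eps n)\<^sup>2) (1/2 * t\<^sup>2 * V') < \<kappa>"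
    using local_expansion[of "{-K..K}"] assms by (auto simp: uniform_limit_iff)
  then show ?thesis using eventually_ge_at_top[of 2]
  proof eventually_elim
    case (elim n)
    have e: "0 < eps n" using eps_pos elim by simp
    show ?case
    proof (intro allI impI)
      fix t assume "\<bar>t\<bar> \<le> K"
      then have "t \<in> {-K..K}" by auto
      with elim have "\<bar>drift n (eps n * t) / (eps n)\<^sup>2 - 1/2 * t\<^sup>2 * V'\<bar> < \<kappa>"
        by (auto simp: dist_real_def drift_def mult.assoc)
      also have "drift n (eps n * t) / (eps n)\<^sup>2 - 1/2 * t\<^sup>2 * V' = (drift n (eps n * t) - 1/2 * (eps n * t)\<^sup>2 * V') / (eps n)\<^sup>2"
        using e by (simp add: diff_divide_distrib power_mult_distrib)
      finally show "\<bar>drift n (eps n * t) - 1/2 * (eps n * t)\<^sup>2 * V'\<bar> \<le> \<kappa> * (eps n)\<^sup>2"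
        using e by (simp add: abs_div_pos[symmetric] abs_divide pos_divide_less_eq)
    qed
  qed
qed

text \<open>The local expansion improves the error \<open>O(\<epsilon>\<^sub>n\<^sup>2)\<close> of the expansion near \<open>x0\<close> to \<open>o(\<epsilon>\<^sub>n\<^sup>2)\<close>: it holds for
  \<open>\<bar>\<beta>\<bar> \<le> K \<epsilon>\<^sub>n\<close>, and for larger \<open>\<beta>\<close> the quadratic term absorbs the error.\<close>

lemma drift_le:
  obtains \<delta> where "0 < \<delta>" "\<delta> < x0"
    "\<And>\<kappa>. 0 < \<kappa> \<Longrightarrow> \<forall>\<^sub>F n in sequentially. \<forall>\<beta>. \<bar>\<beta>\<bar> \<le> \<delta> \<longrightarrow> drift n \<beta> \<le> V' / 8 * \<beta>\<^sup>2 + \<kappa> * (eps n)\<^sup>2"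
proof -
  define v where "v = - V'"
  have v: "0 < v" using V'_neg by (simp add: v_def)
  obtain rr :: "real \<Rightarrow> real" and C \<delta>0 where \<delta>0: "\<delta>0 > 0" and rr: "rr \<in> o[at 0](\<lambda>\<beta>. \<beta>\<^sup>2)"
    and near: "\<forall>\<^sub>F n in sequentially. \<forall>\<beta>. \<bar>\<beta>\<bar> < \<delta>0 \<longrightarrow>
        \<bar>U_n (\<mu> n) (x0 + \<beta>) - U_n (\<mu> n) x0 - \<beta> * Vhat n - 1/2 * \<beta>\<^sup>2 * V'\<bar> \<le> v / 8 * \<beta>\<^sup>2 + rr \<beta> + C * (eps n)\<^sup>2"
    using near_expansion[of "v / 8"] v by auto
  have "\<forall>\<^sub>F \<beta> in at 0. norm (rr \<beta>) \<le> v / 8 * norm (\<beta>\<^sup>2)"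
    using landau_o.smallD[OF rr, of "v / 8"] v by simp
  then obtain \<delta>1 where \<delta>1: "\<delta>1 > 0" "\<And>\<beta>. \<beta> \<noteq> 0 \<Longrightarrow> \<bar>\<beta>\<bar> < \<delta>1 \<Longrightarrow> \<bar>rr \<beta>\<bar> \<le> v / 8 * \<beta>\<^sup>2"
    unfolding eventually_at dist_real_def by auto
  define \<delta> where "\<delta> = min (min \<delta>0 \<delta>1) x0 / 2"
  have \<delta>: "0 < \<delta>" "\<delta> < x0" "\<delta> < \<delta>0" "\<delta> < \<delta>1" using \<delta>0 \<delta>1(1) x0 by (auto simp: \<delta>_def)
  \<comment> \<open>beyond \<open>K \<epsilon>\<^sub>n\<close> an eighth of the quadratic term pays for the error \<open>C (\<epsilon>\<^sub>n)\<^sup>2\<close>\<close>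
  define K where "K = sqrt (8 * \<bar>C\<bar> / v)"
  have K2: "v / 8 * K\<^sup>2 = \<bar>C\<bar>" using v by (simp add: K_def)
  have K0: "0 \<le> K" using v by (simp add: K_def)
  show ?thesis
  proof (rule that[OF \<delta>(1,2)])
    fix \<kappa> :: real assume \<kappa>: "0 < \<kappa>"
    show "\<forall>\<^sub>F n in sequentially. \<forall>\<beta>. \<bar>\<beta>\<bar> \<le> \<delta> \<longrightarrow> drift n \<beta> \<le> V' / 8 * \<beta>\<^sup>2 + \<kappa> * (eps n)\<^sup>2"
      using near drift_local[OF \<kappa>, of K] eventually_ge_at_top[of 2]
    proof eventually_elim
      case (elim n)
      have e: "0 < eps n" using eps_pos elim by simp
      show ?case
      proof (intro allI impI)
        fix \<beta> assume \<beta>: "\<bar>\<beta>\<bar> \<le> \<delta>"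
        show "drift n \<beta> \<le> V' / 8 * \<beta>\<^sup>2 + \<kappa> * (eps n)\<^sup>2"
        proof (cases "\<bar>\<beta>\<bar> \<le> K * eps n")
          case True
          then have "\<bar>\<beta> / eps n\<bar> \<le> K" using e by (simp add: pos_divide_le_eq)
          with elim(2) have "\<bar>drift n (eps n * (\<beta> / eps n)) - 1/2 * (eps n * (\<beta> / eps n))\<^sup>2 * V'\<bar> \<le> \<kappa> * (eps n)\<^sup>2"
            by blast
          then have "drift n \<beta> \<le> 1/2 * \<beta>\<^sup>2 * V' + \<kappa> * (eps n)\<^sup>2" using e by simp
          moreover have "1/2 * \<beta>\<^sup>2 * V' \<le> V' / 8 * \<beta>\<^sup>2"
            using mult_right_mono[of "1/2 * V'" "1/8 * V'" "\<beta>\<^sup>2"] V'_neg by (simp add: mult_ac)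
          ultimately show ?thesis by linarith
        next
          case False
          then have "\<beta> \<noteq> 0" using K0 e by (auto simp: mult_nonneg_nonneg)
          then have rr: "rr \<beta> \<le> v / 8 * \<beta>\<^sup>2" using \<delta>1(2)[of \<beta>] \<beta> \<delta> by (auto simp: abs_le_iff)
          have "\<bar>drift n \<beta> - 1/2 * \<beta>\<^sup>2 * V'\<bar> \<le> v / 8 * \<beta>\<^sup>2 + rr \<beta> + C * (eps n)\<^sup>2"
            using elim(1) \<beta> \<delta> by (simp add: drift_def mult.commute[of "Vhat n"])
          then have 1: "drift n \<beta> \<le> - (1/2 * v * \<beta>\<^sup>2) + v / 4 * \<beta>\<^sup>2 + C * (eps n)\<^sup>2"
            using rr by (simp add: v_def abs_le_iff mult_ac)
          have "(K * eps n)\<^sup>2 \<le> \<bar>\<beta>\<bar>\<^sup>2" using False K0 e by (intro power_mono) auto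
          then have "v / 8 * (K * eps n)\<^sup>2 \<le> v / 8 * \<beta>\<^sup>2" using v by (intro mult_left_mono) auto
          moreover have "v / 8 * (K * eps n)\<^sup>2 = \<bar>C\<bar> * (eps n)\<^sup>2" using K2 by (simp add: power_mult_distrib)
          moreover have "C * (eps n)\<^sup>2 \<le> \<bar>C\<bar> * (eps n)\<^sup>2" by (intro mult_right_mono) auto
          ultimately have "C * (eps n)\<^sup>2 \<le> v / 8 * \<beta>\<^sup>2" by linarith
          with 1 have "drift n \<beta> \<le> - (v / 8 * \<beta>\<^sup>2)" by (simp add: field_simps)
          moreover have "0 \<le> \<kappa> * (eps n)\<^sup>2" using \<kappa> by simp
          ultimately show ?thesis by (simp add: v_def)
        qed
      qed
    qed
  qed
qed

lemma U_n_le: "1 \<le> n \<Longrightarrow> 0 \<le> x \<Longrightarrow> 0 \<le> U_n (\<mu> n) x \<and> U_n (\<mu> n) x \<le> 2 * sqrt x"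
proof -
  assume n: "1 \<le> n" and x: "0 \<le> x"
  interpret \<mu>: nonneg_real_distribution "\<mu> n" by (rule nonneg[OF n])
  have ae: "AE u in \<mu> n. 0 \<le> psi x u" "AE u in \<mu> n. psi x u \<le> 2 * sqrt x"
    using \<mu>.AE_nonneg psi_bounds[OF x] by auto
  have "\<mu>.expectation (psi x) \<le> \<mu>.expectation (\<lambda>_. 2 * sqrt x)"
    using ae \<mu>.integrable_psi[OF x] by (intro integral_mono_AE) auto
  then show ?thesis unfolding \<mu>.U_n_eq_expectation[OF x]
    using integral_nonneg_AE[OF ae(1)] \<mu>.prob_space by simp
qed

text \<open>\<open>Vhat n\<close> is up to a bounded error the slope of a fixed chord of \<open>U\<^sub>n\<close>, and \<open>U\<^sub>n(x) \<le> 2 \<surd>x\<close>.\<close>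

lemma Vhat_bounded:
  obtains A where "0 < A" "\<forall>\<^sub>F n in sequentially. \<bar>Vhat n\<bar> \<le> A"
proof -
  obtain rr :: "real \<Rightarrow> real" and C \<delta> where \<delta>: "\<delta> > 0"
    and near: "\<forall>\<^sub>F n in sequentially. \<forall>\<beta>. \<bar>\<beta>\<bar> < \<delta> \<longrightarrow>
        \<bar>U_n (\<mu> n) (x0 + \<beta>) - U_n (\<mu> n) x0 - \<beta> * Vhat n - 1/2 * \<beta>\<^sup>2 * V'\<bar> \<le> 1 * \<beta>\<^sup>2 + rr \<beta> + C * (eps n)\<^sup>2"
    using near_expansion[of 1] by auto
  define b where "b = \<delta> / 2"
  have b: "0 < b" "b < \<delta>" using \<delta> by (auto simp: b_def)
  define Q where "Q = 2 * sqrt (x0 + b) + 2 * sqrt x0 + \<bar>1/2 * b\<^sup>2 * V'\<bar> + b\<^sup>2 + \<bar>rr b\<bar> + \<bar>C\<bar>"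
  have "\<forall>\<^sub>F n in sequentially. eps n < 1" using order_tendstoD(2)[OF eps_tendsto_0, of 1] by simp
  then have "\<forall>\<^sub>F n in sequentially. \<bar>Vhat n\<bar> \<le> Q / b"
    using near eventually_ge_at_top[of 2]
  proof eventually_elim
    case (elim n)
    have "(eps n)\<^sup>2 \<le> 1" using elim(1) eps_nonneg[of n] by (simp add: power_le_one)
    then have "C * (eps n)\<^sup>2 \<le> \<bar>C\<bar>" using mult_left_mono[of "(eps n)\<^sup>2" 1 "\<bar>C\<bar>"] mult_right_mono[OF abs_ge_self[of C], of "(eps n)\<^sup>2"] by simp
    moreover have "\<bar>U_n (\<mu> n) (x0 + b) - U_n (\<mu> n) x0 - b * Vhat n - 1/2 * b\<^sup>2 * V'\<bar> \<le> b\<^sup>2 + rr b + C * (eps n)\<^sup>2"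
      using elim(2) b by auto
    moreover have "\<bar>U_n (\<mu> n) (x0 + b)\<bar> \<le> 2 * sqrt (x0 + b)" "\<bar>U_n (\<mu> n) x0\<bar> \<le> 2 * sqrt x0"
      using U_n_le[of n "x0 + b"] U_n_le[of n x0] elim x0 b by auto
    ultimately have "\<bar>b * Vhat n\<bar> \<le> Q" unfolding Q_def by linarith
    then show ?case using b by (simp add: abs_mult pos_le_divide_eq mult.commute)
  qed
  moreover have "Q / b \<le> max (Q / b) 1" by simp
  ultimately have "\<forall>\<^sub>F n in sequentially. \<bar>Vhat n\<bar> \<le> max (Q / b) 1" by (auto elim: eventually_mono)
  then show ?thesis by (intro that[of "max (Q / b) 1"]) auto
qed

lemma interval_close:
  obtains C where "0 < C" "\<forall>\<^sub>F n in sequentially. \<forall>s t. s \<le> t \<longrightarrow> \<bar>measure (\<mu> n) {s<..t} - measure \<nu> {s<..t}\<bar> \<le> C * eps n"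
proof -
  obtain C where C: "0 < C" "\<forall>\<^sub>F n in sequentially. \<forall>t. \<bar>cdf (\<mu> n) t - cdf \<nu> t\<bar> \<le> C * eps n"
    using cdf_close by blast
  from C(2) eventually_ge_at_top[of 1]
  have "\<forall>\<^sub>F n in sequentially. \<forall>s t. s \<le> t \<longrightarrow> \<bar>measure (\<mu> n) {s<..t} - measure \<nu> {s<..t}\<bar> \<le> (2 * C) * eps n"
  proof eventually_elim
    case (elim n)
    interpret \<mu>: nonneg_real_distribution "\<mu> n" by (rule nonneg[OF elim(2)])
    show ?case
    proof (intro allI impI)
      fix s t :: real assume "s \<le> t"
      then have "measure (\<mu> n) {s<..t} = cdf (\<mu> n) t - cdf (\<mu> n) s" "measure \<nu> {s<..t} = cdf \<nu> t - cdf \<nu> s"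
        using \<mu>.cdf_diff_eq limit.cdf_diff_eq by (cases "s = t"; force)+
      moreover have "\<bar>cdf (\<mu> n) t - cdf \<nu> t\<bar> \<le> C * eps n" "\<bar>cdf (\<mu> n) s - cdf \<nu> s\<bar> \<le> C * eps n" using elim(1) by auto
      ultimately show "\<bar>measure (\<mu> n) {s<..t} - measure \<nu> {s<..t}\<bar> \<le> (2 * C) * eps n" by (simp add: abs_le_iff)
    qed
  qed
  then show ?thesis using C(1) by (intro that[of "2 * C"]) auto
qed

lemma mass_bound_eventually:
  obtains B where "0 < B" "\<forall>\<^sub>F n in sequentially. mass_bound (\<mu> n) x0 B (eps n)"
proof -
  obtain B where B: "0 < B" "\<And>h. 0 \<le> h \<Longrightarrow> measure \<nu> {x0 - h<..x0 + h} \<le> B * h"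
    using limit.mass_near_le[OF x0 g V_deriv] by blast
  obtain C where C: "0 < C" "\<forall>\<^sub>F n in sequentially. \<forall>s t. s \<le> t \<longrightarrow> \<bar>measure (\<mu> n) {s<..t} - measure \<nu> {s<..t}\<bar> \<le> C * eps n"
    by (rule interval_close)
  have "\<forall>\<^sub>F n in sequentially. mass_bound (\<mu> n) x0 (B + C) (eps n)"
    using C(2) eventually_ge_at_top[of 2]
  proof eventually_elim
    case (elim n)
    interpret \<mu>: nonneg_real_distribution "\<mu> n" by (rule nonneg) (use elim in simp)
    show ?case
    proof
      show "0 < eps n" using elim by (simp add: eps_pos)
      fix h :: real assume h: "0 \<le> h"
      have "measure (\<mu> n) {x0 - h<..x0 + h} \<le> measure \<nu> {x0 - h<..x0 + h} + C * eps n"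
        using elim(1)[rule_format, of "x0 - h" "x0 + h"] h by (simp add: abs_le_iff)
      also have "\<dots> \<le> B * h + C * eps n" using B(2)[OF h] by simp
      also have "\<dots> \<le> (B + C) * (h + eps n)" using B C h eps_nonneg[of n] by (simp add: algebra_simps)
      finally show "measure (\<mu> n) {x0 - h<..x0 + h} \<le> (B + C) * (h + eps n)" .
    qed (use B C in auto)
  qed
  then show ?thesis using B C by (intro that[of "B + C"]) auto
qed

text \<open>The cutoff is of order \<open>\<epsilon>\<^sub>n\<close>, and \<open>ln (1 / \<epsilon>\<^sub>n)\<close> is half of \<open>ln n\<close> in the limit: hence the factor one half in
  the limit variance. The error of \<open>\<mu> n\<close> on intervals is of order \<open>\<epsilon>\<^sub>n\<close>, the same as the cutoff, and contributes
  only a bounded amount.\<close>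

lemma inv_sqrt_variance_limit:
  assumes K: "0 < K"
  shows "(\<lambda>n. E\<mu> n (\<lambda>y. (inv_sqrt x0 (2 * (K * eps n)) y)\<^sup>2) / ln (real n)) \<longlonglongrightarrow> g_dens \<rho> x0 / 2"
proof (rule tendstoI)
  define g where "g = g_dens \<rho> x0"
  fix \<theta> :: real assume \<theta>: "0 < \<theta>"
  define \<eta> where "\<eta> = min \<theta> g / 2"
  have \<eta>: "0 < \<eta>" "\<eta> < g" "\<eta> \<le> \<theta> / 2" using \<theta> g by (auto simp: \<eta>_def g_def)
  have "\<forall>\<^sub>F h in at_right 0. dist (measure \<nu> {x0<..x0 + h} / h) g < \<eta>"
    using limit.right_mass_limit[OF x0 g] \<eta> by (auto simp: tendsto_iff g_def)
  then obtain \<tau>0 where \<tau>0: "0 < \<tau>0" "\<And>h. 0 < h \<Longrightarrow> h < \<tau>0 \<Longrightarrow> \<bar>measure \<nu> {x0<..x0 + h} / h - g\<bar> < \<eta>"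
    unfolding eventually_at_right_field dist_real_def by auto
  define \<tau> where "\<tau> = \<tau>0 / 2"
  have \<tau>: "0 < \<tau>" using \<tau>0 by (simp add: \<tau>_def)
  have \<nu>: "(g - \<eta>) * h \<le> measure \<nu> {x0<..x0 + h} \<and> measure \<nu> {x0<..x0 + h} \<le> (g + \<eta>) * h" if "0 < h" "h \<le> \<tau>" for h
  proof -
    have "\<bar>measure \<nu> {x0<..x0 + h} / h - g\<bar> < \<eta>" using \<tau>0 that by (auto simp: \<tau>_def)
    then have "g - \<eta> \<le> measure \<nu> {x0<..x0 + h} / h" "measure \<nu> {x0<..x0 + h} / h \<le> g + \<eta>" by (auto simp: abs_less_iff)
    then show ?thesis using that by (simp add: pos_le_divide_eq pos_divide_le_eq)
  qed
  obtain C where C: "0 < C" "\<forall>\<^sub>F n in sequentially. \<forall>s t. s \<le> t \<longrightarrow> \<bar>measure (\<mu> n) {s<..t} - measure \<nu> {s<..t}\<bar> \<le> C * eps n"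
    by (rule interval_close)
  define c where "c = (g + \<eta>) + C / (2 * K)"
  let ?L = "\<lambda>n. ln (\<tau> / (2 * (K * eps n)))"
  have lim: "(\<lambda>n. ?L n / ln (real n)) \<longlonglongrightarrow> 1 / 2"
    using K \<tau> unfolding eps_def by real_asymp
  have c0: "(\<lambda>n. c' / ln (real n)) \<longlonglongrightarrow> 0" for c' :: real by real_asymp
  have lo: "(\<lambda>n. (g - \<eta>) * (?L n / ln (real n)) - c / ln (real n)) \<longlonglongrightarrow> (g - \<eta>) * (1 / 2) - 0"
    by (intro tendsto_intros lim c0)
  have up: "(\<lambda>n. (g + \<eta>) * (?L n / ln (real n)) + (c + 1 / \<tau>) / ln (real n)) \<longlonglongrightarrow> (g + \<eta>) * (1 / 2) + 0"
    by (intro tendsto_intros lim c0)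
  have "\<forall>\<^sub>F n in sequentially. g / 2 - \<theta> < (g - \<eta>) * (?L n / ln (real n)) - c / ln (real n)"
    by (rule order_tendstoD(1)[OF lo]) (use \<eta> \<theta> in \<open>simp add: field_simps\<close>)
  moreover have "\<forall>\<^sub>F n in sequentially. (g + \<eta>) * (?L n / ln (real n)) + (c + 1 / \<tau>) / ln (real n) < g / 2 + \<theta>"
    by (rule order_tendstoD(2)[OF up]) (use \<eta> \<theta> in \<open>simp add: field_simps\<close>)
  moreover have "\<forall>\<^sub>F n in sequentially. 2 * (K * eps n) < \<tau>"
  proof -
    have lim0: "(\<lambda>n. 2 * (K * eps n)) \<longlonglongrightarrow> 2 * (K * 0)" by (intro tendsto_intros eps_tendsto_0)
    show ?thesis by (rule order_tendstoD(2)[OF lim0]) (use \<tau> in simp)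
  qed
  ultimately show "\<forall>\<^sub>F n in sequentially. dist (E\<mu> n (\<lambda>y. (inv_sqrt x0 (2 * (K * eps n)) y)\<^sup>2) / ln (real n)) (g_dens \<rho> x0 / 2) < \<theta>"
    using C(2) eventually_ge_at_top[of 2]
  proof eventually_elim
    case (elim n)
    interpret \<mu>: nonneg_real_distribution "\<mu> n" by (rule nonneg) (use elim in simp)
    define b where "b = 2 * (K * eps n)"
    have e: "0 < eps n" using elim by (simp add: eps_pos)
    have b: "0 < b" "b \<le> \<tau>" using e K elim by (auto simp: b_def)
    have lnn: "0 < ln (real n)" using elim by simp
    define d where "d = (g + \<eta>) * b + C * eps n"
    have d0: "0 \<le> d" using b C e \<eta> by (simp add: d_def)
    have db: "d / b = c" using b e K by (simp add: d_def c_def add_divide_distrib) (simp add: b_def)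
    have close: "\<bar>measure (\<mu> n) {s<..t} - measure \<nu> {s<..t}\<bar> \<le> C * eps n" if "s \<le> t" for s t using elim(4) that by blast
    have up: "measure (\<mu> n) {x0 + b<..x0 + r} \<le> (g + \<eta>) * r + d" if "b < r" "r \<le> \<tau>" for r
    proof -
      have "measure (\<mu> n) {x0 + b<..x0 + r} \<le> measure (\<mu> n) {x0<..x0 + r}"
        using b by (intro \<mu>.finite_measure_mono) auto
      also have "\<dots> \<le> (g + \<eta>) * r + C * eps n" using close[of x0 "x0 + r"] \<nu>[of r] that b by (simp add: abs_le_iff)
      also have "\<dots> \<le> (g + \<eta>) * r + d" using b \<eta> by (simp add: d_def)
      finally show ?thesis .
    qed
    have lo: "(g - \<eta>) * r \<le> measure (\<mu> n) {x0 + b<..x0 + r} + d" if "b < r" "r \<le> \<tau>" for r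
    proof -
      have "{x0<..x0 + r} = {x0<..x0 + b} \<union> {x0 + b<..x0 + r}" using that b by auto
      then have "measure \<nu> {x0<..x0 + r} \<le> measure \<nu> {x0<..x0 + b} + measure \<nu> {x0 + b<..x0 + r}"
        by (simp add: measure_Un_le)
      also have "\<dots> \<le> (g + \<eta>) * b + (measure (\<mu> n) {x0 + b<..x0 + r} + C * eps n)"
        using \<nu>[of b] close[of "x0 + b" "x0 + r"] that b by (simp add: abs_le_iff)
      finally show ?thesis using \<nu>[of r] that b by (simp add: d_def)
    qed
    have A: "0 \<le> g - \<eta>" "0 \<le> g + \<eta>" using \<eta> by auto
    let ?E = "E\<mu> n (\<lambda>y. (inv_sqrt x0 b y)\<^sup>2)"
    note bd = \<mu>.inv_sqrt_second_moment[OF b A d0 up lo, unfolded db]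
    have "(g - \<eta>) * (ln (\<tau> / b) / ln (real n)) - c / ln (real n) = ((g - \<eta>) * ln (\<tau> / b) - c) / ln (real n)"
      by (simp add: diff_divide_distrib)
    also have "\<dots> \<le> ?E / ln (real n)" using bd(1) lnn by (intro divide_right_mono) auto
    finally have 1: "g / 2 - \<theta> < ?E / ln (real n)" using elim(1) by (simp add: b_def)
    have "?E / ln (real n) \<le> ((g + \<eta>) * ln (\<tau> / b) + c + 1 / \<tau>) / ln (real n)" using bd(2) lnn by (intro divide_right_mono) auto
    also have "\<dots> = (g + \<eta>) * (ln (\<tau> / b) / ln (real n)) + (c + 1 / \<tau>) / ln (real n)"
      by (simp add: add_divide_distrib)
    finally have 2: "?E / ln (real n) < g / 2 + \<theta>" using elim(2) by (simp add: b_def)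
    show ?case using 1 2 unfolding b_def g_def dist_real_def by (simp add: abs_less_iff)
  qed
qed

lemma inv_sqrt_le_sqrt_step: "0 < b \<Longrightarrow> 0 \<le> inv_sqrt x0 b y \<and> inv_sqrt x0 b y \<le> 2 * sqrt_step x0 b y / b"
proof -
  assume b: "0 < b"
  show ?thesis
  proof (cases "b < y - x0")
    case True
    define w where "w = y - x0"
    have w: "0 < w" "b < w" using True b by (auto simp: w_def)
    have "(sqrt w - sqrt (w - b)) * (sqrt w + sqrt (w - b)) = b" using w by (simp add: algebra_simps)
    moreover have "(sqrt w - sqrt (w - b)) * (sqrt w + sqrt (w - b)) \<le> (sqrt w - sqrt (w - b)) * (2 * sqrt w)"
      using w b by (intro mult_left_mono) auto
    ultimately have "b / sqrt w \<le> 2 * (sqrt w - sqrt (w - b))" using w by (simp add: pos_divide_le_eq mult_ac)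
    then have "1 / sqrt w \<le> 2 * (sqrt w - sqrt (w - b)) / b" using b w by (simp add: field_simps)
    then show ?thesis using True w by (simp add: inv_sqrt_def sqrt_step_def w_def[symmetric] max_def)
  next
    case False
    have "0 \<le> sqrt_step x0 b y" using b by (simp add: sqrt_step_def)
    then show ?thesis using False b by (simp add: inv_sqrt_def)
  qed
qed

text \<open>The mean is at most a difference quotient of \<open>U\<^sub>n\<close> at \<open>x0\<close>, with a step of order \<open>\<epsilon>\<^sub>n\<close>; the local expansion
  bounds it by \<open>Vhat n\<close>.\<close>

lemma inv_sqrt_mean_bounded:
  assumes K: "0 < K"
  obtains A where "\<forall>\<^sub>F n in sequentially. \<bar>E\<mu> n (inv_sqrt x0 (2 * (K * eps n)))\<bar> \<le> A"
proof -
  obtain A where A: "0 < A" "\<forall>\<^sub>F n in sequentially. \<bar>Vhat n\<bar> \<le> A" by (rule Vhat_bounded)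
  have "\<forall>\<^sub>F n in sequentially. eps n < 1" using order_tendstoD(2)[OF eps_tendsto_0, of 1] by simp
  then have "\<forall>\<^sub>F n in sequentially. \<bar>E\<mu> n (inv_sqrt x0 (2 * (K * eps n)))\<bar> \<le> A + 1 / (2 * K)"
    using A(2) drift_local[OF zero_less_one, of "2 * K"] eventually_ge_at_top[of 2]
  proof eventually_elim
    case (elim n)
    interpret \<mu>: nonneg_real_distribution "\<mu> n" by (rule nonneg) (use elim in simp)
    define b where "b = eps n * (2 * K)"
    have e: "0 < eps n" using elim by (simp add: eps_pos)
    have b: "0 < b" using e K by (simp add: b_def)
    have int: "integrable (\<mu> n) (\<lambda>y. (psi (x0 + b) y - psi x0 y) / b)"
      using \<mu>.integrable_psi[of x0] \<mu>.integrable_psi[of "x0 + b"] x0 b by simp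
    have le: "0 \<le> inv_sqrt x0 b y" "inv_sqrt x0 b y \<le> (psi (x0 + b) y - psi x0 y) / b" for y
      using inv_sqrt_le_sqrt_step[OF b, of y] by (simp_all add: psi_diff)
    have "integrable (\<mu> n) (inv_sqrt x0 b)"
      by (rule \<mu>.integrable_const_bound[where B="1 / sqrt b"]) (use inv_sqrt_bound[OF b] in auto)
    then have "E\<mu> n (inv_sqrt x0 b) \<le> \<mu>.expectation (\<lambda>y. (psi (x0 + b) y - psi x0 y) / b)"
      using int le by (intro integral_mono) auto
    also have "\<dots> = (U_n (\<mu> n) (x0 + b) - U_n (\<mu> n) x0) / b"
      using \<mu>.integrable_psi[of x0] \<mu>.integrable_psi[of "x0 + b"] x0 b
      by (simp add: \<mu>.U_n_eq_expectation)
    also have "\<dots> = Vhat n + drift n b / b" using b by (simp add: drift_def field_simps)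
    also have "drift n b / b \<le> 1 / (2 * K)"
    proof -
      have "\<bar>drift n b - 1/2 * b\<^sup>2 * V'\<bar> \<le> 1 * (eps n)\<^sup>2" using elim(3) K unfolding b_def by auto
      moreover have "1/2 * b\<^sup>2 * V' \<le> 0" using V'_neg by (simp add: mult_nonneg_nonpos)
      ultimately have "drift n b \<le> (eps n)\<^sup>2" by linarith
      then have "drift n b / b \<le> (eps n)\<^sup>2 / b" using b by (intro divide_right_mono) auto
      also have "\<dots> = eps n / (2 * K)" using e K by (simp add: b_def power2_eq_square)
      also have "\<dots> \<le> 1 / (2 * K)" using elim(1) K by (intro divide_right_mono) auto
      finally show ?thesis .
    qed
    finally have "E\<mu> n (inv_sqrt x0 b) \<le> A + 1 / (2 * K)" using elim(2) by (simp add: abs_le_iff)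
    moreover have "0 \<le> E\<mu> n (inv_sqrt x0 b)" using le by (intro Bochner_Integration.integral_nonneg_AE) auto
    ultimately show ?case by (simp add: b_def mult_ac)
  qed
  then show ?thesis by (rule that)
qed

text \<open>The coefficient of the linear part of the fluctuations around \<open>x0\<close>, in units of \<open>\<epsilon>\<^sub>n\<close>. The cutoff
  \<open>2 K \<epsilon>\<^sub>n\<close> makes the remainder small on the window \<open>\<bar>\<beta>\<bar> \<le> K \<epsilon>\<^sub>n\<close>.\<close>

definition linear_coeff :: "real \<Rightarrow> nat \<Rightarrow> 'm \<Rightarrow> real" where
  "linear_coeff K n \<omega> = (sample_mean (Y n) n (inv_sqrt x0 (2 * (K * eps n))) \<omega> - E\<mu> n (inv_sqrt x0 (2 * (K * eps n)))) / eps n"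

lemma linear_coeff_limit:
  assumes K: "0 < K"
  shows "weak_conv_m (\<lambda>n. distr M borel (linear_coeff K n)) (density lborel (normal_density 0 (sqrt (g_dens \<rho> x0 / 2))))"
  unfolding linear_coeff_def
proof (rule triangular_central_limit_theorem[where b="\<lambda>n. 1 / sqrt (2 * (K * eps n))"])
  show "iid_sample M (\<mu> n) (Y n) n" if "1 \<le> n" for n by (rule iid[OF that])
  show "\<bar>inv_sqrt x0 (2 * (K * eps n)) y\<bar> \<le> 1 / sqrt (2 * (K * eps n))" if "2 \<le> n" for n y
    using eps_pos[OF that] K by (intro inv_sqrt_bound) simp
  show "0 < sqrt (g_dens \<rho> x0 / 2)" using g by simp
  show "0 < eps n" if "2 \<le> n" for n using that by (rule eps_pos)
  show "(\<lambda>n. 1 / sqrt (2 * (K * eps n)) / (real n * eps n)) \<longlonglongrightarrow> 0"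
    using K unfolding eps_def by real_asymp
  obtain A where A: "\<forall>\<^sub>F n in sequentially. \<bar>E\<mu> n (inv_sqrt x0 (2 * (K * eps n)))\<bar> \<le> A"
    by (rule inv_sqrt_mean_bounded[OF K])
  have "(\<lambda>n. (E\<mu> n (inv_sqrt x0 (2 * (K * eps n))))\<^sup>2 / ln (real n)) \<longlonglongrightarrow> 0"
  proof (rule Lim_null_comparison)
    show "\<forall>\<^sub>F n in sequentially. norm ((E\<mu> n (inv_sqrt x0 (2 * (K * eps n))))\<^sup>2 / ln (real n)) \<le> A\<^sup>2 / ln (real n)"
      using A eventually_ge_at_top[of 2]
    proof eventually_elim
      case (elim n)
      then show ?case using power_mono[OF elim(1) abs_ge_zero, where n=2] by (simp add: divide_right_mono)
    qed
    show "(\<lambda>n. A\<^sup>2 / ln (real n)) \<longlonglongrightarrow> 0" by real_asymp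
  qed
  from tendsto_diff[OF inv_sqrt_variance_limit[OF K] this]
  have "(\<lambda>n. (E\<mu> n (\<lambda>y. (inv_sqrt x0 (2 * (K * eps n)) y)\<^sup>2) - (E\<mu> n (inv_sqrt x0 (2 * (K * eps n))))\<^sup>2) / ln (real n)) \<longlonglongrightarrow> (sqrt (g_dens \<rho> x0 / 2))\<^sup>2"
    using g by (simp add: diff_divide_distrib)
  then show "(\<lambda>n. (E\<mu> n (\<lambda>y. (inv_sqrt x0 (2 * (K * eps n)) y)\<^sup>2) - (E\<mu> n (inv_sqrt x0 (2 * (K * eps n))))\<^sup>2) / (real n * (eps n)\<^sup>2)) \<longlonglongrightarrow> (sqrt (g_dens \<rho> x0 / 2))\<^sup>2"
    by (rule Lim_transform_eventually) (use eventually_ge_at_top[of 1] in \<open>eventually_elim, simp add: n_eps_sq\<close>)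
qed simp_all

end

section \<open>The nonlinear part of the local process\<close>

context sqrt_log_array
begin

definition remainder_dev :: "real \<Rightarrow> nat \<Rightarrow> real \<Rightarrow> 'm \<Rightarrow> real" where
  "remainder_dev K n \<beta> \<omega> = sample_mean (Y n) n (remainder x0 (2 * (K * eps n)) \<beta>) \<omega> - E\<mu> n (remainder x0 (2 * (K * eps n)) \<beta>)"

lemma remainder_dev_measurable: "1 \<le> n \<Longrightarrow> remainder_dev K n \<beta> \<in> borel_measurable M"
proof -
  assume "1 \<le> n"
  then interpret iid_sample M "\<mu> n" "Y n" n by (rule iid)
  show ?thesis unfolding remainder_dev_def[abs_def] by simp
qed

lemma linear_coeff_measurable: "1 \<le> n \<Longrightarrow> linear_coeff K n \<in> borel_measurable M"
proof -
  assume "1 \<le> n"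
  then interpret iid_sample M "\<mu> n" "Y n" n by (rule iid)
  show ?thesis unfolding linear_coeff_def[abs_def] by simp
qed

lemma U_sharp_eq_sample_mean: "U_sharp n (\<lambda>i. Y n i \<omega>) x = sample_mean (Y n) n (psi x) \<omega>"
  unfolding U_sharp_def sample_mean_def psi_def sum_distrib_left[symmetric] by simp

text \<open>The decomposition is exact: the cut-off linear part of the fluctuations is added and subtracted.\<close>

lemma U_sharp_increment:
  assumes n: "2 \<le> n" and \<beta>: "0 \<le> x0 + \<beta>" and K: "0 < K"
  shows "U_sharp n (\<lambda>i. Y n i \<omega>) (x0 + \<beta>) - U_sharp n (\<lambda>i. Y n i \<omega>) x0
    = (U_n (\<mu> n) (x0 + \<beta>) - U_n (\<mu> n) x0) + remainder_dev K n \<beta> \<omega> + \<beta> * (eps n * linear_coeff K n \<omega>)"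
proof -
  interpret iid_sample M "\<mu> n" "Y n" n using n by (intro iid) simp
  interpret \<mu>: nonneg_real_distribution "\<mu> n" using n by (intro nonneg) simp
  let ?a = "2 * (K * eps n)"
  have e: "0 < eps n" using n by (rule eps_pos)
  have a: "0 < ?a" using e K by simp
  have dec: "psi (x0 + \<beta>) y - psi x0 y = remainder x0 ?a \<beta> y + \<beta> * inv_sqrt x0 ?a y" for y
    by (simp add: psi_diff remainder_def)
  have ixi: "integrable (\<mu> n) (inv_sqrt x0 ?a)" using inv_sqrt_bound[OF a] by (intro integrable_bounded) auto
  have ipsi: "integrable (\<mu> n) (psi (x0 + \<beta>))" "integrable (\<mu> n) (psi x0)"
    using \<beta> x0 by (auto intro: \<mu>.integrable_psi)
  have rem_eq: "remainder x0 ?a \<beta> = (\<lambda>y. psi (x0 + \<beta>) y - psi x0 y - \<beta> * inv_sqrt x0 ?a y)"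
    by (simp add: dec fun_eq_iff)
  have irem: "integrable (\<mu> n) (remainder x0 ?a \<beta>)"
    unfolding rem_eq using ixi ipsi by simp
  have "U_sharp n (\<lambda>i. Y n i \<omega>) (x0 + \<beta>) - U_sharp n (\<lambda>i. Y n i \<omega>) x0 = avg (\<lambda>y. remainder x0 ?a \<beta> y + \<beta> * inv_sqrt x0 ?a y) \<omega>"
    unfolding U_sharp_eq_sample_mean avg_diff[symmetric] dec ..
  also have "\<dots> = avg (remainder x0 ?a \<beta>) \<omega> + \<beta> * avg (inv_sqrt x0 ?a) \<omega>"
    by (simp add: sample_mean_def sum.distrib sum_distrib_left add_divide_distrib)
  finally have 1: "U_sharp n (\<lambda>i. Y n i \<omega>) (x0 + \<beta>) - U_sharp n (\<lambda>i. Y n i \<omega>) x0 = avg (remainder x0 ?a \<beta>) \<omega> + \<beta> * avg (inv_sqrt x0 ?a) \<omega>" .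
  have "U_n (\<mu> n) (x0 + \<beta>) - U_n (\<mu> n) x0 = E\<mu> n (\<lambda>y. psi (x0 + \<beta>) y - psi x0 y)"
    using ipsi \<beta> x0 by (simp add: \<mu>.U_n_eq_expectation)
  also have "\<dots> = E\<mu> n (remainder x0 ?a \<beta>) + \<beta> * E\<mu> n (inv_sqrt x0 ?a)"
    unfolding dec using irem ixi by simp
  finally have 2: "U_n (\<mu> n) (x0 + \<beta>) - U_n (\<mu> n) x0 = E\<mu> n (remainder x0 ?a \<beta>) + \<beta> * E\<mu> n (inv_sqrt x0 ?a)" .
  have 3: "eps n * linear_coeff K n \<omega> = avg (inv_sqrt x0 ?a) \<omega> - E\<mu> n (inv_sqrt x0 ?a)" using e by (simp add: linear_coeff_def)
  show ?thesis unfolding 1 2 3 remainder_dev_def by (simp add: right_diff_distrib)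
qed

lemma remainder_dev_chebyshev:
  assumes mb: "mass_bound (\<mu> n) x0 B (eps n)" and n: "2 \<le> n" and K: "1 \<le> K"
    and \<beta>: "\<bar>\<beta>\<bar> \<le> K * eps n" and \<kappa>: "0 < \<kappa>"
  shows "prob {\<omega> \<in> space M. \<kappa> * (eps n)\<^sup>2 \<le> \<bar>remainder_dev K n \<beta> \<omega>\<bar>} \<le> 20 * B * K\<^sup>2 / \<kappa>\<^sup>2 * (1 / ln (real n))"
proof -
  interpret iid_sample M "\<mu> n" "Y n" n using n by (intro iid) simp
  interpret mb: mass_bound "\<mu> n" x0 B "eps n" by (rule mb)
  have e: "0 < eps n" using n by (rule eps_pos)
  let ?q = "remainder x0 (2 * (K * eps n)) \<beta>"
  have em: "eps n \<le> K * eps n" using K e by simp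
  note bd = mb.remainder_local_bounds[OF em \<beta>, of 0, simplified]
  have bd1: "\<bar>?q y\<bar> \<le> 2 * sqrt \<bar>\<beta>\<bar>" for y using bd(1) K e by simp
  have bd2: "E\<mu> n (\<lambda>y. (?q y)\<^sup>2) \<le> 20 * B * (K * eps n) * \<bar>\<beta>\<bar>" using bd(2) K e by simp
  have i2: "integrable (\<mu> n) (\<lambda>y. (?q y)\<^sup>2)"
    using power_mono[OF bd1 abs_ge_zero, where n=2] by (intro integrable_bounded[where b="(2 * sqrt \<bar>\<beta>\<bar>)\<^sup>2"]) auto
  have "prob {\<omega> \<in> space M. \<kappa> * (eps n)\<^sup>2 \<le> \<bar>remainder_dev K n \<beta> \<omega>\<bar>} \<le> E\<mu> n (\<lambda>y. (?q y)\<^sup>2) / (real n * (\<kappa> * (eps n)\<^sup>2)\<^sup>2)"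
    unfolding remainder_dev_def using e \<kappa> by (intro chebyshev_avg i2) auto
  also have "\<dots> \<le> (20 * B * (K * eps n) * (K * eps n)) / (real n * (\<kappa> * (eps n)\<^sup>2)\<^sup>2)"
  proof (rule divide_right_mono)
    have "20 * B * (K * eps n) * \<bar>\<beta>\<bar> \<le> 20 * B * (K * eps n) * (K * eps n)"
      using \<beta> K e mb.B by (intro mult_left_mono) auto
    then show "E\<mu> n (\<lambda>y. (?q y)\<^sup>2) \<le> 20 * B * (K * eps n) * (K * eps n)" using bd2 by linarith
  qed simp
  also have "\<dots> = 20 * B * K\<^sup>2 / \<kappa>\<^sup>2 * (1 / (real n * (eps n)\<^sup>2))"
    using e \<kappa> n by (simp add: power2_eq_square mult_ac)
  also have "real n * (eps n)\<^sup>2 = ln (real n)" using n by (simp add: n_eps_sq)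
  finally show ?thesis .
qed

text \<open>Taking \<open>3 / \<kappa>\<close> for the free exponent and a mesh ratio \<open>s\<close> small compared with \<open>\<kappa>\<^sup>2\<close> makes the failure
  probability as small as \<open>1 / n\<^sup>2\<close>, because \<open>n (\<epsilon>\<^sub>n)\<^sup>2 = ln n\<close>. That is enough for a union over \<open>O(n)\<close> points.\<close>

lemma remainder_dev_increment_bernstein:
  assumes mb: "mass_bound (\<mu> n) x0 B (eps n)" and n: "2 \<le> n" and K: "1 \<le> K"
    and \<beta>: "\<bar>\<beta>\<bar> \<le> K * eps n" and \<gamma>: "\<bar>\<gamma>\<bar> \<le> K * eps n" and \<kappa>: "0 < \<kappa>" and s: "\<bar>\<beta> - \<gamma>\<bar> \<le> s * eps n"
    and s_small: "180 * B * K * s \<le> \<kappa>\<^sup>2" and small: "3 / \<kappa> * (2 * sqrt (s * eps n)) \<le> 1"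
  shows "prob {\<omega> \<in> space M. \<kappa> * (eps n)\<^sup>2 \<le> remainder_dev K n \<beta> \<omega> - remainder_dev K n \<gamma> \<omega>} \<le> 1 / (real n)\<^sup>2"
proof -
  interpret iid_sample M "\<mu> n" "Y n" n using n by (intro iid) simp
  interpret mb: mass_bound "\<mu> n" x0 B "eps n" by (rule mb)
  have e: "0 < eps n" using n by (rule eps_pos)
  let ?q = "\<lambda>\<beta>. remainder x0 (2 * (K * eps n)) \<beta>"
  have em: "eps n \<le> K * eps n" using K e by simp
  have z: "\<bar>0\<bar> \<le> K * eps n" using K e by simp
  have int: "integrable (\<mu> n) (?q \<delta>)" if "\<bar>\<delta>\<bar> \<le> K * eps n" for \<delta>
    using mb.remainder_local_bounds(1)[OF em that z] by (intro integrable_bounded) auto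
  let ?D = "\<lambda>y. ?q \<beta> y - ?q \<gamma> y"
  have sq: "sqrt \<bar>\<beta> - \<gamma>\<bar> \<le> sqrt (s * eps n)" using s by simp
  have b: "\<bar>?D y\<bar> \<le> 2 * sqrt (s * eps n)" for y
    using mb.remainder_local_bounds(1)[OF em \<beta> \<gamma>, of y] sq by linarith
  have v: "E\<mu> n (\<lambda>y. (?D y)\<^sup>2) \<le> 20 * B * (K * eps n) * (s * eps n)"
  proof -
    have "20 * B * (K * eps n) * \<bar>\<beta> - \<gamma>\<bar> \<le> 20 * B * (K * eps n) * (s * eps n)"
      using s K e mb.B by (intro mult_left_mono) auto
    then show ?thesis using mb.remainder_local_bounds(2)[OF em \<beta> \<gamma>] by linarith
  qed
  have "remainder_dev K n \<beta> \<omega> - remainder_dev K n \<gamma> \<omega> = avg ?D \<omega> - E\<mu> n ?D" for \<omega>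
    using int[OF \<beta>] int[OF \<gamma>] by (simp add: remainder_dev_def avg_diff)
  then have "prob {\<omega> \<in> space M. \<kappa> * (eps n)\<^sup>2 \<le> remainder_dev K n \<beta> \<omega> - remainder_dev K n \<gamma> \<omega>} \<le> exp (real n * (- (3 / \<kappa>) * (\<kappa> * (eps n)\<^sup>2) + (3 / \<kappa>)\<^sup>2 * (20 * B * (K * eps n) * (s * eps n))))"
    using bernstein_avg[OF _ b v _ small, of "\<kappa> * (eps n)\<^sup>2"] \<kappa> by simp
  also have "real n * (- (3 / \<kappa>) * (\<kappa> * (eps n)\<^sup>2) + (3 / \<kappa>)\<^sup>2 * (20 * B * (K * eps n) * (s * eps n)))
     = (real n * (eps n)\<^sup>2) * (- 3 + 180 * B * K * s / \<kappa>\<^sup>2)"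
    using \<kappa> by (simp add: algebra_simps power2_eq_square)
  also have "\<dots> = ln (real n) * (- 3 + 180 * B * K * s / \<kappa>\<^sup>2)" using n by (simp add: n_eps_sq)
  also have "\<dots> \<le> ln (real n) * (- 2)"
    using s_small \<kappa> n by (intro mult_left_mono) (auto simp: pos_divide_le_eq)
  also have "exp (ln (real n) * (- 2)) = 1 / (real n)\<^sup>2"
    using n exp_of_nat_mult[of 2 "ln (real n)"] by (simp add: exp_minus mult.commute inverse_eq_divide)
  finally show ?thesis by simp
qed

text \<open>The exponent \<open>c1 K \<epsilon>\<^sub>n / \<bar>\<beta>\<bar>\<close> balances the two terms of Bernstein's inequality; \<open>62 B\<close> is twice the
  constant of the second moment bound. For \<open>\<bar>\<beta>\<bar> \<ge> K \<epsilon>\<^sub>n\<close> the resulting bound decreases with \<open>K\<close> as a power of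
  \<open>n\<close> of order \<open>- K\<^sup>2\<close>.\<close>

lemma far_remainder_bernstein:
  assumes mb: "mass_bound (\<mu> n) x0 B (eps n)" and n: "2 \<le> n" and K: "1 \<le> K" and B: "0 < B"
    and \<beta>: "K * eps n \<le> \<bar>\<beta>\<bar>" and c: "0 < c" and c1: "c1 = c / (62 * B)" and large: "4 \<le> K\<^sup>2 * c1 * c"
    and small: "3 * c1 * sqrt (K * eps n) \<le> 1"
  shows "prob {\<omega> \<in> space M. c * \<beta>\<^sup>2 \<le> remainder_dev K n \<beta> \<omega>} \<le> 1 / (real n)\<^sup>2"
proof -
  interpret iid_sample M "\<mu> n" "Y n" n using n by (intro iid) simp
  interpret mb: mass_bound "\<mu> n" x0 B "eps n" by (rule mb)
  have e: "0 < eps n" using n by (rule eps_pos)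
  define m b where "m = K * eps n" and "b = \<bar>\<beta>\<bar>"
  have em: "eps n \<le> m" using K e by (simp add: m_def)
  have m0: "0 < m" "m \<le> b" using em e \<beta> by (auto simp: m_def b_def)
  have c1p: "0 < c1" using c1 c B by simp
  let ?q = "remainder x0 (2 * (K * eps n)) \<beta>"
  note bd = mb.remainder_far_bounds[OF em, of \<beta>, unfolded m_def[symmetric]]
  have bd1: "\<bar>?q y\<bar> \<le> 3 * b / sqrt m" for y using bd(1)[of y] m0 by (simp add: m_def b_def)
  have bd2: "E\<mu> n (\<lambda>y. (?q y)\<^sup>2) \<le> 31 * B * b ^ 3 / m" using bd(2) m0 by (simp add: m_def b_def)
  have lb: "c1 * m / b * (3 * b / sqrt m) \<le> 1"
  proof -
    have "c1 * m / b * (3 * b / sqrt m) = 3 * c1 * (m / sqrt m)" using m0 by simp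
    also have "m / sqrt m = sqrt m" using m0 by (simp add: real_div_sqrt)
    finally show ?thesis using small by (simp add: m_def)
  qed
  have "prob {\<omega> \<in> space M. c * \<beta>\<^sup>2 \<le> remainder_dev K n \<beta> \<omega>} \<le> exp (real n * (- (c1 * m / b) * (c * b\<^sup>2) + (c1 * m / b)\<^sup>2 * (31 * B * b ^ 3 / m)))"
    using bernstein_avg[OF _ bd1 bd2 _ lb, of "c * b\<^sup>2"] c1p m0 by (simp add: remainder_dev_def b_def)
  also have "- (c1 * m / b) * (c * b\<^sup>2) + (c1 * m / b)\<^sup>2 * (31 * B * b ^ 3 / m) = - (c1 * m * b * (c - 31 * B * c1))"
    using m0 by (simp add: power2_eq_square power3_eq_cube field_simps)
  also have "c - 31 * B * c1 = c / 2" using B by (simp add: c1 field_simps)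
  also have "real n * - (c1 * m * b * (c / 2)) \<le> ln (real n) * (- 2)"
  proof -
    have "4 * ln (real n) \<le> (K\<^sup>2 * c1 * c) * ln (real n)" using large n by (intro mult_right_mono) auto
    also have "\<dots> = real n * (c1 * m * m * c)"
      using n by (simp add: m_def power2_eq_square n_eps_sq[symmetric, unfolded power2_eq_square])
    also have "\<dots> \<le> real n * (c1 * m * b * c)"
      using m0 c1p c by (intro mult_left_mono mult_right_mono) auto
    finally show ?thesis by simp
  qed
  also have "exp (ln (real n) * (- 2)) = 1 / (real n)\<^sup>2"
    using n exp_of_nat_mult[of 2 "ln (real n)"] by (simp add: exp_minus mult.commute inverse_eq_divide)
  finally show ?thesis by simp
qed

text \<open>The mesh \<open>1 / n\<close> is of smaller order than \<open>(\<epsilon>\<^sub>n)\<^sup>2 = ln n / n\<close>, so that the increments of a line across a cell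
  are negligible.\<close>

definition grid :: "real \<Rightarrow> nat \<Rightarrow> real set" where
  "grid \<delta> n = (\<lambda>j. of_int j / real n) ` {- \<lfloor>\<delta> * real n\<rfloor>..\<lfloor>\<delta> * real n\<rfloor>}"

lemma finite_grid: "finite (grid \<delta> n)"
  by (simp add: grid_def)

lemma card_grid: "0 \<le> \<delta> \<Longrightarrow> 1 \<le> n \<Longrightarrow> real (card (grid \<delta> n)) \<le> (2 * \<delta> + 1) * real n"
proof -
  assume \<delta>: "0 \<le> \<delta>" and n: "1 \<le> n"
  have "card (grid \<delta> n) \<le> card {- \<lfloor>\<delta> * real n\<rfloor>..\<lfloor>\<delta> * real n\<rfloor>}"
    unfolding grid_def by (rule card_image_le) simp
  also have "\<dots> = nat (2 * \<lfloor>\<delta> * real n\<rfloor> + 1)" by simp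
  finally have "real (card (grid \<delta> n)) \<le> real (nat (2 * \<lfloor>\<delta> * real n\<rfloor> + 1))" by simp
  also have "\<dots> = 2 * real_of_int \<lfloor>\<delta> * real n\<rfloor> + 1" using \<delta> by (simp add: of_nat_nat)
  also have "\<dots> \<le> 2 * (\<delta> * real n) + real n" using n of_int_floor_le[of "\<delta> * real n"] by linarith
  finally show ?thesis by (simp add: algebra_simps)
qed

lemma union_bound:
  assumes "finite I" "\<And>i. i \<in> I \<Longrightarrow> A i \<in> events" "\<And>i. i \<in> I \<Longrightarrow> prob (A i) \<le> p"
  shows "prob (\<Union>i\<in>I. A i) \<le> real (card I) * p"
proof -
  have "prob (\<Union>i\<in>I. A i) \<le> (\<Sum>i\<in>I. prob (A i))"
    using assms by (intro finite_measure_subadditive_finite) auto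
  also have "\<dots> \<le> (\<Sum>i\<in>I. p)" using assms(3) by (rule sum_mono)
  finally show ?thesis by simp
qed

lemma grid_union_bound:
  assumes \<delta>: "0 \<le> \<delta>" and n: "1 \<le> n" and I: "I \<subseteq> grid \<delta> n"
    and "\<And>\<beta>. \<beta> \<in> I \<Longrightarrow> A \<beta> \<in> events" "\<And>\<beta>. \<beta> \<in> I \<Longrightarrow> prob (A \<beta>) \<le> 1 / (real n)\<^sup>2"
  shows "prob (\<Union>\<beta>\<in>I. A \<beta>) \<le> (2 * \<delta> + 1) / real n"
proof -
  have "prob (\<Union>\<beta>\<in>I. A \<beta>) \<le> real (card I) * (1 / (real n)\<^sup>2)"
    using assms(4,5) finite_subset[OF I finite_grid] by (intro union_bound) auto
  also have "\<dots> \<le> ((2 * \<delta> + 1) * real n) * (1 / (real n)\<^sup>2)"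
    using card_grid[OF \<delta> n] card_mono[OF finite_grid I] by (intro mult_right_mono) auto
  also have "\<dots> = (2 * \<delta> + 1) / real n" using n by (simp add: power2_eq_square)
  finally show ?thesis .
qed

text \<open>Two scales replace chaining. On the finitely many coarse points \<open>k K \<epsilon>\<^sub>n / N\<close> Chebyshev's inequality
  suffices, because the remainder has variance of order \<open>(\<epsilon>\<^sub>n)\<^sup>4 / ln n\<close>; from a coarse point to
  the fine ones near it Bernstein's inequality gains a power of \<open>n\<close>, as large as desired if \<open>N\<close> is large.\<close>

lemma remainder_dev_local:
  assumes K: "1 \<le> K" and \<kappa>: "0 < \<kappa>" and \<delta>: "0 \<le> \<delta>"
  shows "whp (\<lambda>n \<omega>. \<forall>\<beta>\<in>grid \<delta> n. \<bar>\<beta>\<bar> \<le> K * eps n \<longrightarrow> remainder_dev K n \<beta> \<omega> \<le> 2 * \<kappa> * (eps n)\<^sup>2)"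
proof -
  obtain B where B: "0 < B" "\<forall>\<^sub>F n in sequentially. mass_bound (\<mu> n) x0 B (eps n)" by (rule mass_bound_eventually)
  \<comment> \<open>\<open>180\<close> is the constant 20 of the second moment times the square of the 3 in the exponent \<open>3 / \<kappa>\<close>\<close>
  obtain N :: nat where N: "180 * B * K\<^sup>2 / \<kappa>\<^sup>2 < real N" "1 \<le> N"
    using reals_Archimedean2[of "max 1 (180 * B * K\<^sup>2 / \<kappa>\<^sup>2)"] by (auto simp: less_imp_le)
  define s where "s = K / real N"
  have s0: "0 < s" "s \<le> K" using K N by (auto simp: s_def divide_le_eq intro: order_trans[of _ "K * 1"])
  have sK: "180 * B * K * s \<le> \<kappa>\<^sup>2" using N \<kappa> by (simp add: s_def power2_eq_square field_simps)
  define t where "t n k = of_int k * (s * eps n)" for n k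
  define ck where "ck n \<beta> = \<lfloor>\<beta> / (s * eps n)\<rfloor>" for n \<beta>
  define A1 where "A1 n k = {\<omega> \<in> space M. \<kappa> * (eps n)\<^sup>2 \<le> \<bar>remainder_dev K n (t n k) \<omega>\<bar>}" for n and k :: int
  define A2 where "A2 n \<beta> = {\<omega> \<in> space M. \<kappa> * (eps n)\<^sup>2 \<le> remainder_dev K n \<beta> \<omega> - remainder_dev K n (t n (ck n \<beta>)) \<omega>}" for n \<beta>
  define I where "I n = {\<beta> \<in> grid \<delta> n. \<bar>\<beta>\<bar> \<le> K * eps n}" for n
  define F where "F n = (\<Union>k\<in>{-int N..int N}. A1 n k) \<union> (\<Union>\<beta>\<in>I n. A2 n \<beta>)" for n
  have A_meas: "A1 n k \<in> events" "A2 n \<beta> \<in> events" if "1 \<le> n" for n k \<beta>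
    using remainder_dev_measurable[OF that] by (auto simp: A1_def A2_def)
  have F_meas: "F n \<in> events" if "1 \<le> n" for n
    unfolding F_def I_def using A_meas[OF that] finite_grid by (intro sets.Un sets.finite_UN) auto
  have tk: "\<bar>t n k\<bar> \<le> K * eps n" if "k \<in> {-int N..int N}" for n k
  proof -
    have "\<bar>real_of_int k\<bar> \<le> real N" using that by auto
    then have "\<bar>real_of_int k\<bar> * (s * eps n) \<le> real N * (s * eps n)" using s0 eps_nonneg[of n] by (intro mult_right_mono) auto
    also have "\<dots> = K * eps n" using N by (simp add: s_def)
    finally show ?thesis using s0 eps_nonneg[of n] by (simp add: t_def abs_mult)
  qed
  have near: "ck n \<beta> \<in> {-int N..int N} \<and> \<bar>\<beta> - t n (ck n \<beta>)\<bar> \<le> s * eps n" if n: "2 \<le> n" and \<beta>: "\<bar>\<beta>\<bar> \<le> K * eps n" for n \<beta>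
  proof -
    have se: "0 < s * eps n" using s0 eps_pos[OF n] by simp
    have NK: "K * eps n = real N * (s * eps n)" using N by (simp add: s_def)
    have "- real N \<le> \<beta> / (s * eps n)" "\<beta> / (s * eps n) \<le> real N"
      using \<beta> se unfolding NK by (auto simp: abs_le_iff pos_le_divide_eq pos_divide_le_eq)
    then have "ck n \<beta> \<in> {-int N..int N}" unfolding ck_def by (auto simp: le_floor_iff floor_le_iff)
    moreover have "real_of_int (ck n \<beta>) \<le> \<beta> / (s * eps n)" "\<beta> / (s * eps n) < real_of_int (ck n \<beta>) + 1"
      unfolding ck_def by linarith+
    then have "t n (ck n \<beta>) \<le> \<beta>" "\<beta> < t n (ck n \<beta>) + s * eps n"
      using se by (simp_all add: t_def pos_le_divide_eq pos_divide_less_eq algebra_simps)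
    ultimately show ?thesis by auto
  qed
  have ev_small: "\<forall>\<^sub>F n in sequentially. 3 / \<kappa> * (2 * sqrt (s * eps n)) < 1"
  proof -
    have lim: "(\<lambda>n. 3 / \<kappa> * (2 * sqrt (s * eps n))) \<longlonglongrightarrow> 3 / \<kappa> * (2 * sqrt (s * 0))"
      by (intro tendsto_intros eps_tendsto_0)
    show ?thesis by (rule order_tendstoD(2)[OF lim]) simp
  qed
  have "\<forall>\<^sub>F n in sequentially. prob (F n) \<le> real (2 * N + 1) * (20 * B * K\<^sup>2 / \<kappa>\<^sup>2 * (1 / ln (real n))) + (2 * \<delta> + 1) / real n"
    using B(2) ev_small eventually_ge_at_top[of 2]
  proof eventually_elim
    case (elim n)
    have n: "1 \<le> n" "2 \<le> n" using elim by auto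
    have "prob (F n) \<le> prob (\<Union>k\<in>{-int N..int N}. A1 n k) + prob (\<Union>\<beta>\<in>I n. A2 n \<beta>)"
      unfolding F_def using A_meas[OF n(1)] finite_grid by (intro measure_Un_le sets.finite_UN) (auto simp: I_def)
    also have "prob (\<Union>k\<in>{-int N..int N}. A1 n k) \<le> real (card {-int N..int N}) * (20 * B * K\<^sup>2 / \<kappa>\<^sup>2 * (1 / ln (real n)))"
      using A_meas[OF n(1)] remainder_dev_chebyshev[OF elim(1) n(2) K tk \<kappa>] by (intro union_bound) (auto simp: A1_def)
    also have "real (card {-int N..int N}) = real (2 * N + 1)" by (simp add: nat_add_distrib)
    also have "prob (\<Union>\<beta>\<in>I n. A2 n \<beta>) \<le> (2 * \<delta> + 1) / real n"
    proof (rule grid_union_bound[OF \<delta> n(1)])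
      show "prob (A2 n \<beta>) \<le> 1 / (real n)\<^sup>2" if "\<beta> \<in> I n" for \<beta>
      proof -
        have \<beta>: "\<bar>\<beta>\<bar> \<le> K * eps n" using that by (simp add: I_def)
        note nr = near[OF n(2) \<beta>]
        show ?thesis unfolding A2_def
          by (rule remainder_dev_increment_bernstein[OF elim(1) n(2) K \<beta> tk \<kappa> _ sK]) (use nr elim(2) in auto)
      qed
    qed (use A_meas[OF n(1)] in \<open>auto simp: I_def\<close>)
    finally show ?case by simp
  qed
  then have "\<forall>\<^sub>F n in sequentially. F n \<in> events \<and> prob (F n) \<le> real (2 * N + 1) * (20 * B * K\<^sup>2 / \<kappa>\<^sup>2 * (1 / ln (real n))) + (2 * \<delta> + 1) / real n
      \<and> (\<forall>\<omega>\<in>space M - F n. \<forall>\<beta>\<in>grid \<delta> n. \<bar>\<beta>\<bar> \<le> K * eps n \<longrightarrow> remainder_dev K n \<beta> \<omega> \<le> 2 * \<kappa> * (eps n)\<^sup>2)"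
    using eventually_ge_at_top[of 2]
  proof eventually_elim
    case (elim n)
    show ?case
    proof (intro conjI ballI impI elim(1))
      show "F n \<in> events" using F_meas elim by simp
      fix \<omega> \<beta> assume \<omega>: "\<omega> \<in> space M - F n" and \<beta>: "\<beta> \<in> grid \<delta> n" "\<bar>\<beta>\<bar> \<le> K * eps n"
      have "\<omega> \<notin> A1 n (ck n \<beta>)" "\<omega> \<notin> A2 n \<beta>" using \<omega> \<beta> near[OF elim(2) \<beta>(2)] by (auto simp: F_def I_def)
      then have "\<bar>remainder_dev K n (t n (ck n \<beta>)) \<omega>\<bar> < \<kappa> * (eps n)\<^sup>2" "remainder_dev K n \<beta> \<omega> - remainder_dev K n (t n (ck n \<beta>)) \<omega> < \<kappa> * (eps n)\<^sup>2"
        using \<omega> by (auto simp: A1_def A2_def)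
      then show "remainder_dev K n \<beta> \<omega> \<le> 2 * \<kappa> * (eps n)\<^sup>2" by (simp add: abs_less_iff)
    qed
  qed
  moreover have "(\<lambda>n. real (2 * N + 1) * (20 * B * K\<^sup>2 / \<kappa>\<^sup>2 * (1 / ln (real n))) + (2 * \<delta> + 1) / real n) \<longlonglongrightarrow> real (2 * N + 1) * (20 * B * K\<^sup>2 / \<kappa>\<^sup>2 * 0) + 0"
    by (rule tendsto_add[OF tendsto_mult_left[OF tendsto_mult_left]]; real_asymp)
  ultimately show ?thesis by (intro whpI) simp_all
qed

lemma remainder_dev_far:
  assumes c: "0 < c" and \<delta>: "0 \<le> \<delta>"
  obtains K where "1 \<le> K" "whp (\<lambda>n \<omega>. \<forall>\<beta>\<in>grid \<delta> n. K * eps n \<le> \<bar>\<beta>\<bar> \<longrightarrow> remainder_dev K n \<beta> \<omega> \<le> c * \<beta>\<^sup>2)"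
proof -
  obtain B where B: "0 < B" "\<forall>\<^sub>F n in sequentially. mass_bound (\<mu> n) x0 B (eps n)" by (rule mass_bound_eventually)
  define c1 where "c1 = c / (62 * B)"
  have c1: "0 < c1" using c B by (simp add: c1_def)
  define K where "K = max 1 (2 / sqrt (c1 * c))"
  have K: "1 \<le> K" by (simp add: K_def)
  have large: "4 \<le> K\<^sup>2 * c1 * c"
  proof -
    have "(2 / sqrt (c1 * c))\<^sup>2 \<le> K\<^sup>2" using c c1 by (intro power_mono) (auto simp: K_def)
    then have "4 / (c1 * c) \<le> K\<^sup>2" using c c1 by (simp add: power_divide)
    then show ?thesis using c c1 by (simp add: pos_divide_le_eq mult.assoc)
  qed
  define A where "A n \<beta> = {\<omega> \<in> space M. c * \<beta>\<^sup>2 \<le> remainder_dev K n \<beta> \<omega>}" for n \<beta>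
  define I where "I n = {\<beta> \<in> grid \<delta> n. K * eps n \<le> \<bar>\<beta>\<bar>}" for n
  define F where "F n = (\<Union>\<beta>\<in>I n. A n \<beta>)" for n
  have A_meas: "A n \<beta> \<in> events" if "1 \<le> n" for n \<beta>
    using remainder_dev_measurable[OF that] by (auto simp: A_def)
  have F_meas: "F n \<in> events" if "1 \<le> n" for n
    unfolding F_def I_def using A_meas[OF that] finite_grid by (intro sets.finite_UN) auto
  have ev_small: "\<forall>\<^sub>F n in sequentially. 3 * c1 * sqrt (K * eps n) < 1"
  proof -
    have lim: "(\<lambda>n. 3 * c1 * sqrt (K * eps n)) \<longlonglongrightarrow> 3 * c1 * sqrt (K * 0)"
      by (intro tendsto_intros eps_tendsto_0)
    show ?thesis by (rule order_tendstoD(2)[OF lim]) simp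
  qed
  have "\<forall>\<^sub>F n in sequentially. F n \<in> events \<and> prob (F n) \<le> (2 * \<delta> + 1) / real n
      \<and> (\<forall>\<omega>\<in>space M - F n. \<forall>\<beta>\<in>grid \<delta> n. K * eps n \<le> \<bar>\<beta>\<bar> \<longrightarrow> remainder_dev K n \<beta> \<omega> \<le> c * \<beta>\<^sup>2)"
    using B(2) ev_small eventually_ge_at_top[of 2]
  proof eventually_elim
    case (elim n)
    have n: "1 \<le> n" "2 \<le> n" using elim by auto
    have "prob (F n) \<le> (2 * \<delta> + 1) / real n" unfolding F_def
    proof (rule grid_union_bound[OF \<delta> n(1)])
      show "prob (A n \<beta>) \<le> 1 / (real n)\<^sup>2" if "\<beta> \<in> I n" for \<beta>
        unfolding A_def using that elim(2)
        by (intro far_remainder_bernstein[OF elim(1) n(2) K B(1) _ c c1_def large]) (auto simp: I_def)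
    qed (use A_meas[OF n(1)] in \<open>auto simp: I_def\<close>)
    then show ?case using F_meas[OF n(1)] by (auto simp: F_def I_def A_def not_le less_imp_le)
  qed
  moreover have "(\<lambda>n. (2 * \<delta> + 1) / real n) \<longlonglongrightarrow> 0" by real_asymp
  ultimately show ?thesis by (rule that[OF K whpI])
qed

end

section \<open>Behaviour away from the point\<close>

lemma psi_mono: "x \<le> x' \<Longrightarrow> psi x u \<le> psi x' u"
  by (simp add: psi_def)

lemma psi_holder: "\<bar>psi x u - psi x' u\<bar> \<le> 2 * sqrt \<bar>x - x'\<bar>"
proof -
  have eq: "psi x u - psi x' u = 2 * (sqrt (max (u - x') 0) - sqrt (max (u - x) 0))" by (simp add: psi_def)
  have "\<bar>sqrt (max (u - x') 0) - sqrt (max (u - x) 0)\<bar> \<le> sqrt \<bar>x - x'\<bar>"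
    using abs_sqrt_diff_le[of "u - x'" "u - x"] by simp
  then show ?thesis unfolding eq abs_mult by simp
qed

lemma sample_mean_mono: "(\<And>y. p y \<le> q y) \<Longrightarrow> sample_mean Y n p \<omega> \<le> sample_mean Y n q \<omega>"
  unfolding sample_mean_def by (intro divide_right_mono sum_mono) auto

lemma sample_mean_le: "0 < n \<Longrightarrow> (\<And>i. i \<in> {1..n} \<Longrightarrow> q (Y i \<omega>) \<le> c) \<Longrightarrow> sample_mean Y n q \<omega> \<le> c"
  using sum_mono[of "{1..n}" "\<lambda>i. q (Y i \<omega>)" "\<lambda>_. c"] by (simp add: sample_mean_def pos_divide_le_eq mult.commute)

lemma sample_mean_nonneg: "(\<And>i. i \<in> {1..n} \<Longrightarrow> 0 \<le> q (Y i \<omega>)) \<Longrightarrow> 0 \<le> sample_mean Y n q \<omega>"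
  unfolding sample_mean_def by (intro divide_nonneg_nonneg sum_nonneg) auto

lemma sample_mean_holder:
  assumes "0 < n"
  shows "\<bar>sample_mean Y n (psi x) \<omega> - sample_mean Y n (psi x') \<omega>\<bar> \<le> 2 * sqrt \<bar>x - x'\<bar>"
proof -
  have "sample_mean Y n (psi x) \<omega> - sample_mean Y n (psi x') \<omega> \<le> 2 * sqrt \<bar>x - x'\<bar>" for x x'
  proof -
    have "sample_mean Y n (psi x) \<omega> - sample_mean Y n (psi x') \<omega> = sample_mean Y n (\<lambda>u. psi x u - psi x' u) \<omega>"
      by (simp add: sample_mean_def sum_subtractf diff_divide_distrib)
    also have "\<dots> \<le> 2 * sqrt \<bar>x - x'\<bar>"
      by (rule sample_mean_le[OF assms]) (use psi_holder[of x _ x'] in \<open>simp add: abs_le_iff\<close>)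
    finally show ?thesis .
  qed
  from this[of x x'] this[of x' x] show ?thesis by (simp add: abs_le_iff abs_minus_commute)
qed

context nonneg_real_distribution
begin

lemma U_n_mono: "0 \<le> x \<Longrightarrow> x \<le> x' \<Longrightarrow> U_n \<mu> x \<le> U_n \<mu> x'"
  by (simp add: U_n_eq_expectation integral_mono integrable_psi psi_mono)

lemma U_n_holder:
  assumes "0 \<le> x" "0 \<le> x'"
  shows "\<bar>U_n \<mu> x - U_n \<mu> x'\<bar> \<le> 2 * sqrt \<bar>x - x'\<bar>"
proof -
  have "\<bar>expectation (\<lambda>u. psi x u - psi x' u)\<bar> \<le> expectation (\<lambda>u. \<bar>psi x u - psi x' u\<bar>)" by (rule integral_abs_bound)
  also have "\<dots> \<le> expectation (\<lambda>_. 2 * sqrt \<bar>x - x'\<bar>)"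
    using assms by (intro integral_mono) (auto intro!: integrable_psi Bochner_Integration.integrable_diff Bochner_Integration.integrable_abs psi_holder)
  finally show ?thesis using assms prob_space by (simp add: U_n_eq_expectation integrable_psi)
qed

lemma psi_second_moment:
  assumes "0 \<le> x"
  shows "integrable \<mu> (\<lambda>u. (psi x u)\<^sup>2)" "expectation (\<lambda>u. (psi x u)\<^sup>2) \<le> 4 * x"
proof -
  have ae: "AE u in \<mu>. (psi x u)\<^sup>2 \<le> 4 * x"
    using AE_nonneg
  proof eventually_elim
    case (elim u)
    then have "(psi x u)\<^sup>2 \<le> (2 * sqrt x)\<^sup>2" using psi_bounds[OF assms elim] by (intro power_mono) auto
    then show ?case using assms by (simp add: power_mult_distrib)
  qed
  show i: "integrable \<mu> (\<lambda>u. (psi x u)\<^sup>2)"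
    by (rule integrable_const_bound[where B="4 * x"]) (use ae in auto)
  have "expectation (\<lambda>u. (psi x u)\<^sup>2) \<le> expectation (\<lambda>_. 4 * x)" using i ae by (intro integral_mono_AE) auto
  then show "expectation (\<lambda>u. (psi x u)\<^sup>2) \<le> 4 * x" using prob_space by simp
qed

end

context sqrt_log_array
begin

lemma U_n_limit:
  assumes x: "0 \<le> x"
  shows "(\<lambda>n. U_n (\<mu> n) x) \<longlonglongrightarrow> U_n \<nu> x"
proof -
  define f where "f u = psi x (max u 0)" for u
  have f: "0 \<le> f u \<and> f u \<le> 2 * sqrt x" for u unfolding f_def using x by (intro psi_bounds) auto
  have eq: "U_n \<mu>' x = integral\<^sup>L \<mu>' f" if "nonneg_real_distribution \<mu>'" for \<mu>'
  proof -
    interpret \<mu>': nonneg_real_distribution \<mu>' by fact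
    have [measurable]: "f \<in> borel_measurable borel" unfolding f_def by measurable
    have "AE u in \<mu>'. psi x u = f u" using \<mu>'.AE_nonneg by eventually_elim (simp add: f_def)
    then show ?thesis unfolding \<mu>'.U_n_eq_expectation[OF x] by (intro integral_cong_AE) auto
  qed
  have conv: "weak_conv_m (\<lambda>n. \<mu> (Suc n)) \<nu>"
    unfolding weak_conv_m_def weak_conv_def
  proof (intro allI impI)
    fix t
    obtain C where C: "0 < C" "\<forall>\<^sub>F n in sequentially. \<forall>t. \<bar>cdf (\<mu> n) t - cdf \<nu> t\<bar> \<le> C * eps n" using cdf_close by blast
    have lim: "(\<lambda>n. C * eps n) \<longlonglongrightarrow> C * 0" by (intro tendsto_intros eps_tendsto_0)
    have "(\<lambda>n. cdf (\<mu> n) t - cdf \<nu> t) \<longlonglongrightarrow> 0"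
      by (rule Lim_null_comparison[OF _ lim[simplified]]) (use C(2) in \<open>auto elim: eventually_mono\<close>)
    then have "(\<lambda>n. cdf (\<mu> n) t) \<longlonglongrightarrow> cdf \<nu> t" by (simp add: LIM_zero_iff)
    then show "(\<lambda>n. cdf (\<mu> (Suc n)) t) \<longlonglongrightarrow> cdf \<nu> t" by (rule LIMSEQ_Suc)
  qed
  have "(\<lambda>n. integral\<^sup>L (\<mu> (Suc n)) f) \<longlonglongrightarrow> integral\<^sup>L \<nu> f"
  proof (rule weak_conv_imp_integral_bdd_continuous_conv[OF _ limit.distr conv, of f "2 * sqrt x"])
    show "real_distribution (\<mu> (Suc n))" for n
      using nonneg[of "Suc n"] by (simp add: nonneg_real_distribution_def)
    show "isCont f u" for u unfolding f_def psi_def by (intro continuous_intros)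
    show "norm (f u) \<le> 2 * sqrt x" for u using f[of u] by simp
  qed
  then have "(\<lambda>n. U_n (\<mu> (Suc n)) x) \<longlonglongrightarrow> U_n \<nu> x"
    using eq[OF nonneg[of "Suc _"]] eq[OF limit.nonneg_real_distribution_axioms] by simp
  then show ?thesis by (rule LIMSEQ_imp_Suc)
qed

text \<open>Pointwise convergence on a finite grid suffices, since \<open>U\<^sub>n\<^sup>#\<close> and \<open>U\<close> share a modulus of continuity.\<close>

lemma U_sharp_uniform:
  assumes \<eta>: "0 < \<eta>" and R: "0 \<le> R"
  shows "whp (\<lambda>n \<omega>. \<forall>x. 0 \<le> x \<longrightarrow> x \<le> R \<longrightarrow> \<bar>sample_mean (Y n) n (psi x) \<omega> - U_n \<nu> x\<bar> \<le> \<eta>)"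
proof -
  \<comment> \<open>across a cell of this width the modulus of continuity \<open>2 \<surd>p\<close> is \<open>\<eta> / 4\<close>\<close>
  define p where "p = (\<eta> / 8)\<^sup>2"
  have p: "0 < p" "2 * sqrt p = \<eta> / 4" using \<eta> by (auto simp: p_def)
  define N where "N = nat \<lfloor>R / p\<rfloor>"
  define A where "A n k = {\<omega> \<in> space M. \<eta> / 4 \<le> \<bar>sample_mean (Y n) n (psi (real k * p)) \<omega> - E\<mu> n (psi (real k * p))\<bar>}" for n k
  define F where "F n = (\<Union>k\<in>{..N}. A n k)" for n
  have A_meas: "A n k \<in> events" if n: "1 \<le> n" for n k
  proof -
    interpret iid_sample M "\<mu> n" "Y n" n by (rule iid[OF n])
    show ?thesis unfolding A_def by measurable
  qed
  have A_prob: "prob (A n k) \<le> 4 * (real N * p) / (real n * (\<eta> / 4)\<^sup>2)" if n: "1 \<le> n" and k: "k \<le> N" for n k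
  proof -
    interpret iid_sample M "\<mu> n" "Y n" n by (rule iid[OF n])
    interpret \<mu>: nonneg_real_distribution "\<mu> n" by (rule nonneg[OF n])
    have kp: "0 \<le> real k * p" using p by simp
    have "prob (A n k) \<le> E\<mu> n (\<lambda>u. (psi (real k * p) u)\<^sup>2) / (real n * (\<eta> / 4)\<^sup>2)"
      unfolding A_def using \<mu>.psi_second_moment(1)[OF kp] \<eta> by (intro chebyshev_avg) auto
    also have "\<dots> \<le> 4 * (real N * p) / (real n * (\<eta> / 4)\<^sup>2)"
    proof (rule divide_right_mono)
      have "real k * p \<le> real N * p" using k p by (intro mult_right_mono) auto
      then show "E\<mu> n (\<lambda>u. (psi (real k * p) u)\<^sup>2) \<le> 4 * (real N * p)" using \<mu>.psi_second_moment(2)[OF kp] by linarith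
    qed simp
    finally show ?thesis .
  qed
  have lim: "(\<lambda>n. real (card {..N}) * (4 * (real N * p) / (real n * (\<eta> / 4)\<^sup>2))) \<longlonglongrightarrow> 0"
  proof -
    have "(\<lambda>n. (real (card {..N}) * (4 * (real N * p) / (\<eta> / 4)\<^sup>2)) * (1 / real n)) \<longlonglongrightarrow> (real (card {..N}) * (4 * (real N * p) / (\<eta> / 4)\<^sup>2)) * 0"
      by (intro tendsto_mult_left lim_1_over_n)
    then show ?thesis by (simp add: mult_ac)
  qed
  have "\<forall>\<^sub>F n in sequentially. \<forall>k\<in>{..N}. \<bar>U_n (\<mu> n) (real k * p) - U_n \<nu> (real k * p)\<bar> < \<eta> / 4"
  proof (rule eventually_ball_finite)
    show "\<forall>k\<in>{..N}. \<forall>\<^sub>F n in sequentially. \<bar>U_n (\<mu> n) (real k * p) - U_n \<nu> (real k * p)\<bar> < \<eta> / 4"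
      using tendstoD[OF U_n_limit, of _ "\<eta> / 4"] \<eta> p by (auto simp: dist_real_def)
  qed simp
  then have "\<forall>\<^sub>F n in sequentially. F n \<in> events
      \<and> prob (F n) \<le> real (card {..N}) * (4 * (real N * p) / (real n * (\<eta> / 4)\<^sup>2))
      \<and> (\<forall>\<omega>\<in>space M - F n. \<forall>x. 0 \<le> x \<longrightarrow> x \<le> R \<longrightarrow> \<bar>sample_mean (Y n) n (psi x) \<omega> - U_n \<nu> x\<bar> \<le> \<eta>)"
    using eventually_ge_at_top[of 1]
  proof eventually_elim
    case (elim n)
    interpret \<mu>: nonneg_real_distribution "\<mu> n" using elim by (intro nonneg)
    show ?case
    proof (intro conjI ballI allI impI)
      show "F n \<in> events" unfolding F_def using A_meas elim by auto
      show "prob (F n) \<le> real (card {..N}) * (4 * (real N * p) / (real n * (\<eta> / 4)\<^sup>2))"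
        unfolding F_def using A_meas[OF elim(2)] A_prob[OF elim(2)] by (intro union_bound) auto
      fix \<omega> x assume \<omega>: "\<omega> \<in> space M - F n" and x: "0 \<le> x" "x \<le> R"
      define k where "k = nat \<lfloor>x / p\<rfloor>"
      have kf: "real k = real_of_int \<lfloor>x / p\<rfloor>" using x p by (simp add: k_def of_nat_nat)
      have "real k \<le> x / p" "x / p < real k + 1" unfolding kf by linarith+
      then have kx: "real k * p \<le> x" "x - real k * p \<le> p" using p by (simp_all add: pos_le_divide_eq pos_divide_less_eq algebra_simps)
      have kN: "k \<le> N" unfolding k_def N_def using x p by (intro nat_mono floor_mono divide_right_mono) auto
      have kp: "0 \<le> real k * p" using p by simp
      have sq: "2 * sqrt \<bar>x - real k * p\<bar> \<le> \<eta> / 4"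
      proof -
        have "sqrt \<bar>x - real k * p\<bar> \<le> sqrt p" using kx by simp
        then show ?thesis using p(2) by linarith
      qed
      have "\<bar>sample_mean (Y n) n (psi x) \<omega> - sample_mean (Y n) n (psi (real k * p)) \<omega>\<bar> \<le> \<eta> / 4"
        using sample_mean_holder[of n "Y n" x \<omega> "real k * p"] elim(2) sq by linarith
      moreover have "\<bar>U_n \<nu> x - U_n \<nu> (real k * p)\<bar> \<le> \<eta> / 4"
        using limit.U_n_holder[OF x(1) kp] sq by linarith
      moreover have "\<bar>U_n (\<mu> n) (real k * p) - U_n \<nu> (real k * p)\<bar> < \<eta> / 4" using elim(1) kN by auto
      moreover have "\<bar>sample_mean (Y n) n (psi (real k * p)) \<omega> - U_n (\<mu> n) (real k * p)\<bar> < \<eta> / 4"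
      proof -
        have "\<omega> \<notin> A n k" using \<omega> kN by (auto simp: F_def)
        then show ?thesis using \<omega> by (simp add: A_def \<mu>.U_n_eq_expectation[OF kp])
      qed
      ultimately show "\<bar>sample_mean (Y n) n (psi x) \<omega> - U_n \<nu> x\<bar> \<le> \<eta>" by linarith
    qed
  qed
  then show ?thesis using lim by (rule whpI)
qed

lemma sample_nonneg: "whp (\<lambda>n \<omega>. \<forall>i\<in>{1..n}. 0 \<le> Y n i \<omega>)"
proof -
  define A where "A n i = {\<omega> \<in> space M. Y n i \<omega> < 0}" for n i
  have A: "A n i \<in> events \<and> prob (A n i) = 0" if n: "1 \<le> n" and i: "i \<in> {1..n}" for n i
  proof -
    interpret iid_sample M "\<mu> n" "Y n" n by (rule iid[OF n])
    interpret \<mu>: nonneg_real_distribution "\<mu> n" by (rule nonneg[OF n])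
    have [measurable]: "Y n i \<in> borel_measurable M" by (rule Y_measurable[OF i])
    have "prob (A n i) = measure (distr M borel (Y n i)) {..<0}"
      by (subst measure_distr) (auto simp: A_def intro!: arg_cong[where f=prob])
    then show ?thesis using identically[OF i] \<mu>.no_negative by (simp add: A_def)
  qed
  show ?thesis
  proof (rule whpI[where F="\<lambda>n. \<Union>i\<in>{1..n}. A n i" and p="\<lambda>_. 0"])
    show "\<forall>\<^sub>F n in sequentially. (\<Union>i\<in>{1..n}. A n i) \<in> events \<and> prob (\<Union>i\<in>{1..n}. A n i) \<le> 0 \<and>
        (\<forall>\<omega>\<in>space M - (\<Union>i\<in>{1..n}. A n i). \<forall>i\<in>{1..n}. 0 \<le> Y n i \<omega>)"
      using eventually_ge_at_top[of 1]
    proof eventually_elim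
      case (elim n)
      have "prob (\<Union>i\<in>{1..n}. A n i) \<le> real (card {1..n}) * 0" using A[OF elim] by (intro union_bound) auto
      then show ?case using A[OF elim] by (auto simp: A_def not_less)
    qed
  qed simp
qed

lemma slope_small:
  assumes K: "0 < K" and \<eta>: "0 < \<eta>"
  shows "whp (\<lambda>n \<omega>. \<bar>eps n * linear_coeff K n \<omega>\<bar> \<le> \<eta>)"
proof -
  let ?inv_sqrt = "\<lambda>n. inv_sqrt x0 (2 * (K * eps n))"
  define F where "F n = {\<omega> \<in> space M. \<eta> \<le> \<bar>sample_mean (Y n) n (?inv_sqrt n) \<omega> - E\<mu> n (?inv_sqrt n)\<bar>}" for n
  have "\<forall>\<^sub>F n in sequentially. F n \<in> events \<and> prob (F n) \<le> E\<mu> n (\<lambda>y. (?inv_sqrt n y)\<^sup>2) / ln (real n) * (ln (real n) / real n) / \<eta>\<^sup>2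
      \<and> (\<forall>\<omega>\<in>space M - F n. \<bar>eps n * linear_coeff K n \<omega>\<bar> \<le> \<eta>)"
    using eventually_ge_at_top[of 2]
  proof eventually_elim
    case (elim n)
    then have n: "1 \<le> n" by simp
    interpret iid_sample M "\<mu> n" "Y n" n by (rule iid[OF n])
    have a: "0 < 2 * (K * eps n)" using eps_pos[OF elim] K by simp
    have "integrable (\<mu> n) (\<lambda>y. (?inv_sqrt n y)\<^sup>2)"
      using power_mono[OF inv_sqrt_bound[OF a] abs_ge_zero, where n=2]
      by (intro integrable_bounded[where b="(1 / sqrt (2 * (K * eps n)))\<^sup>2"]) auto
    then have "prob (F n) \<le> E\<mu> n (\<lambda>y. (?inv_sqrt n y)\<^sup>2) / (real n * \<eta>\<^sup>2)"
      unfolding F_def using \<eta> by (intro chebyshev_avg) auto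
    also have "\<dots> = E\<mu> n (\<lambda>y. (?inv_sqrt n y)\<^sup>2) / ln (real n) * (ln (real n) / real n) / \<eta>\<^sup>2" using elim by simp
    finally have "prob (F n) \<le> E\<mu> n (\<lambda>y. (?inv_sqrt n y)\<^sup>2) / ln (real n) * (ln (real n) / real n) / \<eta>\<^sup>2" .
    moreover have "F n \<in> events" unfolding F_def by measurable
    moreover have "eps n * linear_coeff K n \<omega> = sample_mean (Y n) n (?inv_sqrt n) \<omega> - E\<mu> n (?inv_sqrt n)" for \<omega>
      using eps_pos[OF elim] by (simp add: linear_coeff_def)
    ultimately show ?case by (auto simp: F_def)
  qed
  moreover have "(\<lambda>n. E\<mu> n (\<lambda>y. (?inv_sqrt n y)\<^sup>2) / ln (real n) * (ln (real n) / real n) / \<eta>\<^sup>2) \<longlonglongrightarrow> g_dens \<rho> x0 / 2 * 0 / \<eta>\<^sup>2"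
    using \<eta> by (intro tendsto_divide tendsto_mult inv_sqrt_variance_limit[OF K] tendsto_const) (real_asymp, simp)
  ultimately show ?thesis by (intro whpI) simp_all
qed

text \<open>Beyond distance \<open>\<delta>\<close> from \<open>x0\<close>, a concave function lies below the line through its values at \<open>x0\<close> and at
  distance \<open>\<delta>\<close> on the same side.\<close>

lemma U_n_limit_chord:
  assumes \<delta>: "0 < \<delta>" "\<delta> < x0" and \<beta>: "\<delta> \<le> \<bar>\<beta>\<bar>" "0 \<le> x0 + \<beta>"
  shows "U_n \<nu> (x0 + \<beta>) - U_n \<nu> x0 \<le> \<bar>\<beta>\<bar> / \<delta> * (U_n \<nu> (x0 + sgn \<beta> * \<delta>) - U_n \<nu> x0)"
proof -
  define c where "c = x0 + sgn \<beta> * \<delta>"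
  have sg: "sgn \<beta> = 1 \<or> sgn \<beta> = -1" using \<beta> \<delta> by (auto simp: sgn_if)
  have c: "0 < c" using sg \<delta> x0 by (auto simp: c_def)
  define v where "v = enn2real (V_n \<nu> c) * sgn \<beta>"
  have \<beta>': "x0 + \<beta> - c = sgn \<beta> * (\<bar>\<beta>\<bar> - \<delta>)" "x0 - c = - (sgn \<beta> * \<delta>)"
    by (simp_all add: c_def right_diff_distrib sgn_mult_abs)
  have 1: "U_n \<nu> (x0 + \<beta>) \<le> U_n \<nu> c + v * (\<bar>\<beta>\<bar> - \<delta>)"
    using limit.U_n_supergradient[OF c \<beta>(2)] unfolding \<beta>' by (simp add: v_def mult_ac)
  have 2: "U_n \<nu> x0 \<le> U_n \<nu> c - v * \<delta>"
    using limit.U_n_supergradient[OF c, of x0] x0 unfolding \<beta>' by (simp add: v_def mult_ac)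
  have "v \<le> (U_n \<nu> c - U_n \<nu> x0) / \<delta>" using 2 \<delta> by (simp add: pos_le_divide_eq)
  then have "v * (\<bar>\<beta>\<bar> - \<delta>) \<le> (U_n \<nu> c - U_n \<nu> x0) / \<delta> * (\<bar>\<beta>\<bar> - \<delta>)" using \<beta> by (intro mult_right_mono) auto
  with 1 have "U_n \<nu> (x0 + \<beta>) - U_n \<nu> x0 \<le> (U_n \<nu> c - U_n \<nu> x0) + (U_n \<nu> c - U_n \<nu> x0) / \<delta> * (\<bar>\<beta>\<bar> - \<delta>)" by simp
  also have "\<dots> = \<bar>\<beta>\<bar> / \<delta> * (U_n \<nu> c - U_n \<nu> x0)" using \<delta> by (simp add: field_simps)
  finally show ?thesis by (simp add: c_def)
qed

text \<open>At \<open>x0 \<plusminus> \<delta>\<close> the limit \<open>U\<close> is below the line of slope \<open>Vhat n\<close> through its value at \<open>x0\<close> by almost \<open>\<theta>\<close>, and by concavity the gap grows at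
  least linearly beyond these points. It absorbs the error of \<open>U\<^sub>n\<^sup>#\<close> and of the slope on every
  bounded interval \<open>[0, R]\<close>. Beyond \<open>R\<close> the bound \<open>U\<^sub>n\<^sup>#(x) \<le> 2 \<surd>x\<close> wins over the line, whose slope is at least
  \<open>\<theta> / (2 \<delta>)\<close>.\<close>

lemma global_majorization:
  assumes K: "0 < K" and \<delta>: "0 < \<delta>" "\<delta> < x0" and \<theta>: "0 < \<theta>"
    and drift: "\<forall>\<^sub>F n in sequentially. drift n \<delta> \<le> - \<theta> \<and> drift n (- \<delta>) \<le> - \<theta>"
  shows "whp (\<lambda>n \<omega>. \<bar>eps n * linear_coeff K n \<omega>\<bar> \<le> 1 \<and> (\<forall>\<beta>. \<delta> \<le> \<bar>\<beta>\<bar> \<longrightarrow> 0 \<le> x0 + \<beta> \<longrightarrow>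
        sample_mean (Y n) n (psi (x0 + \<beta>)) \<omega> - sample_mean (Y n) n (psi x0) \<omega> \<le> (Vhat n + eps n * linear_coeff K n \<omega>) * \<beta>))"
    (is "whp ?P")
proof -
  \<comment> \<open>the second bound serves the interval \<open>[0, R]\<close>, the third one keeps the slope above \<open>\<theta> / (2 \<delta>)\<close>\<close>
  define \<eta> where "\<eta> = min 1 (min (\<theta> / (4 + \<delta>)) (\<theta> / (2 * \<delta>)))"
  have "0 < \<theta> / (4 + \<delta>)" "0 < \<theta> / (2 * \<delta>)" using \<theta> \<delta> by auto
  then have \<eta>: "0 < \<eta>" "\<eta> \<le> 1" "\<eta> \<le> \<theta> / (4 + \<delta>)" "\<eta> \<le> \<theta> / (2 * \<delta>)" by (auto simp: \<eta>_def)
  have \<eta>1: "\<eta> * (4 + \<delta>) \<le> \<theta>" using \<eta>(3) \<delta> by (simp add: pos_le_divide_eq)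
  \<comment> \<open>for \<open>x0 + \<beta> \<ge> R\<close> both \<open>\<beta> \<ge> (x0 + \<beta>) / 2\<close> and \<open>\<surd>(x0 + \<beta>) \<ge> 8 \<delta> / \<theta>\<close>\<close>
  define R where "R = max (2 * x0) ((8 * \<delta> / \<theta>)\<^sup>2)"
  have R: "0 \<le> R" "2 * x0 \<le> R" using x0 by (auto simp: R_def)
  have "whp (\<lambda>n \<omega>. (\<forall>x. 0 \<le> x \<longrightarrow> x \<le> R \<longrightarrow> \<bar>sample_mean (Y n) n (psi x) \<omega> - U_n \<nu> x\<bar> \<le> \<eta>)
      \<and> (\<forall>i\<in>{1..n}. 0 \<le> Y n i \<omega>) \<and> \<bar>eps n * linear_coeff K n \<omega>\<bar> \<le> \<eta>)" (is "whp ?Q")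
    by (intro whp_conj U_sharp_uniform \<eta> R sample_nonneg slope_small K)
  have ev: "\<forall>\<^sub>F n in sequentially. \<bar>U_n (\<mu> n) x - U_n \<nu> x\<bar> < \<eta>" if "0 \<le> x" for x
    using tendstoD[OF U_n_limit[OF that] \<eta>(1)] by (simp add: dist_real_def)
  have xp: "0 \<le> x0 + \<delta>" "0 \<le> x0 - \<delta>" "0 \<le> x0" using \<delta> x0 by auto
  have main: "\<forall>\<^sub>F n in sequentially. \<forall>\<omega>\<in>space M. ?Q n \<omega> \<longrightarrow> ?P n \<omega>"
    using ev[OF xp(1)] ev[OF xp(2)] ev[OF xp(3)] drift eventually_ge_at_top[of 2]
  proof eventually_elim
    case (elim n)
    then have n: "0 < n" "1 \<le> n" by auto
    interpret \<mu>: nonneg_real_distribution "\<mu> n" by (rule nonneg[OF n(2)])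
    have Vh: "\<theta> / \<delta> \<le> Vhat n"
    proof -
      have "U_n (\<mu> n) x0 \<le> U_n (\<mu> n) (x0 + \<delta>)" using x0 \<delta> by (intro \<mu>.U_n_mono) auto
      then have "\<theta> \<le> Vhat n * \<delta>" using elim(4) by (simp add: drift_def)
      then show ?thesis using \<delta> by (simp add: pos_divide_le_eq)
    qed
    show ?case
    proof (intro ballI impI conjI allI)
      fix \<omega> assume Q: "?Q n \<omega>"
      let ?f = "\<lambda>x. sample_mean (Y n) n (psi x) \<omega>"
      define w where "w = eps n * linear_coeff K n \<omega>"
      have w: "\<bar>w\<bar> \<le> \<eta>" using Q by (simp add: w_def)
      then show "\<bar>eps n * linear_coeff K n \<omega>\<bar> \<le> 1" using \<eta> by (simp add: w_def)
      have f: "\<bar>?f x - U_n \<nu> x\<bar> \<le> \<eta>" if "0 \<le> x" "x \<le> R" for x using Q that by simp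
      have Yp: "0 \<le> Y n i \<omega>" if "i \<in> {1..n}" for i using Q that by simp
      fix \<beta> assume \<beta>: "\<delta> \<le> \<bar>\<beta>\<bar>" "0 \<le> x0 + \<beta>"
      show "?f (x0 + \<beta>) - ?f x0 \<le> (Vhat n + eps n * linear_coeff K n \<omega>) * \<beta>"
      proof (cases "x0 + \<beta> \<le> R")
        case True
        define c where "c = x0 + sgn \<beta> * \<delta>"
        have sg: "sgn \<beta> = 1 \<or> sgn \<beta> = -1" using \<beta> \<delta> by (auto simp: sgn_if)
        have dr: "U_n (\<mu> n) c - U_n (\<mu> n) x0 - Vhat n * (sgn \<beta> * \<delta>) \<le> - \<theta>"
          using sg elim(4) by (auto simp: drift_def c_def)
        have cl: "\<bar>U_n (\<mu> n) c - U_n \<nu> c\<bar> < \<eta>" using sg elim(1,2) by (auto simp: c_def)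
        have "U_n \<nu> c - U_n \<nu> x0 \<le> Vhat n * (sgn \<beta> * \<delta>) - \<theta> + 2 * \<eta>" using dr cl elim(3) by linarith
        then have "\<bar>\<beta>\<bar> / \<delta> * (U_n \<nu> c - U_n \<nu> x0) \<le> \<bar>\<beta>\<bar> / \<delta> * (Vhat n * (sgn \<beta> * \<delta>) - \<theta> + 2 * \<eta>)"
          using \<delta> by (intro mult_left_mono) auto
        also have "\<dots> = Vhat n * \<beta> + \<bar>\<beta>\<bar> / \<delta> * (2 * \<eta> - \<theta>)"
          using \<delta> by (simp add: field_simps) (metis abs_mult_sgn mult.commute mult.left_commute)
        finally have "U_n \<nu> (x0 + \<beta>) - U_n \<nu> x0 \<le> Vhat n * \<beta> + \<bar>\<beta>\<bar> / \<delta> * (2 * \<eta> - \<theta>)"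
          using U_n_limit_chord[OF \<delta> \<beta>] by (simp add: c_def)
        moreover have "\<bar>?f (x0 + \<beta>) - U_n \<nu> (x0 + \<beta>)\<bar> \<le> \<eta>" using f[of "x0 + \<beta>"] True \<beta> by simp
        moreover have "\<bar>?f x0 - U_n \<nu> x0\<bar> \<le> \<eta>" using f[of x0] R x0 by simp
        moreover have "- (w * \<beta>) \<le> \<bar>\<beta>\<bar> / \<delta> * (\<eta> * \<delta>)"
        proof -
          have "- (w * \<beta>) \<le> \<bar>w\<bar> * \<bar>\<beta>\<bar>" by (simp add: abs_mult[symmetric])
          also have "\<dots> \<le> \<eta> * \<bar>\<beta>\<bar>" using w by (intro mult_right_mono) auto
          finally show ?thesis using \<delta> by (simp add: mult.commute)
        qed
        moreover have "2 * \<eta> \<le> \<bar>\<beta>\<bar> / \<delta> * (2 * \<eta>)"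
        proof -
          have "1 \<le> \<bar>\<beta>\<bar> / \<delta>" using \<beta> \<delta> by simp
          then show ?thesis using mult_right_mono[of 1 "\<bar>\<beta>\<bar> / \<delta>" "2 * \<eta>"] \<eta> by simp
        qed
        moreover have "\<bar>\<beta>\<bar> / \<delta> * (2 * \<eta> - \<theta>) + \<bar>\<beta>\<bar> / \<delta> * (2 * \<eta>) + \<bar>\<beta>\<bar> / \<delta> * (\<eta> * \<delta>) \<le> 0"
        proof -
          have "\<bar>\<beta>\<bar> / \<delta> * (2 * \<eta> - \<theta>) + \<bar>\<beta>\<bar> / \<delta> * (2 * \<eta>) + \<bar>\<beta>\<bar> / \<delta> * (\<eta> * \<delta>) = \<bar>\<beta>\<bar> / \<delta> * (\<eta> * (4 + \<delta>) - \<theta>)"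
            by (simp add: algebra_simps)
          also have "\<dots> \<le> 0" using \<eta>1 \<delta> by (intro mult_nonneg_nonpos) auto
          finally show ?thesis .
        qed
        ultimately have "?f (x0 + \<beta>) - ?f x0 \<le> Vhat n * \<beta> + w * \<beta>" by linarith
        then show ?thesis by (simp add: w_def distrib_right)
      next
        case False
        have b: "(x0 + \<beta>) / 2 \<le> \<beta>" "0 < x0 + \<beta>" "0 \<le> \<beta>" using False R x0 by auto
        have "8 * \<delta> / \<theta> \<le> sqrt (x0 + \<beta>)"
          using False \<delta> \<theta> by (intro real_le_rsqrt) (auto simp: R_def)
        then have "8 * \<delta> / \<theta> * sqrt (x0 + \<beta>) \<le> sqrt (x0 + \<beta>) * sqrt (x0 + \<beta>)" using b by (intro mult_right_mono) auto
        then have "8 * \<delta> / \<theta> * sqrt (x0 + \<beta>) \<le> x0 + \<beta>" using b by simp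
        then have "2 * sqrt (x0 + \<beta>) \<le> \<theta> / (2 * \<delta>) * ((x0 + \<beta>) / 2)"
          using \<theta> \<delta> by (simp add: field_simps)
        also have "\<dots> \<le> \<theta> / (2 * \<delta>) * \<beta>" using b \<theta> \<delta> by (intro mult_left_mono) auto
        also have "\<dots> \<le> (Vhat n + w) * \<beta>"
        proof (rule mult_right_mono)
          have "\<theta> / \<delta> = \<theta> / (2 * \<delta>) + \<theta> / (2 * \<delta>)" using \<delta> by (simp add: field_simps)
          then show "\<theta> / (2 * \<delta>) \<le> Vhat n + w" using Vh w \<eta>(4) by (simp add: abs_le_iff)
        qed (rule b(3))
        finally have "2 * sqrt (x0 + \<beta>) \<le> (Vhat n + w) * \<beta>" .
        moreover have "?f (x0 + \<beta>) \<le> 2 * sqrt (x0 + \<beta>)"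
          using psi_bounds[OF \<beta>(2)] Yp by (intro sample_mean_le[OF n(1)]) auto
        moreover have "0 \<le> ?f x0"
          using psi_bounds[of x0] x0 Yp by (intro sample_mean_nonneg) auto
        ultimately show ?thesis by (simp add: w_def)
      qed
    qed
  qed
  show ?thesis by (rule whp_mono[OF \<open>whp ?Q\<close> main])
qed

end

section \<open>The limit of the slope\<close>

context sqrt_log_array
begin

lemma U_sharp_mono: "x \<le> x' \<Longrightarrow> sample_mean (Y n) n (psi x) \<omega> \<le> sample_mean (Y n) n (psi x') \<omega>"
  by (intro sample_mean_mono psi_mono)

text \<open>Near \<open>x0\<close> the negative quadratic drift dominates the nonlinear fluctuations at the points of the grid;
  between them \<open>U\<^sub>n\<^sup>#\<close> is monotone, hence bounded by its value at the next grid point. Further away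
  the line is a majorant by concavity.\<close>

lemma nearly_touching_majorant:
  assumes \<kappa>: "0 < \<kappa>"
  obtains K where "1 \<le> K" "whp (\<lambda>n \<omega>. \<forall>y\<ge>0.
      sample_mean (Y n) n (psi y) \<omega> \<le> sample_mean (Y n) n (psi x0) \<omega> + 4 * \<kappa> * (eps n)\<^sup>2
        + (Vhat n + eps n * linear_coeff K n \<omega>) * (y - x0))"
proof -
  obtain \<delta> where \<delta>: "0 < \<delta>" "\<delta> < x0"
    and drift: "\<And>\<kappa>. 0 < \<kappa> \<Longrightarrow> \<forall>\<^sub>F n in sequentially. \<forall>\<beta>. \<bar>\<beta>\<bar> \<le> \<delta> \<longrightarrow> drift n \<beta> \<le> V' / 8 * \<beta>\<^sup>2 + \<kappa> * (eps n)\<^sup>2"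
    using drift_le by blast
  define c where "c = - V' / 8"
  have c: "0 < c" using V'_neg by (simp add: c_def)
  obtain K where K: "1 \<le> K" and far: "whp (\<lambda>n \<omega>. \<forall>\<beta>\<in>grid \<delta> n. K * eps n \<le> \<bar>\<beta>\<bar> \<longrightarrow> remainder_dev K n \<beta> \<omega> \<le> c * \<beta>\<^sup>2)"
    using remainder_dev_far[OF c, of \<delta>] \<delta> by auto
  \<comment> \<open>half the radius leaves room for the grid point above \<open>\<beta>\<close>\<close>
  define \<delta>' where "\<delta>' = \<delta> / 2"
  have \<delta>': "0 < \<delta>'" "\<delta>' < x0" "\<delta>' < \<delta>" using \<delta> by (auto simp: \<delta>'_def)
  define \<theta> where "\<theta> = c * \<delta>'\<^sup>2 / 2"
  have \<theta>: "0 < \<theta>" using c \<delta>' by (simp add: \<theta>_def)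
  have small: "\<forall>\<^sub>F n in sequentially. (eps n)\<^sup>2 < \<theta>"
  proof -
    have lim: "(\<lambda>n. (eps n)\<^sup>2) \<longlonglongrightarrow> 0\<^sup>2" by (intro tendsto_intros eps_tendsto_0)
    show ?thesis by (rule order_tendstoD(2)[OF lim]) (use \<theta> in simp)
  qed
  have drift': "\<forall>\<^sub>F n in sequentially. drift n \<delta>' \<le> - \<theta> \<and> drift n (- \<delta>') \<le> - \<theta>"
    using drift[OF zero_less_one] small
  proof eventually_elim
    case (elim n)
    have "drift n \<delta>' \<le> V' / 8 * \<delta>'\<^sup>2 + (eps n)\<^sup>2" "drift n (- \<delta>') \<le> V' / 8 * \<delta>'\<^sup>2 + (eps n)\<^sup>2"
      using elim(1)[rule_format, of \<delta>'] elim(1)[rule_format, of "- \<delta>'"] \<delta>' by auto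
    then show ?case using elim(2) by (auto simp: \<theta>_def c_def)
  qed
  have K0: "0 < K" and \<delta>0: "0 \<le> \<delta>" using K \<delta> by auto
  note good = whp_conj[OF far whp_conj[OF remainder_dev_local[OF K \<kappa> \<delta>0] global_majorization[OF K0 \<delta>'(1,2) \<theta> drift']]]
  obtain A where A: "0 < A" "\<forall>\<^sub>F n in sequentially. \<bar>Vhat n\<bar> \<le> A" by (rule Vhat_bounded)
  have step: "\<forall>\<^sub>F n in sequentially. (A + 1) / \<kappa> < ln (real n)"
    using filterlim_at_top_dense[THEN iffD1, OF ln_at_top] by simp
  have fine: "\<forall>\<^sub>F n in sequentially. 1 < \<delta>' * real n"
    using \<delta>' by real_asymp
  have main: "\<forall>\<^sub>F n in sequentially. \<forall>\<omega>\<in>space M.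
      (\<forall>\<beta>\<in>grid \<delta> n. K * eps n \<le> \<bar>\<beta>\<bar> \<longrightarrow> remainder_dev K n \<beta> \<omega> \<le> c * \<beta>\<^sup>2) \<and>
      (\<forall>\<beta>\<in>grid \<delta> n. \<bar>\<beta>\<bar> \<le> K * eps n \<longrightarrow> remainder_dev K n \<beta> \<omega> \<le> 2 * \<kappa> * (eps n)\<^sup>2) \<and>
      \<bar>eps n * linear_coeff K n \<omega>\<bar> \<le> 1 \<and> (\<forall>\<beta>. \<delta>' \<le> \<bar>\<beta>\<bar> \<longrightarrow> 0 \<le> x0 + \<beta> \<longrightarrow>
        sample_mean (Y n) n (psi (x0 + \<beta>)) \<omega> - sample_mean (Y n) n (psi x0) \<omega> \<le> (Vhat n + eps n * linear_coeff K n \<omega>) * \<beta>) \<longrightarrow>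
      (\<forall>y\<ge>0. sample_mean (Y n) n (psi y) \<omega> \<le> sample_mean (Y n) n (psi x0) \<omega> + 4 * \<kappa> * (eps n)\<^sup>2
        + (Vhat n + eps n * linear_coeff K n \<omega>) * (y - x0))"
    using drift[OF \<kappa>] A(2) step fine eventually_ge_at_top[of 2]
  proof eventually_elim
    case (elim n)
    have n: "2 \<le> n" "0 < real n" using elim by auto
    show ?case
    proof (intro ballI allI impI, elim conjE)
      fix \<omega> y assume y: "0 \<le> (y::real)"
        and far: "\<forall>\<beta>\<in>grid \<delta> n. K * eps n \<le> \<bar>\<beta>\<bar> \<longrightarrow> remainder_dev K n \<beta> \<omega> \<le> c * \<beta>\<^sup>2"
        and near: "\<forall>\<beta>\<in>grid \<delta> n. \<bar>\<beta>\<bar> \<le> K * eps n \<longrightarrow> remainder_dev K n \<beta> \<omega> \<le> 2 * \<kappa> * (eps n)\<^sup>2"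
        and slope: "\<bar>eps n * linear_coeff K n \<omega>\<bar> \<le> 1"
        and outer: "\<forall>\<beta>. \<delta>' \<le> \<bar>\<beta>\<bar> \<longrightarrow> 0 \<le> x0 + \<beta> \<longrightarrow>
          sample_mean (Y n) n (psi (x0 + \<beta>)) \<omega> - sample_mean (Y n) n (psi x0) \<omega> \<le> (Vhat n + eps n * linear_coeff K n \<omega>) * \<beta>"
      let ?f = "\<lambda>x. sample_mean (Y n) n (psi x) \<omega>"
      define w where "w = eps n * linear_coeff K n \<omega>"
      define \<beta> where "\<beta> = y - x0"
      have k0: "0 \<le> \<kappa> * (eps n)\<^sup>2" using \<kappa> by simp
      have w1: "\<bar>w\<bar> \<le> 1" using slope by (simp add: w_def)
      have "?f (x0 + \<beta>) - ?f x0 \<le> 4 * \<kappa> * (eps n)\<^sup>2 + (Vhat n + w) * \<beta>"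
      proof (cases "\<delta>' \<le> \<bar>\<beta>\<bar>")
        case True
        then have "?f (x0 + \<beta>) - ?f x0 \<le> (Vhat n + w) * \<beta>"
        proof -
          have "0 \<le> x0 + \<beta>" using y by (simp add: \<beta>_def)
          then show ?thesis using outer True unfolding w_def by blast
        qed
        then show ?thesis using k0 by linarith
      next
        case False
        \<comment> \<open>\<open>b\<close> is the grid point just above \<open>\<beta>\<close>, so that monotonicity bounds the increment from above\<close>
        define j where "j = \<lceil>\<beta> * real n\<rceil>"
        define b where "b = real_of_int j / real n"
        have j: "\<beta> * real n \<le> real_of_int j" "real_of_int j < \<beta> * real n + 1" unfolding j_def by linarith+
        have b: "\<beta> \<le> b" "b - \<beta> \<le> 1 / real n"
        proof -
          show "\<beta> \<le> b" using j n by (simp add: b_def pos_le_divide_eq)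
          have "b \<le> (\<beta> * real n + 1) / real n" unfolding b_def using j n by (intro divide_right_mono) auto
          then show "b - \<beta> \<le> 1 / real n" using n by (simp add: add_divide_distrib)
        qed
        have "\<bar>\<beta> * real n\<bar> \<le> \<delta>' * real n" using False n by (simp add: abs_mult)
        then have "\<bar>real_of_int j\<bar> \<le> \<delta>' * real n + 1" using j by linarith
        also have "\<dots> \<le> \<delta> * real n" using elim(4) by (simp add: \<delta>'_def)
        finally have jb: "\<bar>real_of_int j\<bar> \<le> \<delta> * real n" .
        then have grid: "b \<in> grid \<delta> n"
          unfolding grid_def b_def by (intro imageI) (auto simp: abs_le_iff le_floor_iff minus_le_iff)
        have b\<delta>: "\<bar>b\<bar> \<le> \<delta>" using jb n by (simp add: b_def pos_divide_le_eq)
        have b0: "0 \<le> x0 + b" using b y by (simp add: \<beta>_def)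
        have dr: "drift n b \<le> - (c * b\<^sup>2) + \<kappa> * (eps n)\<^sup>2" using elim(1) b\<delta> by (simp add: c_def)
        have X: "remainder_dev K n b \<omega> \<le> c * b\<^sup>2 + 2 * \<kappa> * (eps n)\<^sup>2"
        proof (cases "\<bar>b\<bar> \<le> K * eps n")
          case True
          then have "remainder_dev K n b \<omega> \<le> 2 * \<kappa> * (eps n)\<^sup>2" using near grid by auto
          moreover have "0 \<le> c * b\<^sup>2" using c by simp
          ultimately show ?thesis by linarith
        next
          case False
          then have "remainder_dev K n b \<omega> \<le> c * b\<^sup>2" using far grid by auto
          then show ?thesis using k0 by linarith
        qed
        have "?f (x0 + b) - ?f x0 = (U_n (\<mu> n) (x0 + b) - U_n (\<mu> n) x0) + remainder_dev K n b \<omega> + b * w"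
          using U_sharp_increment[OF n(1) b0, of K] K by (simp add: U_sharp_eq_sample_mean w_def)
        then have "?f (x0 + b) - ?f x0 = drift n b + remainder_dev K n b \<omega> + (Vhat n + w) * b"
          by (simp add: drift_def algebra_simps)
        moreover have "?f (x0 + \<beta>) \<le> ?f (x0 + b)" using b by (intro U_sharp_mono) simp
        moreover have "(Vhat n + w) * b - (Vhat n + w) * \<beta> \<le> \<kappa> * (eps n)\<^sup>2"
        proof -
          have "(Vhat n + w) * (b - \<beta>) \<le> (A + 1) * (b - \<beta>)"
            using elim(2) w1 b by (intro mult_right_mono) auto
          also have "\<dots> \<le> (A + 1) * (1 / real n)" using b A by (intro mult_left_mono) auto
          also have "\<dots> \<le> \<kappa> * (eps n)\<^sup>2"
          proof -
            have "A + 1 \<le> \<kappa> * (real n * (eps n)\<^sup>2)"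
              using elim(3) \<kappa> n by (simp add: n_eps_sq pos_divide_less_eq mult.commute)
            then show ?thesis using n by (simp add: pos_divide_le_eq mult_ac)
          qed
          finally show ?thesis by (simp add: right_diff_distrib)
        qed
        ultimately show ?thesis using dr X by linarith
      qed
      then show "?f y \<le> ?f x0 + 4 * \<kappa> * (eps n)\<^sup>2 + (Vhat n + eps n * linear_coeff K n \<omega>) * (y - x0)"
        by (simp add: \<beta>_def w_def)
    qed
  qed
  show ?thesis by (rule that[OF K whp_mono[OF good main]])
qed

lemma remainder_dev_pointwise:
  assumes K: "1 \<le> K" and t: "\<bar>t\<bar> \<le> K" and \<kappa>: "0 < \<kappa>"
  shows "whp (\<lambda>n \<omega>. \<bar>remainder_dev K n (eps n * t) \<omega>\<bar> \<le> \<kappa> * (eps n)\<^sup>2)"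
proof -
  obtain B where B: "0 < B" "\<forall>\<^sub>F n in sequentially. mass_bound (\<mu> n) x0 B (eps n)" by (rule mass_bound_eventually)
  define F where "F n = {\<omega> \<in> space M. \<kappa> * (eps n)\<^sup>2 \<le> \<bar>remainder_dev K n (eps n * t) \<omega>\<bar>}" for n
  have "\<forall>\<^sub>F n in sequentially. F n \<in> events \<and> prob (F n) \<le> 20 * B * K\<^sup>2 / \<kappa>\<^sup>2 * (1 / ln (real n))
      \<and> (\<forall>\<omega>\<in>space M - F n. \<bar>remainder_dev K n (eps n * t) \<omega>\<bar> \<le> \<kappa> * (eps n)\<^sup>2)"
    using B(2) eventually_ge_at_top[of 2]
  proof eventually_elim
    case (elim n)
    have "eps n * \<bar>t\<bar> \<le> eps n * K" using t eps_nonneg by (intro mult_left_mono)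
    then have "\<bar>eps n * t\<bar> \<le> K * eps n" using eps_nonneg[of n] by (simp add: abs_mult mult.commute)
    then have "prob (F n) \<le> 20 * B * K\<^sup>2 / \<kappa>\<^sup>2 * (1 / ln (real n))" using remainder_dev_chebyshev[OF elim K _ \<kappa>] by (simp add: F_def)
    moreover have "remainder_dev K n (eps n * t) \<in> borel_measurable M" using elim by (intro remainder_dev_measurable) simp
    ultimately show ?case by (auto simp: F_def)
  qed
  moreover have "(\<lambda>n. 20 * B * K\<^sup>2 / \<kappa>\<^sup>2 * (1 / ln (real n))) \<longlonglongrightarrow> 20 * B * K\<^sup>2 / \<kappa>\<^sup>2 * 0"
    by (rule tendsto_mult_left) real_asymp
  ultimately show ?thesis by (intro whpI) simp_all
qed

text \<open>The derivative of the majorant lies between slopes of chords from \<open>x0\<close> to \<open>x0 \<plusminus> \<tau> \<epsilon>\<^sub>n\<close>, up to the gap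
  \<open>4 \<kappa> (\<epsilon>\<^sub>n)\<^sup>2\<close> of the almost touching line. After division by \<open>\<tau> (\<epsilon>\<^sub>n)\<^sup>2\<close> the drift contributes \<open>\<tau> \<bar>V'\<bar> / 2\<close> and
  the other errors \<open>6 \<kappa> / \<tau>\<close>; the choice of \<open>\<tau>\<close> and then of \<open>\<kappa>\<close> makes both at most \<open>\<eta> / 2\<close>.\<close>

lemma slope_approximation:
  assumes \<eta>: "0 < \<eta>"
  obtains K where "1 \<le> K"
    "whp (\<lambda>n \<omega>. \<bar>(V_tilde_sharp n (\<lambda>i. Y n i \<omega>) x0 - Vhat n) / eps n - linear_coeff K n \<omega>\<bar> \<le> \<eta>)"
proof -
  define \<tau> where "\<tau> = min 1 (\<eta> / \<bar>V'\<bar>)"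
  have \<tau>: "0 < \<tau>" "\<tau> \<le> 1" "\<tau> * \<bar>V'\<bar> \<le> \<eta>"
    using \<eta> V'_neg by (auto simp: \<tau>_def min_def field_simps)
  define \<kappa> where "\<kappa> = \<eta> * \<tau> / 12"
  have \<kappa>: "0 < \<kappa>" "6 * \<kappa> / \<tau> = \<eta> / 2" using \<eta> \<tau> by (auto simp: \<kappa>_def)
  obtain K where K: "1 \<le> K" and touch: "whp (\<lambda>n \<omega>. \<forall>y\<ge>0.
      sample_mean (Y n) n (psi y) \<omega> \<le> sample_mean (Y n) n (psi x0) \<omega> + 4 * \<kappa> * (eps n)\<^sup>2
        + (Vhat n + eps n * linear_coeff K n \<omega>) * (y - x0))" by (rule nearly_touching_majorant[OF \<kappa>(1)])
  have t: "\<bar>\<tau>\<bar> \<le> K" "\<bar>- \<tau>\<bar> \<le> K" using \<tau> K by auto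
  note good = whp_conj[OF touch whp_conj[OF remainder_dev_pointwise[OF K t(1) \<kappa>(1)] remainder_dev_pointwise[OF K t(2) \<kappa>(1)]]]
  have near: "\<forall>\<^sub>F n in sequentially. eps n < x0" using order_tendstoD(2)[OF eps_tendsto_0 x0] .
  have main: "\<forall>\<^sub>F n in sequentially. \<forall>\<omega>\<in>space M.
      (\<forall>y\<ge>0. sample_mean (Y n) n (psi y) \<omega> \<le> sample_mean (Y n) n (psi x0) \<omega> + 4 * \<kappa> * (eps n)\<^sup>2
        + (Vhat n + eps n * linear_coeff K n \<omega>) * (y - x0)) \<and>
      \<bar>remainder_dev K n (eps n * \<tau>) \<omega>\<bar> \<le> \<kappa> * (eps n)\<^sup>2 \<and> \<bar>remainder_dev K n (eps n * - \<tau>) \<omega>\<bar> \<le> \<kappa> * (eps n)\<^sup>2 \<longrightarrow>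
      \<bar>(V_tilde_sharp n (\<lambda>i. Y n i \<omega>) x0 - Vhat n) / eps n - linear_coeff K n \<omega>\<bar> \<le> \<eta>"
    using drift_local[OF \<kappa>(1), of 1] near eventually_ge_at_top[of 2]
  proof eventually_elim
    case (elim n)
    have n: "2 \<le> n" using elim by auto
    have e: "0 < eps n" using eps_pos[OF n] .
    show ?case
    proof (intro ballI impI, elim conjE)
      fix \<omega> assume touch: "\<forall>y\<ge>0. sample_mean (Y n) n (psi y) \<omega> \<le> sample_mean (Y n) n (psi x0) \<omega> + 4 * \<kappa> * (eps n)\<^sup>2
        + (Vhat n + eps n * linear_coeff K n \<omega>) * (y - x0)"
        and small: "\<bar>remainder_dev K n (eps n * \<tau>) \<omega>\<bar> \<le> \<kappa> * (eps n)\<^sup>2" "\<bar>remainder_dev K n (eps n * - \<tau>) \<omega>\<bar> \<le> \<kappa> * (eps n)\<^sup>2"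
      define h where "h = U_sharp n (\<lambda>i. Y n i \<omega>)"
      define k s d w where "k = 4 * \<kappa> * (eps n)\<^sup>2" and "s = Vhat n + eps n * linear_coeff K n \<omega>" and "d = eps n * \<tau>" and "w = linear_coeff K n \<omega>"
      have h: "h y \<le> h x0 + k + s * (y - x0)" if "0 \<le> y" for y
        using touch that by (simp add: h_def U_sharp_eq_sample_mean k_def s_def)
      have d: "0 < d" "d \<le> x0"
      proof -
        have "eps n * \<tau> \<le> eps n" using \<tau>(2) e by simp
        then show "d \<le> x0" using elim(2) unfolding d_def by linarith
        show "0 < d" using e \<tau>(1) by (simp add: d_def)
      qed
      define D where "D = V_tilde_sharp n (\<lambda>i. Y n i \<omega>) x0"
      have D: "(h (x0 + d) - h x0 - k) / d \<le> D" "D \<le> (h x0 + k - h (x0 - d)) / d"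
        using right_deriv_least_concave_majorant_bounds[OF x0 h d] by (simp_all add: D_def V_tilde_sharp_def h_def)
      have inc: "h (x0 + \<beta>) - h x0 = drift n \<beta> + remainder_dev K n \<beta> \<omega> + (Vhat n + eps n * w) * \<beta>" if "0 \<le> x0 + \<beta>" for \<beta>
        using U_sharp_increment[OF n that, of K] K by (simp add: h_def drift_def w_def algebra_simps)
      have X: "\<bar>remainder_dev K n d \<omega>\<bar> \<le> \<kappa> * (eps n)\<^sup>2" "\<bar>remainder_dev K n (- d) \<omega>\<bar> \<le> \<kappa> * (eps n)\<^sup>2"
        using small by (simp_all add: d_def)
      have dr: "\<bar>drift n d - 1/2 * d\<^sup>2 * V'\<bar> \<le> \<kappa> * (eps n)\<^sup>2" "\<bar>drift n (- d) - 1/2 * d\<^sup>2 * V'\<bar> \<le> \<kappa> * (eps n)\<^sup>2"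
        using elim(1)[rule_format, of \<tau>] elim(1)[rule_format, of "- \<tau>"] \<tau> by (auto simp: d_def)
      have half: "(6 * \<kappa> * (eps n)\<^sup>2 - 1/2 * d\<^sup>2 * V') / d \<le> \<eta> * eps n"
      proof -
        have "(6 * \<kappa> * (eps n)\<^sup>2 - 1/2 * d\<^sup>2 * V') / d = eps n * (6 * \<kappa> / \<tau> + \<tau> * \<bar>V'\<bar> / 2)"
          using e \<tau> V'_neg by (simp add: d_def field_simps power2_eq_square)
        also have "\<dots> \<le> eps n * (\<eta> / 2 + \<eta> / 2)" using \<kappa>(2) \<tau>(3) e by (intro mult_left_mono add_mono) auto
        finally show ?thesis by (simp add: mult.commute)
      qed
      have "(h x0 + k - h (x0 - d)) / d \<le> (6 * \<kappa> * (eps n)\<^sup>2 - 1/2 * d\<^sup>2 * V' + (Vhat n + eps n * w) * d) / d"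
        using inc[of "- d"] d X(2) dr(2) by (intro divide_right_mono) (auto simp: k_def abs_le_iff)
      also have "\<dots> = (6 * \<kappa> * (eps n)\<^sup>2 - 1/2 * d\<^sup>2 * V') / d + (Vhat n + eps n * w)"
        using d by (simp add: add_divide_distrib)
      finally have up: "D \<le> \<eta> * eps n + (Vhat n + eps n * w)" using D(2) half by linarith
      have "(h (x0 + d) - h x0 - k) / d \<ge> (- (6 * \<kappa> * (eps n)\<^sup>2 - 1/2 * d\<^sup>2 * V') + (Vhat n + eps n * w) * d) / d"
        using inc[of d] d X(1) dr(1) x0 by (intro divide_right_mono) (auto simp: k_def abs_le_iff)
      moreover have "(- (6 * \<kappa> * (eps n)\<^sup>2 - 1/2 * d\<^sup>2 * V') + (Vhat n + eps n * w) * d) / d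
          = - ((6 * \<kappa> * (eps n)\<^sup>2 - 1/2 * d\<^sup>2 * V') / d) + (Vhat n + eps n * w)"
        using d by (simp add: add_divide_distrib diff_divide_distrib)
      ultimately have lo: "- (\<eta> * eps n) + (Vhat n + eps n * w) \<le> D" using D(1) half by linarith
      have "\<bar>(D - Vhat n) / eps n - w\<bar> = \<bar>D - Vhat n - eps n * w\<bar> / eps n"
      proof -
        have "(D - Vhat n) / eps n - w = (D - Vhat n - eps n * w) / eps n" using e by (simp add: diff_divide_distrib)
        then show ?thesis using e by (simp add: abs_divide)
      qed
      also have "\<dots> \<le> \<eta>" using up lo e by (simp add: pos_divide_le_eq abs_le_iff)
      finally show "\<bar>(V_tilde_sharp n (\<lambda>i. Y n i \<omega>) x0 - Vhat n) / eps n - linear_coeff K n \<omega>\<bar> \<le> \<eta>"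
        by (simp add: D_def w_def)
    qed
  qed
  show ?thesis by (rule that[OF K whp_mono[OF good main]])
qed

lemma slope_weak_limit:
  assumes D: "\<And>n. (\<lambda>\<omega>. (V_tilde_sharp n (\<lambda>i. Y n i \<omega>) x0 - Vhat n) / eps n) \<in> borel_measurable M"
  shows "weak_conv_m (\<lambda>n. distr M borel (\<lambda>\<omega>. (V_tilde_sharp n (\<lambda>i. Y n i \<omega>) x0 - Vhat n) / eps n))
    (density lborel (normal_density 0 (sqrt (g_dens \<rho> x0 / 2))))" (is "weak_conv_m _ ?L")
proof (rule weak_conv_of_approximations[OF D])
  have "0 < sqrt (g_dens \<rho> x0 / 2)" using g by simp
  then interpret L: prob_space ?L by (rule prob_space_normal_density)
  interpret L: real_distribution ?L by standard auto
  show "isCont (cdf ?L) x" for x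
  proof -
    have "emeasure ?L {x} = (\<integral>\<^sup>+y. ennreal (normal_density 0 (sqrt (g_dens \<rho> x0 / 2)) y) * indicator {x} y \<partial>lborel)"
      by (rule emeasure_density) auto
    also have "\<dots> = 0" by simp
    finally show ?thesis by (simp add: L.isCont_cdf measure_def)
  qed
  fix \<eta> :: real assume "0 < \<eta>"
  then obtain K where K: "1 \<le> K"
    "whp (\<lambda>n \<omega>. \<bar>(V_tilde_sharp n (\<lambda>i. Y n i \<omega>) x0 - Vhat n) / eps n - linear_coeff K n \<omega>\<bar> \<le> \<eta>)"
    by (rule slope_approximation)
  show "\<exists>W. (\<forall>\<^sub>F n in sequentially. W n \<in> borel_measurable M) \<and>
      whp (\<lambda>n \<omega>. \<bar>(V_tilde_sharp n (\<lambda>i. Y n i \<omega>) x0 - Vhat n) / eps n - W n \<omega>\<bar> \<le> \<eta>) \<and>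
      weak_conv_m (\<lambda>n. distr M borel (W n)) ?L"
  proof (intro exI conjI)
    show "\<forall>\<^sub>F n in sequentially. linear_coeff K n \<in> borel_measurable M"
      using eventually_ge_at_top[of 1] by eventually_elim (rule linear_coeff_measurable)
    show "whp (\<lambda>n \<omega>. \<bar>(V_tilde_sharp n (\<lambda>i. Y n i \<omega>) x0 - Vhat n) / eps n - linear_coeff K n \<omega>\<bar> \<le> \<eta>)" by (rule K(2))
    show "weak_conv_m (\<lambda>n. distr M borel (linear_coeff K n)) ?L" using K(1) by (intro linear_coeff_limit) simp
  qed
qed

end

lemma V_tilde_sharp_cong:
  "(\<And>i. i \<in> {1..n} \<Longrightarrow> y i = z i) \<Longrightarrow> V_tilde_sharp n y = V_tilde_sharp n z"
proof -
  assume "\<And>i. i \<in> {1..n} \<Longrightarrow> y i = z i"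
  then have "U_sharp n y = U_sharp n z" by (auto simp: U_sharp_def fun_eq_iff)
  then show ?thesis by (simp add: V_tilde_sharp_def)
qed

lemma quantile_measurable:
  assumes "real_distribution \<mu>"
  shows "quantile (cdf \<mu>) \<in> borel_measurable borel"
proof -
  interpret cdf_distribution \<mu> unfolding cdf_distribution_def by (rule assms)
  \<comment> \<open>outside the open unit interval the quantile takes at most three values\<close>
  define q where "q u = (if u \<in> {0<..<1} then I u else if u \<le> 0 then Inf (UNIV :: real set) else if u = 1 then I 1 else Inf ({} :: real set))" for u
  have "quantile C u = q u" for u
  proof -
    consider "u \<in> {0<..<1}" | "u \<le> 0" | "u = 1" | "1 < u" by force
    then show ?thesis
    proof cases
      case 2
      then have "{x. C x \<ge> u} = UNIV" using cdf_nonneg by (auto intro: order_trans)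
      then show ?thesis using 2 by (simp add: quantile_def q_def)
    next
      case 4
      then have "{x. C x \<ge> u} = {}" using cdf_bounded_prob by (auto simp: not_le intro: le_less_trans)
      then show ?thesis using 4 by (simp add: quantile_def q_def)
    qed (auto simp: quantile_def q_def)
  qed
  then have "quantile C = q" by auto
  moreover have "q \<in> borel_measurable borel"
  proof -
    have inside: "I \<in> borel_measurable (restrict_space borel {u. u \<in> {0<..<1}})"
      using measurable_CI by (simp only: Collect_mem_eq)
    have "(\<lambda>u::real. if u \<le> 0 then Inf (UNIV :: real set) else if u = 1 then I 1 else Inf ({} :: real set)) \<in> borel_measurable borel"
      by measurable
    from measurable_restrict_space1[OF this] inside show ?thesis
      unfolding q_def by (subst measurable_If_restrict_space_iff) (simp, blast)
  qed
  ultimately show ?thesis by simp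
qed

lemma distr_quantile:
  assumes "real_distribution \<mu>"
  shows "distr (uniform_measure lborel {0<..<1}) borel (quantile (cdf \<mu>)) = \<mu>"
proof -
  interpret cdf_distribution \<mu> unfolding cdf_distribution_def by (rule assms)
  have I: "I = quantile C" by (simp add: quantile_def fun_eq_iff)
  have q[measurable]: "quantile C \<in> borel_measurable borel" by (rule quantile_measurable[OF assms])
  have "distr (uniform_measure lborel {0<..<1}) borel (quantile C) = distr (restrict_space lborel {0<..<1}) borel I"
  proof (rule measure_eqI)
    fix A :: "real set" assume "A \<in> sets (distr (uniform_measure lborel {0<..<1}) borel (quantile C))"
    then have [measurable]: "A \<in> sets borel" by simp
    have m: "quantile C -` A \<in> sets borel" using measurable_sets[OF q, of A] by simp
    have "emeasure (distr (uniform_measure lborel {0<..<1}) borel (quantile C)) A = emeasure lborel ({0<..<1} \<inter> quantile C -` A)"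
      using m by (subst emeasure_distr) (auto simp: divide_ennreal_def)
    also have "\<dots> = emeasure (distr (restrict_space lborel {0<..<1}) borel I) A"
      unfolding I using q by (subst emeasure_distr)
        (auto intro: measurable_restrict_space1 simp: space_restrict_space emeasure_restrict_space Int_commute)
    finally show "emeasure (distr (uniform_measure lborel {0<..<1}) borel (quantile C)) A = emeasure (distr (restrict_space lborel {0<..<1}) borel I) A" .
  qed simp
  then show ?thesis using distr_I_eq_M by simp
qed

lemma iid_sample_quantile:
  assumes M: "prob_space M" and \<mu>: "real_distribution \<mu>" and n: "1 \<le> n"
    and ind: "prob_space.indep_vars M (\<lambda>_. borel) T {1..}"
    and unif: "\<forall>i\<ge>1. distr M borel (T i) = uniform_measure lborel {0<..<1}"
  shows "iid_sample M \<mu> (\<lambda>i \<omega>. quantile (cdf \<mu>) (T i \<omega>)) n"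
proof -
  interpret prob_space M by fact
  have q: "quantile (cdf \<mu>) \<in> borel_measurable borel" by (rule quantile_measurable[OF \<mu>])
  show ?thesis
  proof (intro iid_sample.intro iid_sample_axioms.intro M \<mu>)
    show "0 < n" using n by simp
    have "indep_vars (\<lambda>_. borel) T {1..n}" by (rule indep_vars_subset[OF ind]) auto
    then show "indep_vars (\<lambda>_. borel) (\<lambda>i \<omega>. quantile (cdf \<mu>) (T i \<omega>)) {1..n}"
      by (rule indep_vars_compose2) (rule q)
    fix i assume i: "i \<in> {1..n}"
    then have T: "T i \<in> borel_measurable M" using ind by (auto simp: indep_vars_def)
    have "distr M borel (\<lambda>\<omega>. quantile (cdf \<mu>) (T i \<omega>)) = distr (distr M borel (T i)) borel (quantile (cdf \<mu>))"
      using distr_distr[OF q T] by (simp add: comp_def)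
    also have "\<dots> = \<mu>" using unif i distr_quantile[OF \<mu>] by simp
    finally show "distr M borel (\<lambda>\<omega>. quantile (cdf \<mu>) (T i \<omega>)) = \<mu>" .
  qed
qed

text \<open>The majorant lemma asks for a measurable sequence, but only \<open>T i\<close> with \<open>i \<ge> 1\<close> is known to be measurable;
  the slope sees only the indices \<open>1, \<dots>, n\<close>.\<close>

lemma measurable_slope_statistic:
  assumes "prob_space M" and x: "0 < x" and \<mu>: "\<And>n. 1 \<le> n \<Longrightarrow> real_distribution (\<mu> n)"
    and ind: "prob_space.indep_vars M (\<lambda>_. borel) T {1..}"
  shows "(\<lambda>\<omega>. V_tilde_sharp n (\<lambda>i. quantile (cdf (\<mu> n)) (T i \<omega>)) x) \<in> borel_measurable M"
proof -
  interpret prob_space M by fact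
  define Z where "Z i \<omega> = (if i \<in> {1..n} then quantile (cdf (\<mu> n)) (T i \<omega>) else 0)" for i \<omega>
  have "Z i \<in> borel_measurable M" for i
  proof (cases "i \<in> {1..n}")
    case True
    then have "T i \<in> borel_measurable M" using ind by (auto simp: indep_vars_def)
    moreover have "quantile (cdf (\<mu> n)) \<in> borel_measurable borel" using True by (intro quantile_measurable \<mu>) simp
    moreover have "Z i = (\<lambda>\<omega>. quantile (cdf (\<mu> n)) (T i \<omega>))" using True by (simp add: Z_def fun_eq_iff)
    ultimately show ?thesis using measurable_compose by simp
  next
    case False
    then have "Z i = (\<lambda>_. 0)" by (simp only: Z_def fun_eq_iff if_False) simp
    then show ?thesis by simp
  qed
  then have "(\<lambda>\<omega>. V_tilde_sharp n (\<lambda>i. Z i \<omega>) x) \<in> borel_measurable M" using x by (rule measurable_V_tilde_sharp)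
  moreover have "V_tilde_sharp n (\<lambda>i. Z i \<omega>) = V_tilde_sharp n (\<lambda>i. quantile (cdf (\<mu> n)) (T i \<omega>))" for \<omega>
    by (rule V_tilde_sharp_cong) (simp add: Z_def)
  ultimately show ?thesis by simp
qed

theorem corollary2p1:
  fixes P :: "'p measure" and X1 X2 X3 :: "'p \<Rightarrow> real" and \<rho> :: "real \<Rightarrow> real"
    and G :: "real \<Rightarrow> real"
    and \<mu> :: "nat \<Rightarrow> real measure"
    and M :: "'m measure" and T :: "nat \<Rightarrow> 'm \<Rightarrow> real"
    and N :: "'w measure" and W :: "'w \<Rightarrow> real"
    and x0 V' :: real and Vhat :: "nat \<Rightarrow> real"
  assumes "prob_space P"
    and "\<forall>z\<ge>0. 0 \<le> \<rho> z"
    and "distributed P lborel (\<lambda>\<omega>. (X1 \<omega>, X2 \<omega>, X3 \<omega>))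
           (\<lambda>(x1, x2, x3). ennreal (\<rho> (x1\<^sup>2 + x2\<^sup>2 + x3\<^sup>2)))"
    and G: "G = cdf (distr P borel (\<lambda>\<omega>. (X1 \<omega>)\<^sup>2 + (X2 \<omega>)\<^sup>2))"
    and "x0 > 0" and "g_dens \<rho> x0 > 0"
    and V': "(V_fun \<rho> has_real_derivative V') (at x0)" and "V' \<noteq> 0"
    and mu: "\<forall>n\<ge>1. real_distribution (\<mu> n) \<and> measure (\<mu> n) {..<0} = 0"
    and "prob_space M"
    and "prob_space.indep_vars M (\<lambda>_. borel) T {1..}"
    and "\<forall>i\<ge>1. distr M borel (T i) = uniform_measure lborel {0<..<1}"
    and Vhat: "(\<forall>n\<ge>1. V_n (\<mu> n) x0 < \<infinity> \<and> Vhat n = enn2real (V_n (\<mu> n) x0))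
             \<or> (\<forall>n\<ge>1. Vhat n = V_tilde (\<mu> n) x0)"
    and a: "(\<lambda>n. SUP t. \<bar>cdf (\<mu> n) t - G t\<bar>) \<in> O(eps)"
    and b: "\<forall>K. compact K \<longrightarrow>
              uniform_limit K
                (\<lambda>n t. (U_n (\<mu> n) (x0 + eps n * t) - U_n (\<mu> n) x0 - Vhat n * eps n * t) / (eps n)\<^sup>2)
                (\<lambda>t. 1/2 * t\<^sup>2 * V') sequentially"
    and c: "\<forall>e>0. \<exists>(r :: real \<Rightarrow> real) C \<delta>. \<delta> > 0 \<and> r \<in> o[at 0](\<lambda>\<beta>. \<beta>\<^sup>2) \<and>
              (\<forall>\<^sub>F n in sequentially. \<forall>\<beta>. \<bar>\<beta>\<bar> < \<delta> \<longrightarrow>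
                 \<bar>U_n (\<mu> n) (x0 + \<beta>) - U_n (\<mu> n) x0 - \<beta> * Vhat n - 1/2 * \<beta>\<^sup>2 * V'\<bar>
                   \<le> e * \<beta>\<^sup>2 + r \<beta> + C * (eps n)\<^sup>2)"
    and "prob_space N"
    and W: "distributed N lborel W (normal_density 0 (sqrt (1/2 * g_dens \<rho> x0)))"
  shows "weak_conv_m
           (\<lambda>n. distr M borel (\<lambda>\<omega>.
              (V_tilde_sharp n (\<lambda>i. quantile (cdf (\<mu> n)) (T i \<omega>)) x0 - Vhat n) / eps n))
           (distr N borel W)
       \<and> distr N borel W
           = distr N borel (\<lambda>\<omega>. right_deriv (least_concave_majorant UNIV (\<lambda>t. t * W \<omega> + 1/2 * t\<^sup>2 * V')) 0)"
proof -
  define \<nu> where "\<nu> = distr P borel (\<lambda>\<omega>. (X1 \<omega>)\<^sup>2 + (X2 \<omega>)\<^sup>2)"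
  interpret M: prob_space M by fact
  have law: "radial_law \<nu> (\<lambda>z. ennreal (\<rho> \<bar>z\<bar>))"
    unfolding \<nu>_def using assms(1,3) by (rule radial_law_sum_of_squares)
  then interpret radial_law \<nu> "\<lambda>z. ennreal (\<rho> \<bar>z\<bar>)" .
  interpret radial_density \<nu> "\<lambda>z. ennreal (\<rho> \<bar>z\<bar>)" \<rho>
    by unfold_locales (use assms(2) in auto)
  have V'_neg: "V' < 0"
    using V_fun_deriv_nonpos[OF \<open>x0 > 0\<close> V'] \<open>V' \<noteq> 0\<close> by simp
  have cdf_close: "\<exists>C>0. \<forall>\<^sub>F n in sequentially. \<forall>t. \<bar>cdf (\<mu> n) t - cdf \<nu> t\<bar> \<le> C * eps n"
  proof -
    obtain C where C: "0 < C" "\<forall>\<^sub>F n in sequentially. norm (SUP t. \<bar>cdf (\<mu> n) t - G t\<bar>) \<le> C * norm (eps n)"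
      using landau_o.bigE[OF a] by blast
    have "\<forall>\<^sub>F n in sequentially. \<forall>t. \<bar>cdf (\<mu> n) t - cdf \<nu> t\<bar> \<le> C * eps n"
      using C(2) eventually_ge_at_top[of 1]
    proof eventually_elim
      case (elim n)
      interpret \<mu>: real_distribution "\<mu> n" using mu elim by auto
      have "bdd_above (range (\<lambda>t. \<bar>cdf (\<mu> n) t - cdf \<nu> t\<bar>))"
      proof (rule bdd_aboveI2)
        show "\<bar>cdf (\<mu> n) t - cdf \<nu> t\<bar> \<le> 1" for t
          using \<mu>.cdf_nonneg[of t] \<mu>.cdf_bounded_prob[of t] cdf_nonneg[of t] cdf_bounded_prob[of t] by linarith
      qed
      then have "\<bar>cdf (\<mu> n) t - cdf \<nu> t\<bar> \<le> (SUP t. \<bar>cdf (\<mu> n) t - cdf \<nu> t\<bar>)" for t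
        by (intro cSUP_upper) auto
      moreover have "(SUP t. \<bar>cdf (\<mu> n) t - cdf \<nu> t\<bar>) \<le> C * eps n"
        using elim(1) eps_nonneg[of n] unfolding G \<nu>_def[symmetric] by (simp add: abs_le_iff)
      ultimately show ?case by (blast intro: order_trans)
    qed
    then show ?thesis using C(1) by blast
  qed
  interpret array: sqrt_log_array M \<nu> "\<lambda>z. ennreal (\<rho> \<bar>z\<bar>)" \<rho> \<mu> "\<lambda>n i \<omega>. quantile (cdf (\<mu> n)) (T i \<omega>)" x0 V' Vhat
  proof (intro sqrt_log_array.intro sqrt_log_array_axioms.intro)
    fix n :: nat assume n: "1 \<le> n"
    show "iid_sample M (\<mu> n) (\<lambda>i \<omega>. quantile (cdf (\<mu> n)) (T i \<omega>)) n"
      using mu n by (intro iid_sample_quantile assms) auto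
    show "nonneg_real_distribution (\<mu> n)"
      using mu n by (auto simp: nonneg_real_distribution_def nonneg_real_distribution_axioms_def)
  qed (use M.prob_space_axioms radial_density_axioms assms(5,6) V' V'_neg cdf_close b c in blast)+
  have W_distr: "distr N borel W = density lborel (normal_density 0 (sqrt (g_dens \<rho> x0 / 2)))"
  proof -
    have "distr N borel W = distr N lborel W" by (rule distr_cong) auto
    then show ?thesis using W by (simp add: distributed_def)
  qed
  have stat: "(\<lambda>\<omega>. (V_tilde_sharp n (\<lambda>i. quantile (cdf (\<mu> n)) (T i \<omega>)) x0 - Vhat n) / eps n) \<in> borel_measurable M" for n
    using measurable_slope_statistic[OF \<open>prob_space M\<close> \<open>x0 > 0\<close>, of \<mu> T n] mu assms(11) by simp
  have "(\<lambda>\<omega>. right_deriv (least_concave_majorant UNIV (\<lambda>t. t * W \<omega> + 1/2 * t\<^sup>2 * V')) 0) = W"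
    using V'_neg by (intro ext right_deriv_majorant_parabola) simp
  then have "distr N borel W
      = distr N borel (\<lambda>\<omega>. right_deriv (least_concave_majorant UNIV (\<lambda>t. t * W \<omega> + 1/2 * t\<^sup>2 * V')) 0)"
    by (simp only:)
  with array.slope_weak_limit[OF stat, folded W_distr] show ?thesis by blast
qed

end
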